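(* Let $N\ge2$, $\alpha,b,c\in\mathbb{R}$, $1\le p\le\infty$, $n\in\mathbb{N}_0$. There exists $C>0$ such that $\||x|^\alpha Lu\|_p\ge C\||x|^{\alpha-2}u\|_p$ for every $u\in C_c^\infty(\mathbb{R}^N\setminus\{0\})\cap L^p_n$ if and only if $b+\lambda_n\notin\mathcal{P}_{p,\alpha,c}$. If, in addition, $b+\lambda_n+\bigl(\frac N2-1+\frac c2\bigr)^2\ge0$, the optimal constant is $C=|b+\lambda_n+\gamma_p(\alpha,c)|$. In particular, for $b=c=0$ the inequality holds on $L^p_n$ iff $\alpha\ne\frac N{p'}+n$ and $\alpha\ne-\frac Np+2-n$, with optimal constant $\bigl|(\frac Np-2+\alpha+n)(\frac N{p'}-\alpha+n)\bigr|$.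
   Context: $Lu=\Delta u+c\frac{x}{|x|^2}\cdot\nabla u-\frac b{|x|^2}u$; norms are $L^p(\mathbb{R}^N)$ norms. In polar coordinates $x=\rho\omega$, $L^p_n$ is the closed subspace of $L^p(\mathbb{R}^N)$ (of $C_0^0(\mathbb{R}^N)$ for $p=\infty$) of functions $u=\sum_{i=1}^{d_n}f_i(\rho)P_i(\omega)$, where $P_1,\dots,P_{d_n}$ is a basis of spherical harmonics of order $n$ (restrictions to $S^{N-1}$ of homogeneous harmonic polynomials of degree $n$) and $f_i\in L^p((0,\infty),\rho^{N-1}d\rho)$. $\lambda_n=n(n+N-2)$. $p'=p/(p-1)$, conventions $1/\infty=0$. $\gamma_p(\alpha,c)=(\frac Np-2+\alpha)(\frac N{p'}-\alpha+c)$, $\mathcal{P}_{p,\alpha,c}=\{-\xi^2+i\xi(N(1-\frac2p)+2-2\alpha+c)-\gamma_p(\alpha,c):\xi\in\mathbb{R}\}$. *)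

theory Defs
  imports "HOL-Analysis.Analysis"
begin

definition partial_deriv :: "'n::finite \<Rightarrow> (real^'n \<Rightarrow> real) \<Rightarrow> real^'n \<Rightarrow> real" where
  "partial_deriv i u x = frechet_derivative u (at x) (axis i 1)"

fun iter_partial :: "'n::finite list \<Rightarrow> (real^'n \<Rightarrow> real) \<Rightarrow> real^'n \<Rightarrow> real" where
  "iter_partial [] u = u"
| "iter_partial (i # is) u = partial_deriv i (iter_partial is u)"

definition smooth_fun :: "(real^'n::finite \<Rightarrow> real) \<Rightarrow> bool" where
  "smooth_fun u \<longleftrightarrow> (\<forall>is x. iter_partial is u differentiable (at x))"

definition test_fun :: "(real^'n::finite \<Rightarrow> real) \<Rightarrow> bool" where
  "test_fun u \<longleftrightarrow> smooth_fun u \<and> compact (closure {x. u x \<noteq> 0})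
      \<and> 0 \<notin> closure {x. u x \<noteq> 0}"

definition laplacian :: "(real^'n::finite \<Rightarrow> real) \<Rightarrow> real^'n \<Rightarrow> real" where
  "laplacian u x = (\<Sum>i\<in>UNIV. partial_deriv i (partial_deriv i u) x)"

definition opL :: "real \<Rightarrow> real \<Rightarrow> (real^'n::finite \<Rightarrow> real) \<Rightarrow> real^'n \<Rightarrow> real" where
  "opL b c u x = laplacian u x + c * (frechet_derivative u (at x) x) / (norm x)^2
                 - b / (norm x)^2 * u x"

definition homogeneous_poly :: "nat \<Rightarrow> (real^'n::finite \<Rightarrow> real) \<Rightarrow> bool" where
  "homogeneous_poly n Q \<longleftrightarrow> (\<exists>coef :: ('n \<Rightarrow> nat) \<Rightarrow> real.
      \<forall>x. Q x = (\<Sum>a\<in>{a::'n \<Rightarrow> nat. sum a UNIV = n}. coef a * (\<Prod>i\<in>UNIV. (x $ i) ^ a i)))"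

definition harmonic_homogeneous_poly :: "nat \<Rightarrow> (real^'n::finite \<Rightarrow> real) \<Rightarrow> bool" where
  "harmonic_homogeneous_poly n Q \<longleftrightarrow> homogeneous_poly n Q \<and> (\<forall>x. laplacian Q x = 0)"

text \<open>A spherical harmonic of order n, as a function defined on the unit sphere
  (its values off the sphere are irrelevant).\<close>
definition spherical_harmonic :: "nat \<Rightarrow> (real^'n::finite \<Rightarrow> real) \<Rightarrow> bool" where
  "spherical_harmonic n Y \<longleftrightarrow>
     (\<exists>Q. harmonic_homogeneous_poly n Q \<and> (\<forall>\<omega>\<in>sphere 0 1. Y \<omega> = Q \<omega>))"

definition Lp_norm :: "'a measure \<Rightarrow> ennreal \<Rightarrow> ('a \<Rightarrow> real) \<Rightarrow> ennreal" where
  "Lp_norm M p f =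
     (if p = \<infinity> then Inf {C::ennreal. AE x in M. ennreal \<bar>f x\<bar> \<le> C}
      else (let I = (\<integral>\<^sup>+ x. ennreal (\<bar>f x\<bar> powr enn2real p) \<partial>M)
            in if I = \<infinity> then \<infinity> else ennreal (enn2real I powr (1 / enn2real p))))"

definition memLp :: "'a measure \<Rightarrow> ennreal \<Rightarrow> ('a \<Rightarrow> real) \<Rightarrow> bool" where
  "memLp M p f \<longleftrightarrow> f \<in> borel_measurable M \<and> Lp_norm M p f < \<infinity>"

definition radial_measure :: "nat \<Rightarrow> real measure" where
  "radial_measure N = density (restrict_space lborel {0<..}) (\<lambda>\<rho>. ennreal (\<rho> ^ (N - 1)))"

definition inv_exp :: "ennreal \<Rightarrow> real" where
  "inv_exp p = (if p = \<infinity> then 0 else 1 / enn2real p)"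

definition in_Lpn :: "ennreal \<Rightarrow> nat \<Rightarrow> (real^'n::finite \<Rightarrow> real) \<Rightarrow> bool" where
  "in_Lpn p n u \<longleftrightarrow> (\<exists>(k::nat) (f :: nat \<Rightarrow> real \<Rightarrow> real) (P :: nat \<Rightarrow> real^'n \<Rightarrow> real).
      (\<forall>i<k. spherical_harmonic n (P i) \<and> memLp (radial_measure CARD('n)) p (f i))
      \<and> (AE x in lborel. u x = (\<Sum>i<k. f i (norm x) * P i (x /\<^sub>R norm x))))"

definition lambda_n :: "nat \<Rightarrow> nat \<Rightarrow> real" where
  "lambda_n N n = real n * (real n + real N - 2)"

definition gamma_p :: "nat \<Rightarrow> ennreal \<Rightarrow> real \<Rightarrow> real \<Rightarrow> real" where
  "gamma_p N p \<alpha> c = (real N * inv_exp p - 2 + \<alpha>) * (real N * (1 - inv_exp p) - \<alpha> + c)"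

definition parabola_P :: "nat \<Rightarrow> ennreal \<Rightarrow> real \<Rightarrow> real \<Rightarrow> complex set" where
  "parabola_P N p \<alpha> c = (\<lambda>t::real. complex_of_real (- (t^2)) + \<i> * complex_of_real (t *
       (real N * (1 - 2 * inv_exp p) + 2 - 2 * \<alpha> + c)) - complex_of_real (gamma_p N p \<alpha> c))
     ` UNIV"

definition rellich_ineq :: "'n::finite itself \<Rightarrow> ennreal \<Rightarrow> nat \<Rightarrow> real \<Rightarrow> real \<Rightarrow> real \<Rightarrow> real \<Rightarrow> bool" where
  "rellich_ineq _ p n \<alpha> b c C \<longleftrightarrow>
     (\<forall>u :: real^'n \<Rightarrow> real. test_fun u \<and> in_Lpn p n u \<longrightarrow>
        Lp_norm lborel p (\<lambda>x. norm x powr \<alpha> * opL b c u x)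
          \<ge> ennreal C * Lp_norm lborel p (\<lambda>x. norm x powr (\<alpha> - 2) * u x))"

end

(*
  Along the rays t |-> exp t * x the Euler derivative D = x . grad acts as d/dt.  On test functions
  in L^p_n one has |x|^2 L u = D^2 u + (N - 2 + c) D u - (b + lambda_n) u, so the weighted
  inequality is a statement about a constant-coefficient second-order operator in t = ln |x|.

  Lower bound: factor that operator over the complex numbers.  For a first-order factor, Duhamel's
  formula along rays, Jensen's inequality for the exponential distribution and the scaling of Lebesgue
  measure give the constant |Re z + alpha - 2 + N/p|; the product of the two constants is
  |b + lambda_n + gamma_p| when the roots are real, and is positive off the parabola.

  Upper bound: the functions |x|^(-theta) cos(xi ln |x| + phi) chi(ln |x| / R) Y(x/|x|) with R large
  are approximate eigenfunctions.

  Polar coordinates are never used: the spherical part of the Laplacian is a sum of squares of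
  rotation generators, which commute with radial coefficients, and the norms of the approximate
  eigenfunctions are compared through dilation invariance alone.
*)
theory Submission
  imports Defs
begin

section \<open>Lp norms and dilations\<close>

text \<open>Write 2 h = N - 2 + c, \<theta> = \<alpha> - 2 + N/p, \<mu> = b + lambda_n + gamma_p and
  d^2 = b + lambda_n + h^2. Everything rests on the identity \<mu> + (h - \<theta>)^2 = d^2. On u =
  |x|^(-\<theta>) v(ln |x|) Y the operator |x|^2 L becomes v'' + 2 (h - \<theta>) v' - \<mu> v, and
  the weighted norm becomes translation invariant in ln |x|. A cosine of frequency \<xi> is an
  approximate eigenfunction only if the first-order term disappears, that is if \<xi> = 0 or h =
  \<theta>. The number b + lambda_n lies on the parabola exactly when \<mu> + \<xi>^2 = 0 for one of
  these frequencies. In the other direction the characteristic roots are -h + d and -h - d. For real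
  d the two first-order constants multiply to |(\<theta> - h)^2 - d^2| = |\<mu>|. For imaginary d
  only the common real part counts and the product is (\<theta> - h)^2; it vanishes only for h =
  \<theta>, and then \<mu> = d^2 < 0 puts b + lambda_n on the parabola. Two obstacles shape the
  details: the radial coefficients in L^p_n are merely measurable, and the cut-off errors live on
  all of the support while the cut-off is bounded below only in its middle.\<close>

lemma powr_above_tangent:
  fixes q m y :: real
  assumes "1 \<le> q" "0 < m" "0 \<le> y"
  shows "q * m powr (q - 1) * y \<le> y powr q + (q - 1) * m powr q"
proof (cases "y = 0")
  case True
  then show ?thesis using assms by auto
next
  case False
  have d: "((\<lambda>x. x powr q) has_field_derivative q * m powr (q - 1)) (at m within {0<..})"
    using assms by (auto intro!: derivative_eq_intros)
  have "y powr q - m powr q \<ge> q * m powr (q - 1) * (y - m)"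
    using powr_convex[OF assms(1)] d assms False
    by (intro convex_on_imp_above_tangent[where A = "{0<..}"]) (auto simp: interior_open)
  moreover have "m powr q = m powr (q - 1) * m"
    using assms powr_add[of m "q - 1" 1] by simp
  ultimately show ?thesis by (simp add: algebra_simps)
qed

text \<open>The tangent inequality at the mean \<open>m\<close> is averaged; as it holds for every
  \<open>y \<ge> 0\<close>, the values \<open>a = 0\<close> and \<open>b = 0\<close> are
  included.\<close>

lemma powr_convex_combination:
  fixes q a b l :: real
  assumes "1 \<le> q" "0 \<le> a" "0 \<le> b" "0 \<le> l" "l \<le> 1"
  shows "(l * a + (1 - l) * b) powr q \<le> l * a powr q + (1 - l) * b powr q"
proof -
  define m where "m = l * a + (1 - l) * b"
  have "m \<ge> 0" using assms by (auto simp: m_def)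
  show ?thesis
  proof (cases "m = 0")
    case True
    then show ?thesis using assms by (simp add: m_def[symmetric])
  next
    case False
    then have m: "m > 0" using \<open>m \<ge> 0\<close> by simp
    have "l * (q * m powr (q - 1) * a) + (1 - l) * (q * m powr (q - 1) * b)
        \<le> l * (a powr q + (q - 1) * m powr q) + (1 - l) * (b powr q + (q - 1) * m powr q)"
      using assms m by (intro add_mono mult_left_mono powr_above_tangent) auto
    moreover have "l * (q * m powr (q - 1) * a) + (1 - l) * (q * m powr (q - 1) * b)
        = q * (m powr (q - 1) * m)"
      by (simp add: m_def algebra_simps)
    moreover have "m powr (q - 1) * m = m powr q"
      using m powr_add[of m "q - 1" 1] by simp
    moreover have "l * (a powr q + (q - 1) * m powr q) + (1 - l) * (b powr q + (q - 1) * m powr q)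
        = l * a powr q + (1 - l) * b powr q + (q * m powr q - m powr q)"
      by algebra
    ultimately show ?thesis unfolding m_def[symmetric] by simp
  qed
qed

text \<open>Jensen's inequality, stated so that neither integral needs to be finite.\<close>
lemma powr_le_nn_integral_powr:
  fixes H :: "'a \<Rightarrow> real"
  assumes M: "emeasure M (space M) = 1" and H: "H \<in> borel_measurable M" "\<And>t. 0 \<le> H t"
    and "1 \<le> q" "0 \<le> r" and le: "ennreal r \<le> (\<integral>\<^sup>+t. ennreal (H t) \<partial>M)"
  shows "ennreal (r powr q) \<le> (\<integral>\<^sup>+t. ennreal (H t powr q) \<partial>M)"
proof (cases "r = 0")
  case False
  then have r: "0 < r" using assms by simp
  let ?c = "q * r powr (q - 1)"
  have rr: "r powr (q - 1) * r = r powr q"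
    using r powr_add[of r "q - 1" 1] by simp
  have "ennreal (q * r powr q) = ennreal ?c * ennreal r"
    using assms by (simp add: rr ennreal_mult[symmetric] mult.assoc)
  also have "\<dots> \<le> ennreal ?c * (\<integral>\<^sup>+t. ennreal (H t) \<partial>M)"
    by (intro mult_left_mono le) auto
  also have "\<dots> = (\<integral>\<^sup>+t. ennreal (?c * H t) \<partial>M)"
    using assms by (subst nn_integral_cmult[symmetric]) (auto simp: ennreal_mult)
  also have "\<dots> \<le> (\<integral>\<^sup>+t. ennreal (H t powr q) + ennreal ((q - 1) * r powr q) \<partial>M)"
    using assms r powr_above_tangent[OF \<open>1 \<le> q\<close> r]
    by (intro nn_integral_mono) (auto simp flip: ennreal_plus)
  also have "\<dots> = (\<integral>\<^sup>+t. ennreal (H t powr q) \<partial>M) + ennreal ((q - 1) * r powr q)"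
    using H M by (subst nn_integral_add) auto
  finally have "ennreal (r powr q + (q - 1) * r powr q)
      \<le> (\<integral>\<^sup>+t. ennreal (H t powr q) \<partial>M) + ennreal ((q - 1) * r powr q)"
    by (simp add: algebra_simps)
  then have "ennreal ((q - 1) * r powr q) + ennreal (r powr q)
      \<le> ennreal ((q - 1) * r powr q) + (\<integral>\<^sup>+t. ennreal (H t powr q) \<partial>M)"
    using assms by (subst (asm) ennreal_plus) (auto simp: add.commute)
  then show ?thesis by (simp add: ennreal_add_left_cancel_le)
qed (use assms in simp)

lemma ennreal_le_by_real_bounds:
  fixes X Y :: ennreal
  assumes "\<And>C. 0 \<le> C \<Longrightarrow> Y \<le> ennreal C \<Longrightarrow> X \<le> ennreal C"
  shows "X \<le> Y"
  using assms by (cases Y) auto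

lemma enn2real_ge_1:
  assumes "1 \<le> p" "p \<noteq> (\<infinity>::ennreal)"
  shows "1 \<le> enn2real p"
  using assms by (cases p) (auto simp: ennreal_le_iff2 simp flip: ennreal_1)

text \<open>Estimates for finite \<open>p\<close> are carried out on integrals and brought back
  through this equivalence, which absorbs both the root and the case of an infinite
  integral.\<close>

lemma Lp_norm_le_iff:
  assumes p: "1 \<le> p" "p \<noteq> \<infinity>" and "0 \<le> C"
  shows "Lp_norm M p f \<le> ennreal C \<longleftrightarrow>
    (\<integral>\<^sup>+ x. ennreal (\<bar>f x\<bar> powr enn2real p) \<partial>M) \<le> ennreal (C powr enn2real p)"
proof -
  let ?I = "\<integral>\<^sup>+ x. ennreal (\<bar>f x\<bar> powr enn2real p) \<partial>M"
  have q: "1 \<le> enn2real p" using enn2real_ge_1 p by auto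
  show ?thesis
  proof (cases ?I)
    case (real r)
    have "r powr (1 / enn2real p) \<le> C \<longleftrightarrow> r \<le> C powr enn2real p" (is "?L \<longleftrightarrow> ?R")
    proof
      assume ?L
      then have "(r powr (1 / enn2real p)) powr enn2real p \<le> C powr enn2real p"
        using q by (intro powr_mono2) auto
      then show ?R using q real by (simp add: powr_powr)
    next
      assume ?R
      then have "r powr (1 / enn2real p) \<le> (C powr enn2real p) powr (1 / enn2real p)"
        using q real by (intro powr_mono2) auto
      then show ?L using q assms by (simp add: powr_powr)
    qed
    then show ?thesis using real p assms by (simp add: Lp_norm_def)
  next
    case top
    then show ?thesis using p by (simp add: Lp_norm_def top_unique)
  qed
qed

text \<open>The infimum in the definition is attained: the exceptional sets of the bounds
  \<open>C + 1 / Suc n\<close> are countably many, so their union is null.\<close>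

lemma Lp_norm_infinity_le_iff:
  "Lp_norm M \<infinity> f \<le> C \<longleftrightarrow> (AE x in M. ennreal \<bar>f x\<bar> \<le> C)"
proof
  assume "AE x in M. ennreal \<bar>f x\<bar> \<le> C"
  then show "Lp_norm M \<infinity> f \<le> C" by (auto simp: Lp_norm_def intro: Inf_lower)
next
  assume *: "Lp_norm M \<infinity> f \<le> C"
  show "AE x in M. ennreal \<bar>f x\<bar> \<le> C"
  proof (cases "C = \<infinity>")
    case False
    have "AE x in M. ennreal \<bar>f x\<bar> \<le> C + ennreal (1 / Suc n)" for n
    proof -
      have "Inf {C. AE x in M. ennreal \<bar>f x\<bar> \<le> C} \<le> C"
        using * by (simp add: Lp_norm_def)
      also have "C < C + ennreal (1 / Suc n)"
        using False ennreal_add_left_cancel_less[of C 0 "ennreal (1 / Suc n)"]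
        by (simp add: add_pos_nonneg)
      finally obtain D where "AE x in M. ennreal \<bar>f x\<bar> \<le> D" "D < C + ennreal (1 / Suc n)"
        unfolding Inf_less_iff by auto
      then show ?thesis by (auto elim!: eventually_mono)
    qed
    then have "AE x in M. \<forall>n. ennreal \<bar>f x\<bar> \<le> C + ennreal (1 / Suc n)"
      by (simp add: AE_all_countable)
    then show ?thesis
    proof (rule eventually_mono)
      fix x assume **: "\<forall>n. ennreal \<bar>f x\<bar> \<le> C + ennreal (1 / Suc n)"
      show "ennreal \<bar>f x\<bar> \<le> C"
      proof (rule ennreal_le_epsilon)
        fix e :: real assume "0 < e"
        then obtain n where "1 / Suc n < e" using nat_approx_posE by blast
        then have "ennreal (1 / Suc n) \<le> ennreal e" by (simp add: ennreal_leI)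
        then show "ennreal \<bar>f x\<bar> \<le> C + ennreal e"
          using ** by (meson add_left_mono order_trans)
      qed
    qed
  qed simp
qed

lemma Lp_norm_abs: "Lp_norm M p (\<lambda>x. \<bar>f x\<bar>) = Lp_norm M p f"
  by (simp only: Lp_norm_def abs_idempotent)

lemma Lp_norm_mono:
  assumes p: "1 \<le> p" and le: "AE x in M. \<bar>f x\<bar> \<le> \<bar>g x\<bar>"
  shows "Lp_norm M p f \<le> Lp_norm M p g"
proof (rule ennreal_le_by_real_bounds)
  fix C :: real assume C: "0 \<le> C" "Lp_norm M p g \<le> ennreal C"
  show "Lp_norm M p f \<le> ennreal C"
  proof (cases "p = \<infinity>")
    case True
    have "AE x in M. ennreal \<bar>g x\<bar> \<le> ennreal C"
      using C True by (simp only: Lp_norm_infinity_le_iff)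
    then have "AE x in M. ennreal \<bar>f x\<bar> \<le> ennreal C"
      using le by eventually_elim (use C in auto)
    then show ?thesis using True by (simp only: Lp_norm_infinity_le_iff)
  next
    case False
    have q: "1 \<le> enn2real p" using enn2real_ge_1 p False by auto
    have "(\<integral>\<^sup>+ x. ennreal (\<bar>f x\<bar> powr enn2real p) \<partial>M) \<le> (\<integral>\<^sup>+ x. ennreal (\<bar>g x\<bar> powr enn2real p) \<partial>M)"
      using le by (intro nn_integral_mono_AE) (auto elim!: eventually_mono intro!: ennreal_leI powr_mono2 simp: order_trans[OF _ q])
    then show ?thesis using C p False by (auto simp: Lp_norm_le_iff)
  qed
qed

text \<open>The factor 0 is separate because the right-hand side is then 0 even when the norm of
  \<open>f\<close> is infinite. The reverse bound, where it is wanted, comes from applying this one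
  to \<open>1 / c\<close>.\<close>

lemma Lp_norm_cmult_le:
  assumes p: "1 \<le> p" and f: "f \<in> borel_measurable M"
  shows "Lp_norm M p (\<lambda>x. c * f x) \<le> ennreal \<bar>c\<bar> * Lp_norm M p f"
proof (cases "c = 0")
  case True
  have "Lp_norm M p (\<lambda>x. 0 * f x) \<le> ennreal 0"
    using p Lp_norm_le_iff[OF p, of 0 M "\<lambda>x. 0 * f x"] Lp_norm_infinity_le_iff[of M "\<lambda>x. 0 * f x" 0]
    by (cases "p = \<infinity>") auto
  then show ?thesis using True by simp
next
  case c: False
  show ?thesis
  proof (cases "Lp_norm M p f")
    case (real C)
    have "Lp_norm M p (\<lambda>x. c * f x) \<le> ennreal (\<bar>c\<bar> * C)"
    proof (cases "p = \<infinity>")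
      case True
      have "AE x in M. ennreal \<bar>f x\<bar> \<le> ennreal C"
        using real True Lp_norm_infinity_le_iff[of M f "ennreal C"] by simp
      then have "AE x in M. ennreal \<bar>c * f x\<bar> \<le> ennreal (\<bar>c\<bar> * C)"
        by eventually_elim (use real in \<open>auto simp: abs_mult intro!: mult_left_mono ennreal_leI\<close>)
      then show ?thesis using True by (simp only: Lp_norm_infinity_le_iff)
    next
      case False
      have *: "(\<integral>\<^sup>+ x. ennreal (\<bar>f x\<bar> powr enn2real p) \<partial>M) \<le> ennreal (C powr enn2real p)"
        using real p False Lp_norm_le_iff[of p C M f] by auto
      have "(\<integral>\<^sup>+ x. ennreal (\<bar>c * f x\<bar> powr enn2real p) \<partial>M)
          = ennreal (\<bar>c\<bar> powr enn2real p) * (\<integral>\<^sup>+ x. ennreal (\<bar>f x\<bar> powr enn2real p) \<partial>M)"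
        using f by (subst nn_integral_cmult[symmetric]) (auto simp: abs_mult powr_mult ennreal_mult)
      also have "\<dots> \<le> ennreal (\<bar>c\<bar> powr enn2real p) * ennreal (C powr enn2real p)"
        using * by (intro mult_left_mono) auto
      finally show ?thesis
        using real p False by (subst Lp_norm_le_iff) (auto simp: powr_mult ennreal_mult)
    qed
    then show ?thesis using real by (simp add: ennreal_mult)
  qed (use c in \<open>simp add: ennreal_mult_top\<close>)
qed

text \<open>Minkowski's inequality by convexity: for bounds \<open>A\<close> and \<open>B\<close> on
  the two norms, |f| + |g| is \<open>A + B\<close> times the convex combination of |f| / A and |g| /
  B with weights A / (A + B) and B / (A + B).\<close>

lemma Lp_norm_triangle:
  assumes p: "1 \<le> p" and f: "f \<in> borel_measurable M" and g: "g \<in> borel_measurable M"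
  shows "Lp_norm M p (\<lambda>x. f x + g x) \<le> Lp_norm M p f + Lp_norm M p g"
proof -
  have main: "Lp_norm M p (\<lambda>x. f x + g x) \<le> ennreal (A + B)"
    if A: "0 < A" "Lp_norm M p f \<le> ennreal A" and B: "0 < B" "Lp_norm M p g \<le> ennreal B" for A B
  proof (cases "p = \<infinity>")
    case True
    have "AE x in M. ennreal \<bar>f x\<bar> \<le> ennreal A" "AE x in M. ennreal \<bar>g x\<bar> \<le> ennreal B"
      using A B True by (simp_all only: Lp_norm_infinity_le_iff)
    then have "AE x in M. ennreal \<bar>f x + g x\<bar> \<le> ennreal (A + B)"
    proof eventually_elim
      case (elim x)
      then have "\<bar>f x\<bar> \<le> A" "\<bar>g x\<bar> \<le> B" using A B by simp_all
      then show ?case by (intro ennreal_leI) linarith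
    qed
    then show ?thesis using True by (simp only: Lp_norm_infinity_le_iff)
  next
    case False
    let ?q = "enn2real p"
    define l where "l = A / (A + B)"
    have q: "1 \<le> ?q" using enn2real_ge_1 p False by auto
    have l: "0 \<le> l" "l \<le> 1" "1 - l = B / (A + B)" using A B by (auto simp: l_def field_simps)
    have If: "(\<integral>\<^sup>+ x. ennreal (\<bar>f x\<bar> powr ?q) \<partial>M) \<le> ennreal (A powr ?q)"
      and Ig: "(\<integral>\<^sup>+ x. ennreal (\<bar>g x\<bar> powr ?q) \<partial>M) \<le> ennreal (B powr ?q)"
      using A B p False by (auto simp: Lp_norm_le_iff)
    let ?u = "(A + B) powr ?q * l / A powr ?q" and ?v = "(A + B) powr ?q * (1 - l) / B powr ?q"
    have pt: "\<bar>f x + g x\<bar> powr ?q \<le> ?u * \<bar>f x\<bar> powr ?q + ?v * \<bar>g x\<bar> powr ?q" for x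
    proof -
      have "\<bar>f x + g x\<bar> powr ?q \<le> (\<bar>f x\<bar> + \<bar>g x\<bar>) powr ?q"
        using q by (intro powr_mono2) auto
      also have "\<bar>f x\<bar> + \<bar>g x\<bar> = (A + B) * (l * (\<bar>f x\<bar> / A) + (1 - l) * (\<bar>g x\<bar> / B))"
      proof -
        have "(A + B) * l = A" "(A + B) * (1 - l) = B" unfolding l(3) using A B by (auto simp: l_def)
        then have "(A + B) * (l * (\<bar>f x\<bar> / A) + (1 - l) * (\<bar>g x\<bar> / B)) = A * (\<bar>f x\<bar> / A) + B * (\<bar>g x\<bar> / B)"
          by (metis distrib_left mult.assoc)
        then show ?thesis using A B by simp
      qed
      also have "\<dots> powr ?q = (A + B) powr ?q * (l * (\<bar>f x\<bar> / A) + (1 - l) * (\<bar>g x\<bar> / B)) powr ?q"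
        using A B l by (intro powr_mult)
      also have "\<dots> \<le> (A + B) powr ?q * (l * (\<bar>f x\<bar> / A) powr ?q + (1 - l) * (\<bar>g x\<bar> / B) powr ?q)"
        using A B l q by (intro mult_left_mono powr_convex_combination) auto
      also have "\<dots> = ?u * \<bar>f x\<bar> powr ?q + ?v * \<bar>g x\<bar> powr ?q"
        using A B by (simp add: powr_divide algebra_simps)
      finally show ?thesis .
    qed
    have "(\<integral>\<^sup>+ x. ennreal (\<bar>f x + g x\<bar> powr ?q) \<partial>M)
        \<le> (\<integral>\<^sup>+ x. ennreal ?u * ennreal (\<bar>f x\<bar> powr ?q) + ennreal ?v * ennreal (\<bar>g x\<bar> powr ?q) \<partial>M)"
      using pt l A B by (intro nn_integral_mono) (simp flip: ennreal_mult ennreal_plus)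
    also have "\<dots> = ennreal ?u * (\<integral>\<^sup>+ x. ennreal (\<bar>f x\<bar> powr ?q) \<partial>M)
        + ennreal ?v * (\<integral>\<^sup>+ x. ennreal (\<bar>g x\<bar> powr ?q) \<partial>M)"
      using f g by (simp add: nn_integral_add nn_integral_cmult)
    also have "\<dots> \<le> ennreal ?u * ennreal (A powr ?q) + ennreal ?v * ennreal (B powr ?q)"
      using If Ig by (intro add_mono mult_left_mono) auto
    also have "\<dots> = ennreal ((A + B) powr ?q)"
    proof -
      have "?u * A powr ?q + ?v * B powr ?q = (A + B) powr ?q"
      proof -
        have "?u * A powr ?q = (A + B) powr ?q * l" "?v * B powr ?q = (A + B) powr ?q * (1 - l)"
          using A B by auto
        then show ?thesis by (simp add: algebra_simps)
      qed
      then show ?thesis using A B l by (simp flip: ennreal_mult ennreal_plus)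
    qed
    finally show ?thesis using p False A B by (subst Lp_norm_le_iff) auto
  qed
  show ?thesis
  proof (cases "Lp_norm M p f = \<infinity> \<or> Lp_norm M p g = \<infinity>")
    case False
    then obtain A B where AB: "0 \<le> A" "Lp_norm M p f = ennreal A" "0 \<le> B" "Lp_norm M p g = ennreal B"
      by (cases "Lp_norm M p f"; cases "Lp_norm M p g") auto
    show ?thesis
    proof (rule ennreal_le_epsilon)
      \<comment> \<open>\<open>main\<close> divides by its bounds and a norm may be 0, hence the
        shift of both bounds by \<open>e / 2\<close>.\<close>
      fix e :: real assume e: "0 < e"
      have "Lp_norm M p (\<lambda>x. f x + g x) \<le> ennreal ((A + e / 2) + (B + e / 2))"
        using AB e by (intro main) (auto intro: ennreal_leI)
      also have "(A + e / 2) + (B + e / 2) = (A + B) + e" by simp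
      also have "ennreal \<dots> = ennreal A + ennreal B + ennreal e"
        using AB e by simp
      finally show "Lp_norm M p (\<lambda>x. f x + g x) \<le> Lp_norm M p f + Lp_norm M p g + ennreal e"
        using AB by simp
    qed
  qed auto
qed

section \<open>Dilations of Lebesgue measure\<close>

lemma nn_integral_lborel_dilation:
  fixes h :: "'a::euclidean_space \<Rightarrow> ennreal"
  assumes "0 < t" and h: "h \<in> borel_measurable borel"
  shows "(\<integral>\<^sup>+x. h (t *\<^sub>R x) \<partial>lborel) = ennreal (t powr (- real DIM('a))) * (\<integral>\<^sup>+x. h x \<partial>lborel)"
proof -
  have "(\<integral>\<^sup>+x. h x \<partial>lborel)
      = (\<integral>\<^sup>+x. h x \<partial>density (distr lborel borel (\<lambda>x. 0 + t *\<^sub>R x)) (\<lambda>_. \<bar>t\<bar>^DIM('a)))"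
    using assms by (subst lborel_affine[of t 0]) auto
  also have "\<dots> = (\<integral>\<^sup>+x. ennreal (t ^ DIM('a)) * h (t *\<^sub>R x) \<partial>lborel)"
    using h assms by (simp add: nn_integral_density nn_integral_distr)
  also have "\<dots> = ennreal (t ^ DIM('a)) * (\<integral>\<^sup>+x. h (t *\<^sub>R x) \<partial>lborel)"
    by (intro nn_integral_cmult measurable_compose[OF _ h]) (simp add: borel_measurable_continuous_onI continuous_intros)
  finally have "(\<integral>\<^sup>+x. h x \<partial>lborel) = ennreal (t ^ DIM('a)) * (\<integral>\<^sup>+x. h (t *\<^sub>R x) \<partial>lborel)" .
  then show ?thesis
    using assms by (simp add: mult.assoc[symmetric] ennreal_mult[symmetric] powr_minus powr_realpow)
qed

lemma AE_lborel_dilation: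
  fixes P :: "'a::euclidean_space \<Rightarrow> bool"
  assumes "0 < t" "AE x in lborel. P x"
  shows "AE x in lborel. P (t *\<^sub>R x)"
proof -
  from assms(2) obtain S where S: "S \<in> sets lborel" "emeasure lborel S = 0" "{x. \<not> P x} \<subseteq> S"
    by (auto elim!: AE_E)
  let ?T = "(\<lambda>x. t *\<^sub>R x) -` S"
  have [measurable]: "S \<in> sets borel" using S by simp
  have T: "?T \<in> sets borel"
    using measurable_sets_borel[of "\<lambda>x::'a. t *\<^sub>R x" borel S] S by simp
  have "emeasure lborel ?T = (\<integral>\<^sup>+x. indicator S (t *\<^sub>R x) \<partial>lborel)"
    unfolding nn_integral_indicator[OF T[folded sets_lborel], symmetric]
    by (intro nn_integral_cong) (auto split: split_indicator)
  also have "\<dots> = 0"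
    using assms S by (subst nn_integral_lborel_dilation) auto
  finally show ?thesis
    using T S by (intro AE_I[of _ _ ?T]) auto
qed

text \<open>Since \<open>inv_exp \<infinity> = 0\<close>, a single power of \<open>t\<close> serves
  for all \<open>p\<close>.\<close>

lemma Lp_norm_dilation_le:
  fixes f :: "'a::euclidean_space \<Rightarrow> real"
  assumes p: "1 \<le> p" and t: "0 < t" and f: "f \<in> borel_measurable borel"
  shows "Lp_norm lborel p (\<lambda>x. f (t *\<^sub>R x))
    \<le> ennreal (t powr (- real DIM('a) * inv_exp p)) * Lp_norm lborel p f"
proof (cases "Lp_norm lborel p f")
  case (real C)
  let ?c = "t powr (- real DIM('a) * inv_exp p)"
  have "Lp_norm lborel p (\<lambda>x. f (t *\<^sub>R x)) \<le> ennreal (?c * C)"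
  proof (cases "p = \<infinity>")
    case True
    have "AE x in lborel. ennreal \<bar>f x\<bar> \<le> ennreal C"
      using real True Lp_norm_infinity_le_iff[of lborel f "ennreal C"] by simp
    from AE_lborel_dilation[OF t this] show ?thesis
      using True t by (simp add: Lp_norm_infinity_le_iff inv_exp_def del: infinity_ennreal_def)
  next
    case False
    have q: "1 \<le> enn2real p" using enn2real_ge_1 p False by auto
    have *: "(\<integral>\<^sup>+ x. ennreal (\<bar>f x\<bar> powr enn2real p) \<partial>lborel) \<le> ennreal (C powr enn2real p)"
      using real p False Lp_norm_le_iff[of p C lborel f] by auto
    have "(\<integral>\<^sup>+ x. ennreal (\<bar>f (t *\<^sub>R x)\<bar> powr enn2real p) \<partial>lborel)
        = ennreal (t powr (- real DIM('a))) * (\<integral>\<^sup>+ x. ennreal (\<bar>f x\<bar> powr enn2real p) \<partial>lborel)"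
      using nn_integral_lborel_dilation[OF t, of "\<lambda>x. ennreal (\<bar>f x\<bar> powr enn2real p)"] f by simp
    also have "\<dots> \<le> ennreal (t powr (- real DIM('a))) * ennreal (C powr enn2real p)"
      using * by (intro mult_left_mono) auto
    also have "\<dots> = ennreal ((?c * C) powr enn2real p)"
      using False q real by (simp add: inv_exp_def powr_mult powr_powr ennreal_mult)
    finally show ?thesis
      using real p False by (subst Lp_norm_le_iff) auto
  qed
  then show ?thesis using real by (simp add: ennreal_mult)
qed (use t in \<open>simp add: ennreal_mult_top\<close>)

section \<open>First-order operators along rays\<close>

lemma nn_integral_exponential:
  assumes "0 < (k::real)"
  shows "(\<integral>\<^sup>+t. ennreal (exp (- k * t)) * indicator {0..} t \<partial>lborel) = ennreal (1 / k)"
proof -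
  have "((\<lambda>t. - exp (- k * t) / k) \<longlongrightarrow> - 0 / k) at_top"
    using assms by (intro tendsto_intros filterlim_compose[OF exp_at_bot])
      (auto simp: filterlim_uminus_at_bot intro!: filterlim_tendsto_pos_mult_at_top filterlim_ident)
  note * = nn_integral_FTC_atLeast[OF _ _ _ this, of "\<lambda>t. exp (- k * t)" 0]
  have "((\<lambda>t. - exp (- k * t) / k) has_real_derivative exp (- k * t)) (at t)" for t
    using assms by (auto intro!: derivative_eq_intros simp: field_simps)
  with * show ?thesis using assms by simp
qed

section \<open>Measurability and almost-everywhere statements for continuous functions\<close>

lemma continuous_off_origin_borel:
  fixes f :: "'a::euclidean_space \<Rightarrow> 'b::real_normed_vector"
  assumes "continuous_on (- {0}) f"
  shows "f \<in> borel_measurable borel"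
  using assms by (intro borel_measurable_continuous_countable_exceptions[of "{0}"]) auto

lemma AE_lborel_open_imp:
  fixes P :: "'a::euclidean_space \<Rightarrow> bool"
  assumes "AE x in lborel. P x" "open S" "S \<noteq> {}"
  shows "\<exists>x\<in>S. P x"
proof (rule ccontr)
  assume *: "\<not> (\<exists>x\<in>S. P x)"
  from assms(1) obtain N where N: "N \<in> null_sets lborel" "{x. \<not> P x} \<subseteq> N"
    by (auto elim!: AE_E simp: null_sets_def)
  have "negligible N"
    using N(1) null_sets_completionI by (auto simp: negligible_iff_null_sets)
  moreover have "S \<subseteq> N" using * N(2) by auto
  ultimately have "negligible S" by (rule negligible_subset)
  then show False using assms(2,3) open_not_negligible by blast
qed

lemma AE_lborel_continuous_eq:
  fixes f g :: "'a::euclidean_space \<Rightarrow> 'b::metric_space"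
  assumes ae: "AE x in lborel. f x = g x" and c: "continuous_on S f" "continuous_on S g"
    and S: "open S" "x \<in> S"
  shows "f x = g x"
proof (rule ccontr)
  assume "f x \<noteq> g x"
  let ?U = "{x\<in>S. dist (f x) (g x) > 0}"
  have "continuous_on S (\<lambda>x. dist (f x) (g x))" using c by (intro continuous_intros)
  then have "open (S \<inter> (\<lambda>x. dist (f x) (g x)) -` {0<..})"
    using S(1) by (rule continuous_open_preimage) simp
  also have "S \<inter> (\<lambda>x. dist (f x) (g x)) -` {0<..} = ?U" by auto
  finally have "open ?U" .
  moreover have "x \<in> ?U" using S \<open>f x \<noteq> g x\<close> by simp
  ultimately obtain y where "y \<in> ?U" "f y = g y"
    using AE_lborel_open_imp[OF ae, of ?U] by blast
  then show False by simp
qed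

lemma AE_lborel_continuous_le:
  fixes f :: "'a::euclidean_space \<Rightarrow> real"
  assumes ae: "AE x in lborel. f x \<le> C" and c: "continuous_on S f" and S: "open S" "x \<in> S"
  shows "f x \<le> C"
proof -
  have "AE x in lborel. max (f x) C = C" using ae by eventually_elim simp
  then have "max (f x) C = C"
    by (rule AE_lborel_continuous_eq) (use c S in \<open>auto intro!: continuous_intros\<close>)
  then show ?thesis by simp
qed

text \<open>The kernel exp (- s a t) is 1/k times the exponential probability density of rate
  \<open>k\<close> times exp (s N t / p), and the last factor makes the dilation by exp (s t) an
  isometry of L^p. So \<open>k * W\<close> is dominated by an average of functions with the norm of
  \<open>G\<close>; Jensen and Tonelli conclude for finite \<open>p\<close>. The sign
  \<open>s\<close> selects outward or inward rays so that the rate \<open>k\<close> is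
  positive.\<close>

lemma Lp_norm_ray_le:
  fixes W G :: "'a::euclidean_space \<Rightarrow> real"
  assumes p: "1 \<le> p" and W: "W \<in> borel_measurable borel" and G: "continuous_on (- {0}) G"
    and s: "s = 1 \<or> s = - 1" and k: "k = s * (a + real DIM('a) * inv_exp p)" "0 < k"
    and le: "\<And>x. x \<noteq> 0 \<Longrightarrow> ennreal \<bar>W x\<bar> \<le>
      (\<integral>\<^sup>+t. ennreal (exp (- s * a * t) * \<bar>G (exp (s * t) *\<^sub>R x)\<bar>) * indicator {0..} t \<partial>lborel)"
  shows "ennreal k * Lp_norm lborel p W \<le> Lp_norm lborel p G"
proof (rule ennreal_le_by_real_bounds)
  fix C :: real assume C: "0 \<le> C" "Lp_norm lborel p G \<le> ennreal C"
  have [measurable]: "G \<in> borel_measurable borel" using G by (rule continuous_off_origin_borel)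
  note W[measurable]
  have "Lp_norm lborel p W \<le> ennreal (C / k)"
  proof (cases "p = \<infinity>")
    case True
    have "AE x in lborel. ennreal \<bar>G x\<bar> \<le> ennreal C"
      using C True Lp_norm_infinity_le_iff[of lborel G "ennreal C"] by simp
    then have "AE x in lborel. \<bar>G x\<bar> \<le> C" using C by simp
    \<comment> \<open>The bound is needed along each single ray, which an almost-everywhere
      statement does not reach; continuity of \<open>G\<close> gives it at every point off the
      origin.\<close>
    then have GC: "\<bar>G x\<bar> \<le> C" if "x \<noteq> 0" for x
      by (rule AE_lborel_continuous_le[of _ C "- {0}"]) (use G that in \<open>auto intro!: continuous_intros\<close>)
    have WC: "ennreal \<bar>W x\<bar> \<le> ennreal (C / k)" if x: "x \<noteq> 0" for x
    proof -
      have "ennreal \<bar>W x\<bar> \<le> (\<integral>\<^sup>+t. ennreal (exp (- s * a * t) * \<bar>G (exp (s * t) *\<^sub>R x)\<bar>) * indicator {0..} t \<partial>lborel)"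
        by (rule le[OF x])
      also have "\<dots> \<le> (\<integral>\<^sup>+t. ennreal C * (ennreal (exp (- k * t)) * indicator {0..} t) \<partial>lborel)"
        using k True GC x C
        by (intro nn_integral_mono) (auto simp: inv_exp_def mult.commute split: split_indicator simp flip: ennreal_mult intro!: ennreal_leI)
      also have "\<dots> = ennreal (C / k)"
        using k(2) C nn_integral_exponential[OF k(2)]
        by (subst nn_integral_cmult) (simp_all flip: ennreal_mult)
      finally show ?thesis .
    qed
    have "AE x in lborel. ennreal \<bar>W x\<bar> \<le> ennreal (C / k)"
      by (rule eventually_mono[OF AE_lborel_singleton[of 0]]) (rule WC)
    then show ?thesis using True by (simp only: Lp_norm_infinity_le_iff)
  next
    case False
    let ?q = "enn2real p" and ?N = "real DIM('a)"
    have q: "1 \<le> ?q" using enn2real_ge_1 p False by auto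
    have IG: "(\<integral>\<^sup>+ x. ennreal (\<bar>G x\<bar> powr ?q) \<partial>lborel) \<le> ennreal (C powr ?q)"
      using C p False by (auto simp: Lp_norm_le_iff)
    \<comment> \<open>\<open>w\<close> is the exponential density of rate \<open>k\<close>, and
      \<open>H\<close> contains the isometric dilation of \<open>G\<close>.\<close>
    define w where "w t = ennreal (k * exp (- k * t)) * indicator {0..} t" for t :: real
    define H where "H x t = exp (s * ?N / ?q * t) * \<bar>G (exp (s * t) *\<^sub>R x)\<bar>" for x t
    have Hm[measurable]: "(\<lambda>z. H (fst z) (snd z)) \<in> borel_measurable (lborel \<Otimes>\<^sub>M lborel)"
      unfolding H_def by measurable
    have [measurable]: "w \<in> borel_measurable borel" unfolding w_def by measurable
    have [measurable]: "H x \<in> borel_measurable borel" for x unfolding H_def by measurable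
    have Hnn: "0 \<le> H x t" for x t by (simp add: H_def)
    let ?M = "density lborel w"
    have wk: "w t = ennreal k * (ennreal (exp (- k * t)) * indicator {0..} t)" for t
      using k(2) by (simp add: w_def ennreal_mult mult.assoc)
    have w1: "(\<integral>\<^sup>+t. w t \<partial>lborel) = 1"
      unfolding wk using k(2) by (subst nn_integral_cmult)
        (use nn_integral_exponential[OF k(2)] in \<open>simp_all flip: ennreal_mult\<close>)
    then have M1: "emeasure ?M (space ?M) = 1"
      by (simp add: emeasure_density)
    have pt: "ennreal (\<bar>k * W x\<bar> powr ?q) \<le> (\<integral>\<^sup>+t. w t * ennreal (H x t powr ?q) \<partial>lborel)" if x: "x \<noteq> 0" for x
    proof -
      have "ennreal \<bar>k * W x\<bar> = ennreal k * ennreal \<bar>W x\<bar>"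
        using k(2) by (simp add: abs_mult ennreal_mult)
      also have "\<dots> \<le> ennreal k * (\<integral>\<^sup>+t. ennreal (exp (- s * a * t) * \<bar>G (exp (s * t) *\<^sub>R x)\<bar>) * indicator {0..} t \<partial>lborel)"
        by (intro mult_left_mono le[OF x]) auto
      also have "\<dots> = (\<integral>\<^sup>+t. ennreal k * (ennreal (exp (- s * a * t) * \<bar>G (exp (s * t) *\<^sub>R x)\<bar>) * indicator {0..} t) \<partial>lborel)"
        by (intro nn_integral_cmult[symmetric]) measurable
      also have "\<dots> = (\<integral>\<^sup>+t. w t * ennreal (H x t) \<partial>lborel)"
      proof (intro nn_integral_cong)
        fix t :: real
        have "exp (- s * a * t) = exp (- k * t) * exp (s * ?N / ?q * t)"
          using k(1) False by (simp add: exp_add[symmetric] inv_exp_def algebra_simps)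
        then show "ennreal k * (ennreal (exp (- s * a * t) * \<bar>G (exp (s * t) *\<^sub>R x)\<bar>) * indicator {0..} t)
            = w t * ennreal (H x t)"
          using k(2) by (auto simp: w_def H_def split: split_indicator simp flip: ennreal_mult)
      qed
      also have "\<dots> = (\<integral>\<^sup>+t. ennreal (H x t) \<partial>?M)"
        by (subst nn_integral_density) auto
      finally have "ennreal (\<bar>k * W x\<bar> powr ?q) \<le> (\<integral>\<^sup>+t. ennreal (H x t powr ?q) \<partial>?M)"
        using M1 q Hnn by (intro powr_le_nn_integral_powr) auto
      also have "\<dots> = (\<integral>\<^sup>+t. w t * ennreal (H x t powr ?q) \<partial>lborel)"
        by (subst nn_integral_density) auto
      finally show ?thesis .
    qed
    have "(\<integral>\<^sup>+x. ennreal (\<bar>k * W x\<bar> powr ?q) \<partial>lborel)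
        \<le> (\<integral>\<^sup>+x. (\<integral>\<^sup>+t. w t * ennreal (H x t powr ?q) \<partial>lborel) \<partial>lborel)"
      using AE_lborel_singleton[of 0] by (intro nn_integral_mono_AE) (auto intro: pt elim!: eventually_mono)
    also have "\<dots> = (\<integral>\<^sup>+t. (\<integral>\<^sup>+x. w t * ennreal (H x t powr ?q) \<partial>lborel) \<partial>lborel)"
      by (rule lborel_pair.Fubini'[symmetric]) measurable
    also have "\<dots> = (\<integral>\<^sup>+t. w t * (\<integral>\<^sup>+x. ennreal (\<bar>G x\<bar> powr ?q) \<partial>lborel) \<partial>lborel)"
    proof (intro nn_integral_cong)
      fix t :: real
      have e: "ennreal (H x t powr ?q) = ennreal (exp (s * ?N * t)) * ennreal (\<bar>G (exp (s * t) *\<^sub>R x)\<bar> powr ?q)" for x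
        using q by (simp add: H_def powr_mult exp_powr_real mult.commute flip: ennreal_mult)
      have "(\<integral>\<^sup>+x. ennreal (H x t powr ?q) \<partial>lborel)
          = ennreal (exp (s * ?N * t)) * (\<integral>\<^sup>+x. ennreal (\<bar>G (exp (s * t) *\<^sub>R x)\<bar> powr ?q) \<partial>lborel)"
        unfolding e by (intro nn_integral_cmult) measurable
      also have "\<dots> = (\<integral>\<^sup>+x. ennreal (\<bar>G x\<bar> powr ?q) \<partial>lborel)"
      proof -
        have "exp (s * ?N * t) * exp (s * t) powr (- ?N) = 1"
          by (simp add: exp_powr_real exp_add[symmetric])
        then have *: "ennreal (exp (s * ?N * t)) * ennreal (exp (s * t) powr (- ?N)) = 1"
          by (simp only: ennreal_mult[symmetric] exp_ge_zero powr_ge_zero ennreal_1)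
        have **: "(\<integral>\<^sup>+x. ennreal (\<bar>G (exp (s * t) *\<^sub>R x)\<bar> powr ?q) \<partial>lborel)
            = ennreal (exp (s * t) powr (- ?N)) * (\<integral>\<^sup>+x. ennreal (\<bar>G x\<bar> powr ?q) \<partial>lborel)"
          by (rule nn_integral_lborel_dilation) auto
        show ?thesis by (simp only: ** mult.assoc[symmetric] * mult_1)
      qed
      finally show "(\<integral>\<^sup>+x. w t * ennreal (H x t powr ?q) \<partial>lborel)
          = w t * (\<integral>\<^sup>+x. ennreal (\<bar>G x\<bar> powr ?q) \<partial>lborel)"
        by (subst nn_integral_cmult) (auto simp: H_def)
    qed
    also have "\<dots> = (\<integral>\<^sup>+x. ennreal (\<bar>G x\<bar> powr ?q) \<partial>lborel)"
      by (subst nn_integral_multc) (auto simp: w1)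
    finally have "Lp_norm lborel p (\<lambda>x. k * W x) \<le> ennreal C"
      using IG p False C by (subst Lp_norm_le_iff) auto
    moreover have "Lp_norm lborel p (\<lambda>x. (1 / k) * (k * W x)) \<le> ennreal \<bar>1 / k\<bar> * Lp_norm lborel p (\<lambda>x. k * W x)"
      using p by (intro Lp_norm_cmult_le) auto
    ultimately have "Lp_norm lborel p (\<lambda>x. (1 / k) * (k * W x)) \<le> ennreal \<bar>1 / k\<bar> * ennreal C"
      by (meson mult_left_mono order_trans zero_le)
    then show ?thesis using k(2) C by (simp flip: ennreal_mult)
  qed
  then have "ennreal k * Lp_norm lborel p W \<le> ennreal k * ennreal (C / k)"
    by (intro mult_left_mono) auto
  then show "ennreal k * Lp_norm lborel p W \<le> ennreal C"
    using k(2) C by (simp flip: ennreal_mult)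
qed

section \<open>Smooth functions and the angular part of the Laplacian\<close>

text \<open>The product rule leads out of a given family of generators, so smoothness is proved for
  the closure of the family under sums and products, which partial derivatives can preserve.\<close>

inductive fun_alg :: "(('a \<Rightarrow> real) \<Rightarrow> bool) \<Rightarrow> ('a \<Rightarrow> real) \<Rightarrow> bool" for B where
  base: "B u \<Longrightarrow> fun_alg B u"
| add: "fun_alg B u \<Longrightarrow> fun_alg B v \<Longrightarrow> fun_alg B (\<lambda>x. u x + v x)"
| mult: "fun_alg B u \<Longrightarrow> fun_alg B v \<Longrightarrow> fun_alg B (\<lambda>x. u x * v x)"

lemma partial_deriv_eqI:
  "(u has_derivative u') (at x) \<Longrightarrow> partial_deriv i u x = u' (axis i 1)"
  unfolding partial_deriv_def by (metis frechet_derivative_at)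

lemma frechet_derivative_eqI:
  "(u has_derivative u') (at x) \<Longrightarrow> frechet_derivative u (at x) h = u' h"
  by (metis frechet_derivative_at)

lemma partial_deriv_add:
  assumes "u differentiable (at x)" "v differentiable (at x)"
  shows "partial_deriv i (\<lambda>x. u x + v x) x = partial_deriv i u x + partial_deriv i v x"
  using has_derivative_add[OF assms[THEN frechet_derivative_works[THEN iffD1]]]
  by (simp add: partial_deriv_eqI) (simp add: partial_deriv_def)

lemma partial_deriv_mult:
  assumes "u differentiable (at x)" "v differentiable (at x)"
  shows "partial_deriv i (\<lambda>x. u x * v x) x = u x * partial_deriv i v x + partial_deriv i u x * v x"
  using has_derivative_mult[OF assms[THEN frechet_derivative_works[THEN iffD1]]]
  by (simp add: partial_deriv_eqI) (simp add: partial_deriv_def)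

lemma partial_deriv_const: "partial_deriv i (\<lambda>x. c) x = 0"
  by (simp add: partial_deriv_def)

lemma partial_deriv_coord: "partial_deriv i (\<lambda>x. x $ j) x = (if i = j then 1 else 0)"
proof -
  have "((\<lambda>x. x $ j) has_derivative (\<lambda>h. h $ j)) (at x)"
    by (intro bounded_linear_imp_has_derivative bounded_linear_vec_nth)
  then show ?thesis by (simp add: partial_deriv_eqI axis_def)
qed

text \<open>A coinduction principle: \<open>iter_partial\<close> never leaves a class that is
  invariant under \<open>partial_deriv\<close>.\<close>

lemma smooth_fun_partial_closed:
  assumes cl: "\<And>u. \<Phi> u \<Longrightarrow> (\<forall>x. u differentiable (at x)) \<and> (\<forall>i. \<Phi> (partial_deriv i u))" and "\<Phi> u"
  shows "smooth_fun u"
proof -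
  have "\<Phi> (iter_partial is u)" for "is"
    by (induction "is") (use cl \<open>\<Phi> u\<close> in auto)
  then show ?thesis unfolding smooth_fun_def using cl by blast
qed

lemma iter_partial_append: "iter_partial (is @ js) u = iter_partial is (iter_partial js u)"
  by (induction "is") auto

lemma smooth_fun_differentiable: "smooth_fun u \<Longrightarrow> u differentiable (at x)"
  unfolding smooth_fun_def by (metis iter_partial.simps(1))

lemma smooth_fun_partial: "smooth_fun u \<Longrightarrow> smooth_fun (partial_deriv i u)"
  unfolding smooth_fun_def
proof (intro allI)
  fix "is" x
  assume "\<forall>is x. iter_partial is u differentiable (at x)"
  then have "iter_partial (is @ [i]) u differentiable (at x)" by blast
  then show "iter_partial is (partial_deriv i u) differentiable (at x)"
    by (simp add: iter_partial_append)
qed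

text \<open>Only generators have to be differentiated: sums and products follow from linearity and
  the Leibniz rule. The derivative of a generator may be any element of the algebra.\<close>

lemma smooth_fun_fun_alg:
  fixes u :: "real^'n \<Rightarrow> real"
  assumes B: "\<And>u. B u \<Longrightarrow> (\<forall>x. u differentiable (at x)) \<and> (\<forall>i. fun_alg B (partial_deriv i u))"
    and u: "fun_alg B u"
  shows "smooth_fun u"
proof (rule smooth_fun_partial_closed[of "fun_alg B"])
  fix u :: "real^'n \<Rightarrow> real" assume "fun_alg B u"
  then show "(\<forall>x. u differentiable (at x)) \<and> (\<forall>i. fun_alg B (partial_deriv i u))"
  proof induction
    case (base u)
    then show ?case using B by blast
  next
    case (add u v)
    then have "partial_deriv i (\<lambda>x. u x + v x) = (\<lambda>x. partial_deriv i u x + partial_deriv i v x)" for i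
      by (intro ext partial_deriv_add) auto
    moreover have "fun_alg B (\<lambda>x. partial_deriv i u x + partial_deriv i v x)" for i
      using add by (intro fun_alg.add) blast+
    ultimately show ?case using add by (simp add: differentiable_add)
  next
    case (mult u v)
    then have "partial_deriv i (\<lambda>x. u x * v x)
        = (\<lambda>x. u x * partial_deriv i v x + partial_deriv i u x * v x)" for i
      by (intro ext partial_deriv_mult) auto
    moreover have "fun_alg B (\<lambda>x. u x * partial_deriv i v x + partial_deriv i u x * v x)" for i
      using mult by (intro fun_alg.add fun_alg.mult) blast+
    ultimately show ?case using mult by (simp add: differentiable_mult)
  qed
qed (fact u)

lemma smooth_fun_alg_smooth: "fun_alg smooth_fun u \<Longrightarrow> smooth_fun u"
  by (erule smooth_fun_fun_alg[rotated])
    (auto intro: smooth_fun_differentiable smooth_fun_partial fun_alg.base)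

lemma smooth_fun_add: "smooth_fun u \<Longrightarrow> smooth_fun v \<Longrightarrow> smooth_fun (\<lambda>x. u x + v x)"
  by (rule smooth_fun_alg_smooth) (intro fun_alg.add fun_alg.base)

lemma smooth_fun_mult: "smooth_fun u \<Longrightarrow> smooth_fun v \<Longrightarrow> smooth_fun (\<lambda>x. u x * v x)"
  by (rule smooth_fun_alg_smooth) (intro fun_alg.mult fun_alg.base)

lemma smooth_fun_const: "smooth_fun (\<lambda>x::real^'n. c)"
proof (rule smooth_fun_partial_closed[of "\<lambda>u. \<exists>c. u = (\<lambda>x. c)"])
  fix u :: "real^'n \<Rightarrow> real" assume "\<exists>c. u = (\<lambda>x. c)"
  then obtain c where u: "u = (\<lambda>x. c)" by blast
  have "partial_deriv i u = (\<lambda>x. 0)" for i unfolding u by (intro ext partial_deriv_const)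
  then show "(\<forall>x. u differentiable at x) \<and> (\<forall>i. \<exists>c. partial_deriv i u = (\<lambda>x. c))"
    unfolding u by (metis differentiable_const)
qed blast

lemma smooth_fun_coord: "smooth_fun (\<lambda>x::real^'n. x $ j)"
proof (rule smooth_fun_fun_alg[of "\<lambda>u. smooth_fun u \<or> u = (\<lambda>x. x $ j)"])
  fix u :: "real^'n \<Rightarrow> real" assume "smooth_fun u \<or> u = (\<lambda>x. x $ j)"
  then show "(\<forall>x. u differentiable (at x)) \<and>
      (\<forall>i. fun_alg (\<lambda>u. smooth_fun u \<or> u = (\<lambda>x. x $ j)) (partial_deriv i u))"
  proof
    assume "u = (\<lambda>x. x $ j)"
    moreover have "partial_deriv i (\<lambda>x. x $ j) = (\<lambda>x. if i = j then 1 else 0)" for i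
      by (simp add: partial_deriv_coord fun_eq_iff)
    ultimately show ?thesis
      by (auto intro!: fun_alg.base smooth_fun_const bounded_linear_imp_differentiable bounded_linear_vec_nth)
  qed (auto intro: smooth_fun_differentiable smooth_fun_partial fun_alg.base)
qed (auto intro: fun_alg.base)

lemma smooth_fun_sum: "(\<And>a. a \<in> A \<Longrightarrow> smooth_fun (f a)) \<Longrightarrow> smooth_fun (\<lambda>x. \<Sum>a\<in>A. f a x)"
  by (induction A rule: infinite_finite_induct) (auto intro: smooth_fun_const smooth_fun_add)

lemma smooth_fun_prod: "(\<And>a. a \<in> A \<Longrightarrow> smooth_fun (f a)) \<Longrightarrow> smooth_fun (\<lambda>x. \<Prod>a\<in>A. f a x)"
  by (induction A rule: infinite_finite_induct) (auto intro: smooth_fun_const smooth_fun_mult)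

lemma smooth_fun_power: "smooth_fun f \<Longrightarrow> smooth_fun (\<lambda>x. f x ^ k)"
  by (induction k) (auto intro: smooth_fun_const smooth_fun_mult)

lemma smooth_fun_continuous: "smooth_fun u \<Longrightarrow> continuous_on S u"
  by (meson continuous_at_imp_continuous_on differentiable_imp_continuous_within smooth_fun_differentiable)

lemma smooth_fun_homogeneous_poly: "homogeneous_poly n Q \<Longrightarrow> smooth_fun Q"
proof -
  assume "homogeneous_poly n Q"
  then obtain coef where "Q = (\<lambda>x. \<Sum>a\<in>{a. sum a UNIV = n}. coef a * (\<Prod>i\<in>UNIV. (x $ i) ^ a i))"
    unfolding homogeneous_poly_def by auto
  then show ?thesis
    by (simp only:) (intro smooth_fun_sum smooth_fun_mult smooth_fun_const smooth_fun_prod smooth_fun_power smooth_fun_coord)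
qed

lemma homogeneous_poly_scaleR:
  fixes Q :: "real^'n \<Rightarrow> real"
  assumes "homogeneous_poly n Q" shows "Q (t *\<^sub>R x) = t ^ n * Q x"
proof -
  obtain coef where Q: "Q = (\<lambda>x. \<Sum>a\<in>{a. sum a UNIV = n}. coef a * (\<Prod>i\<in>UNIV. (x $ i) ^ a i))"
    using assms unfolding homogeneous_poly_def by auto
  show ?thesis unfolding Q sum_distrib_left
  proof (intro sum.cong refl)
    fix a :: "'n \<Rightarrow> nat" assume "a \<in> {a. sum a UNIV = n}"
    then have "(\<Prod>i\<in>UNIV. t ^ a i) = t ^ n" by (simp add: power_sum[symmetric])
    then show "coef a * (\<Prod>i\<in>UNIV. ((t *\<^sub>R x) $ i) ^ a i) = t ^ n * (coef a * (\<Prod>i\<in>UNIV. x $ i ^ a i))"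
      by (simp add: power_mult_distrib prod.distrib)
  qed
qed

section \<open>The Euler derivative and the rotation generators\<close>

lemma frechet_derivative_partial:
  fixes u :: "real^'n \<Rightarrow> real"
  assumes "u differentiable (at x)"
  shows "frechet_derivative u (at x) h = (\<Sum>i\<in>UNIV. h $ i * partial_deriv i u x)"
proof -
  have lin: "linear (frechet_derivative u (at x))"
    using assms by (rule linear_frechet_derivative)
  have "frechet_derivative u (at x) (\<Sum>i\<in>UNIV. h $ i *\<^sub>R axis i 1) = (\<Sum>i\<in>UNIV. h $ i * partial_deriv i u x)"
    by (simp add: linear_sum[OF lin] linear_scale[OF lin] partial_deriv_def)
  moreover have "(\<Sum>i\<in>UNIV. h $ i *\<^sub>R axis i 1) = h"
    using basis_expansion[of h] by (simp add: scalar_mult_eq_scaleR)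
  ultimately show ?thesis by simp
qed

definition euler_op :: "(real^'n \<Rightarrow> real) \<Rightarrow> real^'n \<Rightarrow> real" where
  "euler_op u x = frechet_derivative u (at x) x"

text \<open>The infinitesimal generator of the rotations in the plane of coordinates
  \<open>i\<close> and \<open>j\<close>; it annihilates functions of \<open>norm x\<close>.\<close>

definition angular_op :: "'n \<Rightarrow> 'n \<Rightarrow> (real^'n \<Rightarrow> real) \<Rightarrow> real^'n \<Rightarrow> real" where
  "angular_op i j u x = x $ i * partial_deriv j u x - x $ j * partial_deriv i u x"

lemma euler_op_partial:
  "smooth_fun u \<Longrightarrow> euler_op u = (\<lambda>x. \<Sum>i\<in>UNIV. x $ i * partial_deriv i u x)"
  by (auto simp: euler_op_def frechet_derivative_partial smooth_fun_differentiable)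

lemma smooth_fun_euler_op: "smooth_fun u \<Longrightarrow> smooth_fun (euler_op u)"
  by (simp only: euler_op_partial) (intro smooth_fun_sum smooth_fun_mult smooth_fun_coord smooth_fun_partial)

lemma angular_op_alt: "angular_op i j u = (\<lambda>x. x $ i * partial_deriv j u x + (- 1) * (x $ j * partial_deriv i u x))"
  by (simp add: angular_op_def fun_eq_iff)

lemma smooth_fun_angular_op: "smooth_fun u \<Longrightarrow> smooth_fun (angular_op i j u)"
  unfolding angular_op_alt
  by (intro smooth_fun_add smooth_fun_mult smooth_fun_coord smooth_fun_partial smooth_fun_const)

lemma partial_deriv_sum:
  assumes "finite A" "\<And>a. a \<in> A \<Longrightarrow> f a differentiable (at x)"
  shows "partial_deriv i (\<lambda>x. \<Sum>a\<in>A. f a x) x = (\<Sum>a\<in>A. partial_deriv i (f a) x)"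
  using assms
  by (induction A) (auto simp: partial_deriv_const partial_deriv_add intro!: differentiable_sum)

lemma partial_deriv_angular_op:
  assumes "smooth_fun u"
  shows "partial_deriv k (angular_op i j u) x =
    (x $ i * partial_deriv k (partial_deriv j u) x + (if k = i then 1 else 0) * partial_deriv j u x)
    - (x $ j * partial_deriv k (partial_deriv i u) x + (if k = j then 1 else 0) * partial_deriv i u x)"
proof -
  note d = smooth_fun_differentiable[OF smooth_fun_coord]
    smooth_fun_differentiable[OF smooth_fun_partial[OF assms]]
    smooth_fun_differentiable[OF smooth_fun_const]
  have m: "(\<lambda>x. x $ i * partial_deriv j u x) differentiable (at x)" for i j
    using d by (intro smooth_fun_differentiable smooth_fun_mult smooth_fun_coord smooth_fun_partial assms)
  have 1: "partial_deriv k (\<lambda>x. x $ i * partial_deriv j u x) x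
      = x $ i * partial_deriv k (partial_deriv j u) x + (if k = i then 1 else 0) * partial_deriv j u x" for i j
    by (simp add: partial_deriv_mult[OF d(1,2)] partial_deriv_coord)
  have 2: "partial_deriv k (\<lambda>x. (- 1) * (x $ j * partial_deriv i u x)) x
      = - partial_deriv k (\<lambda>x. x $ j * partial_deriv i u x) x"
    using partial_deriv_mult[OF d(3) m, of k "- 1"] by (simp add: partial_deriv_const)
  have m': "(\<lambda>x. (- 1) * (x $ j * partial_deriv i u x)) differentiable (at x)"
    by (intro smooth_fun_differentiable smooth_fun_mult smooth_fun_coord smooth_fun_partial assms smooth_fun_const)
  show ?thesis unfolding angular_op_alt partial_deriv_add[OF m m'] 2 1 by simp
qed

text \<open>This is the spherical part of the Laplacian as a sum of squares. Summing over ordered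
  pairs counts every plane twice, hence the factor 2, and an exchange of indices identifies the two
  sums of mixed second derivatives. The Euler terms collect to N - 2 after
  \<open>euler_op (euler_op u)\<close> has absorbed one of them.\<close>

lemma sum_angular_op_angular_op:
  fixes u :: "real^'n \<Rightarrow> real"
  assumes u: "smooth_fun u"
  shows "(\<Sum>i\<in>UNIV. \<Sum>j\<in>UNIV. angular_op i j (angular_op i j u) x)
    = 2 * ((norm x)\<^sup>2 * laplacian u x - euler_op (euler_op u) x - (real CARD('n) - 2) * euler_op u x)"
proof -
  let ?U = "\<lambda>i. partial_deriv i u x" and ?H = "\<lambda>i j. partial_deriv i (partial_deriv j u) x"
  define A where "A = (\<Sum>i\<in>UNIV. (x $ i)\<^sup>2)"
  define L where "L = (\<Sum>i\<in>UNIV. ?H i i)"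
  define H where "H = (\<Sum>i\<in>UNIV. \<Sum>j\<in>UNIV. x $ i * x $ j * ?H i j)"
  define E where "E = (\<Sum>i\<in>UNIV. x $ i * ?U i)"
  let ?N = "real CARD('n)"
  \<comment> \<open>The last summand makes the formula valid on the diagonal as well, where the
    angular operator is 0 and the other terms add up to \<open>- 2 * (x $ i * ?U i)\<close>.\<close>
  have "(\<Sum>i\<in>UNIV. \<Sum>j\<in>UNIV. angular_op i j (angular_op i j u) x)
    = (\<Sum>i\<in>UNIV. \<Sum>j\<in>UNIV. (x $ i)\<^sup>2 * ?H j j + (x $ j)\<^sup>2 * ?H i i
        - x $ i * x $ j * ?H j i - x $ i * x $ j * ?H i j
        - x $ i * ?U i - x $ j * ?U j
        + (if i = j then 2 * (x $ i * ?U i) else 0))"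
  proof (intro sum.cong refl)
    fix i j :: 'n
    show "angular_op i j (angular_op i j u) x = (x $ i)\<^sup>2 * ?H j j + (x $ j)\<^sup>2 * ?H i i
        - x $ i * x $ j * ?H j i - x $ i * x $ j * ?H i j
        - x $ i * ?U i - x $ j * ?U j
        + (if i = j then 2 * (x $ i * ?U i) else 0)"
      unfolding angular_op_def[of i j "angular_op i j u"] partial_deriv_angular_op[OF u]
      by (cases "i = j") (simp_all add: power2_eq_square algebra_simps)
  qed
  also have "\<dots> = A * L + A * L - H - H - ?N * E - ?N * E + 2 * E"
  proof -
    have 1: "(\<Sum>i\<in>UNIV. \<Sum>j\<in>UNIV. (x $ i)\<^sup>2 * ?H j j) = A * L"
      by (simp add: A_def L_def sum_product)
    have 2: "(\<Sum>i\<in>UNIV. \<Sum>j\<in>UNIV. (x $ j)\<^sup>2 * ?H i i) = A * L"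
      using 1 by (subst sum.swap) simp
    have 3: "(\<Sum>i\<in>UNIV. \<Sum>j\<in>UNIV. x $ i * x $ j * ?H j i) = H"
      unfolding H_def by (subst sum.swap) (simp add: mult.commute)
    have 4: "(\<Sum>i\<in>UNIV. \<Sum>j\<in>(UNIV::'n set). x $ i * ?U i) = ?N * E"
      by (simp add: E_def sum_distrib_left)
    have 5: "(\<Sum>i\<in>(UNIV::'n set). \<Sum>j\<in>UNIV. x $ j * ?U j) = ?N * E"
      by (simp add: E_def)
    have 6: "(\<Sum>i\<in>UNIV. \<Sum>j\<in>UNIV. (if i = j then 2 * (x $ i * ?U i) else 0)) = 2 * E"
      by (simp add: E_def sum_distrib_left)
    show ?thesis
      by (simp only: sum.distrib sum_subtractf 1 2 3 4 5 6 H_def[symmetric])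
  qed
  finally have *: "(\<Sum>i\<in>UNIV. \<Sum>j\<in>UNIV. angular_op i j (angular_op i j u) x)
    = A * L + A * L - H - H - ?N * E - ?N * E + 2 * E" .
  have AA: "A = (norm x)\<^sup>2" by (simp add: A_def norm_vec_def L2_set_def sum_nonneg)
  have LL: "L = laplacian u x" by (simp add: L_def laplacian_def)
  have EE: "euler_op u x = E" by (simp add: euler_op_partial[OF u] E_def)
  note d = smooth_fun_differentiable[OF smooth_fun_coord]
    smooth_fun_differentiable[OF smooth_fun_partial[OF u]]
    smooth_fun_differentiable[OF smooth_fun_mult[OF smooth_fun_coord smooth_fun_partial[OF u]]]
  have "euler_op (euler_op u) x = (\<Sum>i\<in>UNIV. x $ i * partial_deriv i (\<lambda>x. \<Sum>j\<in>UNIV. x $ j * partial_deriv j u x) x)"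
    by (subst euler_op_partial[OF smooth_fun_euler_op[OF u]]) (simp add: euler_op_partial[OF u])
  also have "\<dots> = (\<Sum>i\<in>UNIV. x $ i * (\<Sum>j\<in>UNIV. x $ j * ?H i j + (if i = j then 1 else 0) * ?U j))"
    by (simp only: partial_deriv_sum[OF finite d(3)] partial_deriv_mult[OF d(1,2)] partial_deriv_coord)
  also have "\<dots> = H + E"
  proof -
    have "(\<Sum>j\<in>UNIV. x $ j * ?H i j + (if i = j then 1 else 0) * ?U j) = (\<Sum>j\<in>UNIV. x $ j * ?H i j) + ?U i" for i
      by (simp add: sum.distrib if_distrib[of "\<lambda>c. c * _"] cong: if_cong)
    then show ?thesis
      by (simp only: H_def E_def sum.distrib sum_distrib_left distrib_left mult.assoc)
  qed
  finally show ?thesis unfolding * AA LL EE by (simp add: algebra_simps)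
qed

section \<open>The Laplacian on functions of spherical type\<close>

lemma AE_lborel_orthogonal:
  fixes R :: "'a::euclidean_space \<Rightarrow> 'a"
  assumes R: "orthogonal_transformation R" and ae: "AE x in lborel. P x"
  shows "AE x in lborel. P (R x)"
proof -
  from ae obtain N where N: "N \<in> null_sets lborel" "{x. \<not> P x} \<subseteq> N"
    by (auto elim!: AE_E simp: null_sets_def)
  have "negligible N"
    using N(1) null_sets_completionI by (auto simp: negligible_iff_null_sets)
  moreover have "inv R differentiable_on N"
    using R by (intro linear_imp_differentiable_on orthogonal_transformation_linear orthogonal_transformation_inv)
  ultimately have "negligible (inv R ` N)"
    by (intro negligible_differentiable_image_negligible) auto
  moreover have "{x. \<not> P (R x)} \<subseteq> inv R ` N"
  proof
    fix x assume "x \<in> {x. \<not> P (R x)}"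
    then have "R x \<in> N" using N by auto
    moreover have "x = inv R (R x)"
      using orthogonal_transformation_inj[OF R] by simp
    ultimately show "x \<in> inv R ` N" by blast
  qed
  ultimately have "AE x in lebesgue. P (R x)"
    by (intro AE_I'[of "inv R ` N"]) (auto simp: negligible_iff_null_sets)
  then show ?thesis by (simp add: AE_completion_iff)
qed

definition plane_rot :: "'n \<Rightarrow> 'n \<Rightarrow> real \<Rightarrow> real^'n \<Rightarrow> real^'n" where
  "plane_rot i j t x = x + ((cos t - 1) * x $ i - sin t * x $ j) *\<^sub>R axis i 1
    + (sin t * x $ i + (cos t - 1) * x $ j) *\<^sub>R axis j 1"

lemma orthogonal_plane_rot:
  fixes i j :: "'n::finite"
  assumes "i \<noteq> j" shows "orthogonal_transformation (plane_rot i j t)"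
  unfolding orthogonal_transformation
proof (intro conjI allI)
  show "linear (plane_rot i j t)"
    by (intro linearI) (auto simp: plane_rot_def vec_eq_iff algebra_simps)
  fix x :: "real^'n"
  have "axis i (1::real) $ j = 0" "axis j (1::real) $ i = 0" using assms by (auto simp: axis_def)
  moreover have cs: "cos t * (cos t * z) + sin t * (sin t * z) = z" for z
    using sin_cos_squared_add[of t] by (metis add.commute distrib_right mult.assoc mult_1 power2_eq_square)
  ultimately have "(norm (plane_rot i j t x))\<^sup>2 = (norm x)\<^sup>2 + ((cos t - 1)\<^sup>2 + (sin t)\<^sup>2 + 2 * (cos t - 1)) * ((x $ i)\<^sup>2 + (x $ j)\<^sup>2)"
    unfolding power2_norm_eq_inner plane_rot_def
    by (simp add: inner_add_left inner_add_right inner_axis inner_axis' inner_commute[of "axis j 1"])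
      (use cs[of "x $ i * x $ i"] cs[of "x $ j * x $ j"] in \<open>simp add: power2_eq_square algebra_simps\<close>)
  also have "(cos t - 1)\<^sup>2 + (sin t)\<^sup>2 + 2 * (cos t - 1) = 0"
    using sin_cos_squared_add[of t] by (simp add: power2_eq_square algebra_simps)
  finally show "norm (plane_rot i j t x) = norm x" by simp
qed

lemma plane_rot_deriv:
  fixes u :: "real^'n \<Rightarrow> real"
  assumes "u differentiable (at x)"
  shows "((\<lambda>t. u (plane_rot i j t x)) has_real_derivative angular_op i j u x) (at 0)"
proof -
  let ?v = "(- (x $ j)) *\<^sub>R axis i 1 + (x $ i) *\<^sub>R axis j 1 :: real^'n"
  have 0: "plane_rot i j 0 x = x" by (simp add: plane_rot_def)
  have u: "(u has_derivative frechet_derivative u (at x)) (at (plane_rot i j 0 x))"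
    using assms by (simp add: 0 frechet_derivative_works)
  have "((\<lambda>t. plane_rot i j t x) has_vector_derivative ?v) (at 0)"
    unfolding plane_rot_def by (auto intro!: derivative_eq_intros)
  then have "((\<lambda>t. plane_rot i j t x) has_derivative (\<lambda>h. h *\<^sub>R ?v)) (at 0)"
    by (simp add: has_vector_derivative_def)
  from diff_chain_at[OF this u]
  have "((\<lambda>t. u (plane_rot i j t x)) has_derivative (\<lambda>h. frechet_derivative u (at x) (h *\<^sub>R ?v))) (at 0)"
    by (simp add: o_def)
  moreover have lin: "linear (frechet_derivative u (at x))"
    using assms by (rule linear_frechet_derivative)
  have "frechet_derivative u (at x) (h *\<^sub>R ?v) = angular_op i j u x * h" for h
    by (simp only: linear_scale[OF lin] linear_add[OF lin] partial_deriv_def[symmetric] angular_op_def real_scaleR_def)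
      (simp add: algebra_simps)
  ultimately show ?thesis by (simp add: has_field_derivative_def fun_eq_iff)
qed

text \<open>
  Nothing is known about the regularity of the radial coefficients \<open>g\<close>: the difference quotients are
  taken along rotations, which leave \<open>norm x\<close> fixed.
\<close>
lemma AE_angular_op:
  fixes u :: "real^'n \<Rightarrow> real"
  assumes u: "\<And>x. u differentiable (at x)" and S: "\<And>l x. l < k \<Longrightarrow> S l differentiable (at x)"
    and ae: "AE x in lborel. u x = (\<Sum>l<k. g l (norm x) * S l x)"
  shows "AE x in lborel. angular_op i j u x = (\<Sum>l<k. g l (norm x) * angular_op i j (S l) x)"
proof (cases "i = j")
  case True
  then show ?thesis by (simp add: angular_op_def)
next
  case False
  define \<tau> where "\<tau> m = 1 / real (Suc m)" for m
  have \<tau>: "filterlim \<tau> (at 0) sequentially"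
    unfolding filterlim_at \<tau>_def using LIMSEQ_inverse_real_of_nat
    by (auto simp: inverse_eq_divide intro!: always_eventually simp del: of_nat_Suc)
  have nr: "norm (plane_rot i j t x) = norm x" for t and x :: "real^'n"
    using orthogonal_plane_rot[OF False] by (simp add: orthogonal_transformation)
  \<comment> \<open>Only countably many angles are used, so one null set serves for all difference
    quotients at \<open>x\<close>.\<close>
  have "AE x in lborel. \<forall>m. u (plane_rot i j (\<tau> m) x) = (\<Sum>l<k. g l (norm x) * S l (plane_rot i j (\<tau> m) x))"
    unfolding AE_all_countable
    using AE_lborel_orthogonal[OF orthogonal_plane_rot[OF False] ae] by (simp add: nr)
  with ae show ?thesis
  proof eventually_elim
    case (elim x)
    define f where "f t = u (plane_rot i j t x)" for t
    define F where "F t = (\<Sum>l<k. g l (norm x) * S l (plane_rot i j t x))" for t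
    have f: "(f has_real_derivative angular_op i j u x) (at 0)"
      unfolding f_def by (rule plane_rot_deriv[OF u])
    have F: "(F has_real_derivative (\<Sum>l<k. g l (norm x) * angular_op i j (S l) x)) (at 0)"
      unfolding F_def by (intro DERIV_sum DERIV_cmult plane_rot_deriv S) auto
    have lim: "(\<lambda>m. (h (\<tau> m) - h 0) / \<tau> m) \<longlonglongrightarrow> D" if "(h has_real_derivative D) (at 0)" for h D
      using filterlim_compose[OF that[unfolded DERIV_def] \<tau>] by simp
    have "plane_rot i j 0 x = x" by (simp add: plane_rot_def)
    then have "f 0 = F 0" "\<And>m. f (\<tau> m) = F (\<tau> m)" using elim by (auto simp: f_def F_def)
    then show ?case using lim[OF f] lim[OF F] by (simp add: LIMSEQ_unique)
  qed
qed

lemma euler_op_homogeneous_poly: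
  assumes Q: "homogeneous_poly n Q"
  shows "euler_op Q x = real n * Q x"
proof -
  have d: "(Q has_derivative frechet_derivative Q (at x)) (at (1 *\<^sub>R x))"
    using smooth_fun_differentiable[OF smooth_fun_homogeneous_poly[OF Q]] by (simp add: frechet_derivative_works)
  have "((\<lambda>t. t *\<^sub>R x) has_derivative (\<lambda>h. h *\<^sub>R x)) (at 1)"
    by (auto intro!: derivative_eq_intros)
  from diff_chain_at[OF this d]
  have "((\<lambda>t. Q (t *\<^sub>R x)) has_derivative (\<lambda>h. frechet_derivative Q (at x) (h *\<^sub>R x))) (at 1)"
    by (simp add: o_def)
  moreover have "((\<lambda>t. Q (t *\<^sub>R x)) has_derivative (\<lambda>h. h * (real n * Q x))) (at 1)"
    unfolding homogeneous_poly_scaleR[OF Q] by (auto intro!: derivative_eq_intros)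
  ultimately have "frechet_derivative Q (at x) (1 *\<^sub>R x) = 1 * (real n * Q x)"
    by (metis (no_types) has_derivative_unique)
  then show ?thesis by (simp add: euler_op_def)
qed

lemma euler_op_cmult:
  assumes "u differentiable (at x)"
  shows "euler_op (\<lambda>x. c * u x) x = c * euler_op u x"
  unfolding euler_op_def
  using assms by (intro frechet_derivative_eqI) (auto intro!: derivative_eq_intros simp: frechet_derivative_works)

text \<open>With vanishing Laplacian and Euler's identity D Q = n Q, the sum of squares acts as the
  scalar -2 (n^2 + (N - 2) n).\<close>

lemma sum_angular_op_harmonic:
  fixes Q :: "real^'n \<Rightarrow> real"
  assumes "harmonic_homogeneous_poly n Q"
  shows "(\<Sum>i\<in>UNIV. \<Sum>j\<in>UNIV. angular_op i j (angular_op i j Q) x) = - 2 * lambda_n CARD('n) n * Q x"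
proof -
  have Q: "homogeneous_poly n Q" "laplacian Q x = 0"
    using assms by (auto simp: harmonic_homogeneous_poly_def)
  have sm: "smooth_fun Q" by (rule smooth_fun_homogeneous_poly[OF Q(1)])
  have e: "euler_op Q = (\<lambda>x. real n * Q x)" using euler_op_homogeneous_poly[OF Q(1)] by auto
  have "euler_op (euler_op Q) x = real n * (real n * Q x)"
    unfolding e using euler_op_cmult[OF smooth_fun_differentiable[OF sm]] e by simp
  then show ?thesis
    using sum_angular_op_angular_op[OF sm, of x] Q(2)
    by (simp add: e lambda_n_def algebra_simps)
qed

text \<open>The almost-everywhere expansion of \<open>u\<close> is differentiated twice along
  rotations. The resulting eigenvalue equation holds almost everywhere between continuous functions,
  hence everywhere, and the sum-of-squares identity turns it into a formula for the
  Laplacian.\<close>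

lemma laplacian_Lpn:
  fixes u :: "real^'n \<Rightarrow> real"
  assumes u: "smooth_fun u" and L: "in_Lpn p n u"
  shows "(norm x)\<^sup>2 * laplacian u x
    = euler_op (euler_op u) x + (real CARD('n) - 2) * euler_op u x - lambda_n CARD('n) n * u x"
proof -
  obtain k :: nat and f :: "nat \<Rightarrow> real \<Rightarrow> real" and P :: "nat \<Rightarrow> real^'n \<Rightarrow> real"
    where P: "\<forall>i<k. spherical_harmonic n (P i) \<and> memLp (radial_measure CARD('n)) p (f i)"
    and ae: "AE x in lborel. u x = (\<Sum>i<k. f i (norm x) * P i (x /\<^sub>R norm x))"
    using L unfolding in_Lpn_def by blast
  have "\<exists>Q. \<forall>l<k. harmonic_homogeneous_poly n (Q l) \<and> (\<forall>\<omega>\<in>sphere 0 1. P l \<omega> = Q l \<omega>)"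
    using P unfolding spherical_harmonic_def by metis
  then obtain Q where Q: "\<And>l. l < k \<Longrightarrow> harmonic_homogeneous_poly n (Q l)"
    "\<And>l \<omega>. l < k \<Longrightarrow> \<omega> \<in> sphere 0 1 \<Longrightarrow> P l \<omega> = Q l \<omega>" by blast
  \<comment> \<open>Dividing by r^n replaces the spherical harmonic at x / |x| by the polynomial
    \<open>Q l\<close> at \<open>x\<close>, to which \<open>angular_op\<close> can be
    applied.\<close>
  define g where "g l r = f l r / r ^ n" for l r
  have sm: "smooth_fun (Q l)" if "l < k" for l
    using Q(1)[OF that] smooth_fun_homogeneous_poly by (auto simp: harmonic_homogeneous_poly_def)
  have uQ: "AE x in lborel. u x = (\<Sum>l<k. g l (norm x) * Q l x)"
    using ae AE_lborel_singleton[of 0]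
  proof eventually_elim
    case (elim x)
    have "P l (x /\<^sub>R norm x) = Q l x / norm x ^ n" if l: "l < k" for l
    proof -
      have "P l (x /\<^sub>R norm x) = Q l (x /\<^sub>R norm x)"
        using elim by (intro Q(2) l) auto
      also have "\<dots> = Q l x / norm x ^ n"
        using Q(1)[OF l] by (simp add: harmonic_homogeneous_poly_def homogeneous_poly_scaleR[of n "Q l"] divide_inverse power_inverse mult.commute)
      finally show ?thesis .
    qed
    then show ?case using elim by (simp add: g_def)
  qed
  have uQ1: "AE x in lborel. angular_op i j u x = (\<Sum>l<k. g l (norm x) * angular_op i j (Q l) x)" for i j
    by (rule AE_angular_op[OF _ _ uQ]) (auto intro: smooth_fun_differentiable u sm)
  have "AE x in lborel. angular_op i j (angular_op i j u) x
      = (\<Sum>l<k. g l (norm x) * angular_op i j (angular_op i j (Q l)) x)" for i j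
    by (rule AE_angular_op[OF _ _ uQ1]) (auto intro: smooth_fun_differentiable smooth_fun_angular_op u sm)
  then have "AE x in lborel. \<forall>i\<in>UNIV. \<forall>j\<in>UNIV. angular_op i j (angular_op i j u) x
      = (\<Sum>l<k. g l (norm x) * angular_op i j (angular_op i j (Q l)) x)"
    by (intro AE_finite_allI) auto
  then have "AE x in lborel. (\<Sum>i\<in>UNIV. \<Sum>j\<in>UNIV. angular_op i j (angular_op i j u) x)
      = - 2 * lambda_n CARD('n) n * u x"
    using uQ
  proof eventually_elim
    case (elim x)
    have "(\<Sum>i\<in>UNIV. \<Sum>j\<in>UNIV. angular_op i j (angular_op i j u) x)
        = (\<Sum>i\<in>UNIV. \<Sum>j\<in>UNIV. \<Sum>l<k. g l (norm x) * angular_op i j (angular_op i j (Q l)) x)"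
      using elim(1) by simp
    also have "\<dots> = (\<Sum>i\<in>UNIV. \<Sum>l<k. \<Sum>j\<in>UNIV. g l (norm x) * angular_op i j (angular_op i j (Q l)) x)"
      by (intro sum.cong refl sum.swap)
    also have "\<dots> = (\<Sum>l<k. g l (norm x) * (\<Sum>i\<in>UNIV. \<Sum>j\<in>UNIV. angular_op i j (angular_op i j (Q l)) x))"
      unfolding sum_distrib_left by (rule sum.swap)
    also have "\<dots> = (\<Sum>l<k. g l (norm x) * (- 2 * lambda_n CARD('n) n * Q l x))"
      by (intro sum.cong refl arg_cong[of _ _ "(*) _"] sum_angular_op_harmonic Q) auto
    also have "\<dots> = - 2 * lambda_n CARD('n) n * u x"
      unfolding elim(2) sum_distrib_left by (intro sum.cong refl) simp
    finally show ?case .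
  qed
  then have "(\<Sum>i\<in>UNIV. \<Sum>j\<in>UNIV. angular_op i j (angular_op i j u) x) = - 2 * lambda_n CARD('n) n * u x"
  proof (rule AE_lborel_continuous_eq[where S = UNIV])
    show "continuous_on UNIV (\<lambda>x. \<Sum>i\<in>UNIV. \<Sum>j\<in>UNIV. angular_op i j (angular_op i j u) x)"
      by (rule smooth_fun_continuous) (intro smooth_fun_sum smooth_fun_angular_op u)
    show "continuous_on UNIV (\<lambda>x. - 2 * lambda_n CARD('n) n * u x)"
      by (rule smooth_fun_continuous) (intro smooth_fun_mult smooth_fun_const u)
  qed auto
  then show ?thesis unfolding sum_angular_op_angular_op[OF u] by (simp add: algebra_simps)
qed

section \<open>The lower bound\<close>

text \<open>The integrating factor exp (- s t z) turns the equation into an expression for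
  \<open>w x\<close> as an integral of \<open>g\<close> along the ray, up to a time at which
  \<open>w\<close> vanishes. For s = 1 this time exists because the support is bounded, for s = -1
  because the support avoids a ball around the origin. The imaginary part of \<open>z\<close> only
  rotates the integrand, so the rate is governed by \<open>Re z\<close>.\<close>

lemma Lp_norm_ray_ode_le:
  fixes w g :: "'a::euclidean_space \<Rightarrow> complex"
  assumes p: "1 \<le> p" and w: "continuous_on (- {0}) w" and g: "continuous_on (- {0}) g"
    and d: "\<And>x t. x \<noteq> 0 \<Longrightarrow> ((\<lambda>t. w (exp t *\<^sub>R x)) has_vector_derivative
        z * w (exp t *\<^sub>R x) + g (exp t *\<^sub>R x)) (at t)"
    and supp: "0 < r" "0 < R" "\<And>x. norm x < r \<Longrightarrow> w x = 0" "\<And>x. R < norm x \<Longrightarrow> w x = 0"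
  shows "ennreal \<bar>Re z + real DIM('a) * inv_exp p\<bar> * Lp_norm lborel p (\<lambda>x. norm (w x))
    \<le> Lp_norm lborel p (\<lambda>x. norm (g x))"
proof (cases "Re z + real DIM('a) * inv_exp p = 0")
  case False
  define s :: real where "s = (if Re z + real DIM('a) * inv_exp p > 0 then 1 else - 1)"
  have s: "s = 1 \<or> s = - 1" by (simp add: s_def)
  have k: "\<bar>Re z + real DIM('a) * inv_exp p\<bar> = s * (Re z + real DIM('a) * inv_exp p)"
    by (simp add: s_def)
  show ?thesis
  proof (rule Lp_norm_ray_le[OF p _ _ s k])
    show "(\<lambda>x. norm (w x)) \<in> borel_measurable borel"
      using continuous_off_origin_borel[OF w] by measurable
    show "continuous_on (- {0}) (\<lambda>x. norm (g x))" using g by (rule continuous_on_norm)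
    show "0 < \<bar>Re z + real DIM('a) * inv_exp p\<bar>" using False by simp
    fix x :: 'a assume x: "x \<noteq> 0"
    define \<phi> where "\<phi> t = exp (- (of_real (s * t) * z)) * w (exp (s * t) *\<^sub>R x)" for t
    define \<phi>' where "\<phi>' t = of_real s * exp (- (of_real (s * t) * z)) * g (exp (s * t) *\<^sub>R x)" for t
    have d\<phi>: "(\<phi> has_vector_derivative \<phi>' t) (at t)" for t
    proof -
      have "((\<lambda>t. s * t) has_vector_derivative s) (at t)"
        by (auto intro!: derivative_eq_intros)
      from vector_diff_chain_at[OF this d[OF x]]
      have 1: "((\<lambda>t. w (exp (s * t) *\<^sub>R x)) has_vector_derivative
          s *\<^sub>R (z * w (exp (s * t) *\<^sub>R x) + g (exp (s * t) *\<^sub>R x))) (at t)"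
        by (simp add: o_def)
      have "((\<lambda>t. - (of_real (s * t) * z)) has_vector_derivative - (of_real s * z)) (at t)"
        by (auto intro!: derivative_eq_intros simp: has_vector_derivative_def scaleR_conv_of_real)
      from field_vector_diff_chain_at[OF this DERIV_exp]
      have 2: "((\<lambda>t. exp (- (of_real (s * t) * z))) has_vector_derivative
          - (of_real s * z) * exp (- (of_real (s * t) * z))) (at t)"
        by (simp add: o_def)
      show ?thesis unfolding \<phi>_def[abs_def]
        by (rule has_vector_derivative_eq_rhs[OF has_vector_derivative_mult[OF 2 1]])
          (simp add: \<phi>'_def scaleR_conv_of_real algebra_simps)
    qed
    \<comment> \<open>Large enough for both directions: exp (s T) x lies beyond the radius
      \<open>R\<close> if s = 1 and inside the radius \<open>r\<close> if s = -1.\<close>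
    define T where "T = \<bar>ln (R / norm x)\<bar> + \<bar>ln (r / norm x)\<bar> + 1"
    have T: "0 \<le> T" by (simp add: T_def)
    have \<phi>T: "\<phi> T = 0"
    proof -
      have nx: "norm (exp (s * T) *\<^sub>R x) = exp (s * T) * norm x" by simp
      have "w (exp (s * T) *\<^sub>R x) = 0"
      proof (cases "s = 1")
        case True
        have "R / norm x = exp (ln (R / norm x))" using x supp by simp
        also have "\<dots> < exp (s * T)" unfolding exp_less_cancel_iff using True by (simp add: T_def)
        finally show ?thesis using x by (intro supp(4)) (simp add: field_simps)
      next
        case False
        have "exp (s * T) < exp (ln (r / norm x))"
          unfolding exp_less_cancel_iff using False s by (simp add: T_def)
        also have "\<dots> = r / norm x" using x supp by simp
        finally show ?thesis using x by (intro supp(3)) (simp add: field_simps)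
      qed
      then show ?thesis by (simp add: \<phi>_def)
    qed
    have c: "continuous_on UNIV (\<lambda>t. g (exp (s * t) *\<^sub>R x))"
      using x by (intro continuous_on_compose2[OF g] continuous_intros) auto
    have "continuous_on UNIV \<phi>'"
      unfolding \<phi>'_def[abs_def] by (intro continuous_intros c)
    then have "has_bochner_integral lborel (\<lambda>t. indicator {0..T} t *\<^sub>R \<phi>' t) (\<phi> T - \<phi> 0)"
      using d\<phi> T by (intro has_bochner_integral_FTC_Icc)
        (auto intro: has_vector_derivative_at_within continuous_on_subset)
    then have i: "integrable lborel (\<lambda>t. indicator {0..T} t *\<^sub>R \<phi>' t)"
      and e: "(\<integral>t. indicator {0..T} t *\<^sub>R \<phi>' t \<partial>lborel) = \<phi> T - \<phi> 0"
      by (auto simp: has_bochner_integral_iff)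
    have "ennreal \<bar>norm (w x)\<bar> = ennreal (norm (\<phi> T - \<phi> 0))"
      by (simp add: \<phi>T) (simp add: \<phi>_def)
    also have "\<dots> \<le> (\<integral>\<^sup>+t. norm (indicator {0..T} t *\<^sub>R \<phi>' t) \<partial>lborel)"
      using integral_norm_bound_ennreal[OF i] by (simp add: e)
    also have "\<dots> \<le> (\<integral>\<^sup>+t. ennreal (exp (- s * Re z * t) * \<bar>norm (g (exp (s * t) *\<^sub>R x))\<bar>) * indicator {0..} t \<partial>lborel)"
      using s by (intro nn_integral_mono)
        (auto simp: \<phi>'_def norm_mult mult_ac split: split_indicator)
    finally show "ennreal \<bar>norm (w x)\<bar> \<le> \<dots>" .
  qed
qed simp

section \<open>The weighted operator on test functions\<close>

lemma euler_op_zero_on_open: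
  assumes "open S" "x \<in> S" "\<And>y. y \<in> S \<Longrightarrow> u y = 0"
  shows "euler_op u x = 0"
proof -
  have "(u has_derivative (\<lambda>h. 0)) (at x)"
    by (rule has_derivative_transform_within_open[OF has_derivative_const[of 0] assms(1,2)])
      (simp add: assms(3))
  then show ?thesis unfolding euler_op_def by (rule frechet_derivative_eqI)
qed

lemma test_fun_annulus:
  fixes u :: "real^'n \<Rightarrow> real"
  assumes "test_fun u"
  obtains r R where "0 < r" "0 < R" "\<And>x. norm x < r \<Longrightarrow> u x = 0" "\<And>x. R < norm x \<Longrightarrow> u x = 0"
proof -
  let ?K = "closure {x. u x \<noteq> 0}"
  have "open (- ?K)" "0 \<in> - ?K" using assms by (auto simp: test_fun_def)
  then obtain r where r: "0 < r" "ball 0 r \<subseteq> - ?K" using open_contains_ball by blast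
  have "bounded ?K" using assms by (simp add: test_fun_def compact_imp_bounded)
  then obtain R where R: "0 < R" "\<And>x. x \<in> ?K \<Longrightarrow> norm x \<le> R" using bounded_pos by blast
  show thesis
  proof (rule that[OF r(1) R(1)])
    show "u x = 0" if "norm x < r" for x
      using r(2) that closure_subset[of "{x. u x \<noteq> 0}"] by (auto simp: subset_iff)
    show "u x = 0" if "R < norm x" for x
      using R(2)[of x] that closure_subset[of "{x. u x \<noteq> 0}"] by fastforce
  qed
qed

text \<open>The weight shifts the Euler derivative by \<open>\<beta>\<close>. Thus a factor D - z
  acting on \<open>F\<close> becomes, for the weighted function, a first-order equation with
  coefficient \<open>\<beta> + z\<close>.\<close>

lemma has_derivative_along_ray:
  fixes F :: "real^'n \<Rightarrow> real"
  assumes F: "smooth_fun F" and x: "x \<noteq> 0"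
  shows "((\<lambda>t. norm (exp t *\<^sub>R x) powr \<beta> * F (exp t *\<^sub>R x)) has_real_derivative
    \<beta> * (norm (exp t *\<^sub>R x) powr \<beta> * F (exp t *\<^sub>R x)) + norm (exp t *\<^sub>R x) powr \<beta> * euler_op F (exp t *\<^sub>R x)) (at t)"
proof -
  let ?y = "exp t *\<^sub>R x"
  have u: "(F has_derivative frechet_derivative F (at ?y)) (at ?y)"
    using smooth_fun_differentiable[OF F] by (simp add: frechet_derivative_works)
  have "((\<lambda>t. exp t *\<^sub>R x) has_derivative (\<lambda>h. h *\<^sub>R ?y)) (at t)"
    by (auto intro!: derivative_eq_intros)
  from diff_chain_at[OF this u]
  have "((\<lambda>t. F (exp t *\<^sub>R x)) has_derivative (\<lambda>h. frechet_derivative F (at ?y) (h *\<^sub>R ?y))) (at t)"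
    by (simp add: o_def)
  moreover have lin: "linear (frechet_derivative F (at ?y))"
    using smooth_fun_differentiable[OF F] by (rule linear_frechet_derivative)
  have "frechet_derivative F (at ?y) (h *\<^sub>R ?y) = euler_op F ?y * h" for h
    by (simp only: linear_scale[OF lin] euler_op_def real_scaleR_def mult.commute)
  ultimately have 1: "((\<lambda>t. F (exp t *\<^sub>R x)) has_real_derivative euler_op F ?y) (at t)"
    by (simp add: has_field_derivative_def fun_eq_iff)
  have e: "norm (exp t *\<^sub>R x) powr \<beta> = exp (\<beta> * t) * norm x powr \<beta>" for t
    using x by (simp add: powr_mult exp_powr_real mult.commute)
  have 2: "((\<lambda>t. norm (exp t *\<^sub>R x) powr \<beta>) has_real_derivative \<beta> * norm ?y powr \<beta>) (at t)"
    unfolding e by (auto intro!: derivative_eq_intros)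
  show ?thesis
    by (rule DERIV_cong[OF DERIV_mult[OF 2 1]]) (simp add: algebra_simps)
qed

lemma norm_sq_opL:
  fixes u :: "real^'n \<Rightarrow> real"
  assumes "smooth_fun u" "in_Lpn p n u" "x \<noteq> 0"
  shows "(norm x)\<^sup>2 * opL b c u x = euler_op (euler_op u) x + (real CARD('n) - 2 + c) * euler_op u x
    - (b + lambda_n CARD('n) n) * u x"
proof -
  have "(norm x)\<^sup>2 * opL b c u x = (norm x)\<^sup>2 * laplacian u x + c * euler_op u x - b * u x"
    using assms(3) by (simp add: opL_def euler_op_def field_simps)
  then show ?thesis
    unfolding laplacian_Lpn[OF assms(1,2)] by (simp add: algebra_simps)
qed

text \<open>The hypotheses \<open>z\<close> say that D^2 + (N - 2 + c) D - (b + lambda_n) = (D - z1)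
  (D - z2). They are stated with complex roots so that both signs of the discriminant are covered at
  once; the two first-order estimates are chained.\<close>

lemma rellich_lower_bound:
  fixes u :: "real^'n \<Rightarrow> real" and z1 z2 :: complex
  assumes p: "1 \<le> p" and u: "test_fun u" "in_Lpn p n u"
    and z: "z1 + z2 = - of_real (real CARD('n) - 2 + c)" "z1 * z2 = - of_real (b + lambda_n CARD('n) n)"
    and \<theta>: "\<theta> = \<alpha> - 2 + real CARD('n) * inv_exp p"
  shows "ennreal (\<bar>Re z1 + \<theta>\<bar> * \<bar>Re z2 + \<theta>\<bar>) * Lp_norm lborel p (\<lambda>x. norm x powr (\<alpha> - 2) * u x)
    \<le> Lp_norm lborel p (\<lambda>x. norm x powr \<alpha> * opL b c u x)"
proof -
  let ?\<beta> = "\<alpha> - 2" and ?e = "euler_op u" and ?d = "euler_op (euler_op u)"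
  have sm: "smooth_fun u" "smooth_fun ?e" "smooth_fun ?d"
    using u by (auto simp: test_fun_def intro: smooth_fun_euler_op)
  obtain r R where rR: "0 < r" "0 < R" "\<And>x. norm x < r \<Longrightarrow> u x = 0" "\<And>x. R < norm x \<Longrightarrow> u x = 0"
    using test_fun_annulus[OF u(1)] by blast
  have e0: "?e x = 0" if "norm x < r" for x
    using that rR(3) by (intro euler_op_zero_on_open[of "ball 0 r"]) auto
  have eR: "?e x = 0" if "R < norm x" for x
    using that rR(4) by (intro euler_op_zero_on_open[of "- cball 0 R"]) auto
  define U where "U x = norm x powr ?\<beta> * u x" for x
  define V where "V x = norm x powr ?\<beta> * ?e x" for x
  define H where "H x = norm x powr ?\<beta> * ?d x" for x
  have cnt: "continuous_on (- {0}) U" "continuous_on (- {0}) V" "continuous_on (- {0}) H"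
    unfolding U_def V_def H_def by (intro continuous_intros smooth_fun_continuous sm; force)+
  have dU: "((\<lambda>t. U (exp t *\<^sub>R x)) has_real_derivative ?\<beta> * U (exp t *\<^sub>R x) + V (exp t *\<^sub>R x)) (at t)"
    and dV: "((\<lambda>t. V (exp t *\<^sub>R x)) has_real_derivative ?\<beta> * V (exp t *\<^sub>R x) + H (exp t *\<^sub>R x)) (at t)"
    if "x \<noteq> 0" for x t
    unfolding U_def V_def H_def using has_derivative_along_ray that sm by blast+
  \<comment> \<open>\<open>w1\<close> is the weighted (D - z2) u and \<open>h\<close> the weighted
    (D - z1) (D - z2) u; \<open>w1\<close> again vanishes outside the annulus, so the first-order
    estimate applies to it too.\<close>
  define w1 where "w1 x = of_real (V x) - z2 * of_real (U x)" for x
  define h where "h x = complex_of_real (H x + (real CARD('n) - 2 + c) * V x - (b + lambda_n CARD('n) n) * U x)" for x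
  have cw1: "continuous_on (- {0}) w1" unfolding w1_def by (intro continuous_intros cnt)
  have 1: "ennreal \<bar>Re (of_real ?\<beta> + z2) + real DIM(real^'n) * inv_exp p\<bar> * Lp_norm lborel p (\<lambda>x. norm (complex_of_real (U x)))
    \<le> Lp_norm lborel p (\<lambda>x. norm (w1 x))"
  proof (rule Lp_norm_ray_ode_le[OF p _ cw1 _ rR(1,2)])
    show "continuous_on (- {0}) (\<lambda>x. complex_of_real (U x))" by (intro continuous_intros cnt)
    fix x :: "real^'n" and t :: real assume "x \<noteq> 0"
    from has_vector_derivative_of_real[OF dU[OF this]]
    show "((\<lambda>t. complex_of_real (U (exp t *\<^sub>R x))) has_vector_derivative
        (of_real ?\<beta> + z2) * of_real (U (exp t *\<^sub>R x)) + w1 (exp t *\<^sub>R x)) (at t)"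
      by (rule has_vector_derivative_eq_rhs) (simp add: w1_def algebra_simps)
  qed (simp_all add: U_def rR)
  have 2: "ennreal \<bar>Re (of_real ?\<beta> + z1) + real DIM(real^'n) * inv_exp p\<bar> * Lp_norm lborel p (\<lambda>x. norm (w1 x))
    \<le> Lp_norm lborel p (\<lambda>x. norm (h x))"
  proof (rule Lp_norm_ray_ode_le[OF p cw1 _ _ rR(1,2)])
    show "continuous_on (- {0}) h" unfolding h_def by (intro continuous_intros cnt)
    fix x :: "real^'n" and t :: real assume x: "x \<noteq> 0"
    let ?y = "exp t *\<^sub>R x"
    note * = dU[OF x] dV[OF x]
    have "((\<lambda>t. w1 (exp t *\<^sub>R x)) has_vector_derivative
        of_real (?\<beta> * V ?y + H ?y) - z2 * of_real (?\<beta> * U ?y + V ?y)) (at t)"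
      unfolding w1_def
      by (intro has_vector_derivative_diff has_vector_derivative_mult_right has_vector_derivative_of_real *)
    moreover have "of_real (?\<beta> * V ?y + H ?y) - z2 * of_real (?\<beta> * U ?y + V ?y)
        = (of_real ?\<beta> + z1) * w1 ?y + h ?y"
    proof -
      have "h ?y = of_real (H ?y) - (z1 + z2) * of_real (V ?y) + z1 * z2 * of_real (U ?y)"
        unfolding z h_def by (simp add: algebra_simps)
      then show ?thesis unfolding w1_def by (simp add: algebra_simps)
    qed
    ultimately show "((\<lambda>t. w1 (exp t *\<^sub>R x)) has_vector_derivative (of_real ?\<beta> + z1) * w1 ?y + h ?y) (at t)"
      by simp
  qed (simp_all add: w1_def U_def V_def rR e0 eR)
  have h: "h x = complex_of_real (norm x powr \<alpha> * opL b c u x)" for x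
  proof (cases "x = 0")
    \<comment> \<open>\<open>0 powr a = 0\<close> for every exponent \<open>a\<close>, so both sides
      are 0 at the origin.\<close>
    case True
    then show ?thesis by (simp add: h_def H_def V_def U_def)
  next
    case False
    have "norm x powr \<alpha> = norm x powr ?\<beta> * (norm x)\<^sup>2"
      using False powr_add[of "norm x" ?\<beta> 2] by simp
    then have "norm x powr \<alpha> * opL b c u x = norm x powr ?\<beta> * ((norm x)\<^sup>2 * opL b c u x)" by simp
    then show ?thesis
      unfolding norm_sq_opL[OF sm(1) u(2) False] h_def of_real_eq_iff
      by (simp add: H_def V_def U_def algebra_simps)
  qed
  have "ennreal (\<bar>Re z1 + \<theta>\<bar> * \<bar>Re z2 + \<theta>\<bar>) * Lp_norm lborel p (\<lambda>x. \<bar>U x\<bar>)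
      = ennreal \<bar>Re z1 + \<theta>\<bar> * (ennreal \<bar>Re z2 + \<theta>\<bar> * Lp_norm lborel p (\<lambda>x. \<bar>U x\<bar>))"
    by (simp add: ennreal_mult mult.assoc)
  also have "\<dots> \<le> ennreal \<bar>Re z1 + \<theta>\<bar> * Lp_norm lborel p (\<lambda>x. norm (w1 x))"
    using 1 by (intro mult_left_mono) (simp_all add: \<theta> algebra_simps)
  also have "\<dots> \<le> Lp_norm lborel p (\<lambda>x. \<bar>norm x powr \<alpha> * opL b c u x\<bar>)"
    using 2 by (simp add: \<theta> h algebra_simps del: of_real_mult)
  finally show ?thesis by (simp only: Lp_norm_abs U_def)
qed

section \<open>Existence of harmonic homogeneous polynomials\<close>

lemma finite_multi_indices: "finite {a::'n::finite \<Rightarrow> nat. sum a UNIV = n}"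
proof (rule finite_subset)
  show "{a::'n \<Rightarrow> nat. sum a UNIV = n} \<subseteq> Pi\<^sub>E UNIV (\<lambda>_. {..n})"
    by (auto simp: PiE_UNIV_domain intro!: member_le_sum)
  show "finite (Pi\<^sub>E (UNIV :: 'n set) (\<lambda>_. {..n}))"
    by (intro finite_PiE) auto
qed

lemma homogeneous_poly_one: "homogeneous_poly 0 (\<lambda>x::real^'n. 1)"
proof -
  have "{a::'n \<Rightarrow> nat. sum a UNIV = 0} = {\<lambda>_. 0}" by (auto simp: fun_eq_iff)
  then show ?thesis unfolding homogeneous_poly_def by (intro exI[of _ "\<lambda>_. 1"]) simp
qed

lemma homogeneous_poly_diff:
  assumes "homogeneous_poly n P" "homogeneous_poly n Q"
  shows "homogeneous_poly n (\<lambda>x. P x - Q x)"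
proof -
  obtain c d where
    "\<forall>x. P x = (\<Sum>a\<in>{a. sum a UNIV = n}. c a * (\<Prod>i\<in>UNIV. (x $ i) ^ a i))"
    "\<forall>x. Q x = (\<Sum>a\<in>{a. sum a UNIV = n}. d a * (\<Prod>i\<in>UNIV. (x $ i) ^ a i))"
    using assms unfolding homogeneous_poly_def by blast
  then show ?thesis unfolding homogeneous_poly_def
    by (intro exI[of _ "\<lambda>a. c a - d a"]) (simp add: left_diff_distrib sum_subtractf)
qed

lemma homogeneous_poly_add:
  assumes "homogeneous_poly n P" "homogeneous_poly n Q"
  shows "homogeneous_poly n (\<lambda>x. P x + Q x)"
proof -
  obtain c d where
    "\<forall>x. P x = (\<Sum>a\<in>{a. sum a UNIV = n}. c a * (\<Prod>i\<in>UNIV. (x $ i) ^ a i))"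
    "\<forall>x. Q x = (\<Sum>a\<in>{a. sum a UNIV = n}. d a * (\<Prod>i\<in>UNIV. (x $ i) ^ a i))"
    using assms unfolding homogeneous_poly_def by blast
  then show ?thesis unfolding homogeneous_poly_def
    by (intro exI[of _ "\<lambda>a. c a + d a"]) (simp add: distrib_right sum.distrib)
qed

lemma homogeneous_poly_coord_mult:
  fixes Q :: "real^'n \<Rightarrow> real"
  assumes "homogeneous_poly n Q"
  shows "homogeneous_poly (Suc n) (\<lambda>x. x $ k * Q x)"
proof -
  obtain c where c: "\<And>x. Q x = (\<Sum>a\<in>{a. sum a UNIV = n}. c a * (\<Prod>i\<in>UNIV. (x $ i) ^ a i))"
    using assms unfolding homogeneous_poly_def by blast
  define d where "d a = (if a k = 0 then 0 else c (a(k := a k - 1)))" for a :: "'n \<Rightarrow> nat"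
  have s: "sum (a(k := m)) UNIV + a k = sum a UNIV + m" for a :: "'n \<Rightarrow> nat" and m
    by (simp add: sum.remove[of UNIV k])
  have p: "(\<Prod>i\<in>UNIV. x $ i ^ (a(k := Suc (a k))) i) = x $ k * (\<Prod>i\<in>UNIV. x $ i ^ a i)"
    for a and x :: "real^'n"
    by (simp add: prod.remove[of UNIV k])
  \<comment> \<open>Raising the \<open>k\<close>-th exponent by one is a bijection onto the
    multi-indices with \<open>a k > 0\<close>; on the remaining ones \<open>d\<close> is 0.\<close>
  have "x $ k * Q x = (\<Sum>a\<in>{a. sum a UNIV = Suc n}. d a * (\<Prod>i\<in>UNIV. (x $ i) ^ a i))" for x
    unfolding c sum_distrib_left
  proof (rule sum.reindex_bij_witness_not_neutral[where S' = "{}" and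
        T' = "{a \<in> {a. sum a UNIV = Suc n}. a k = 0}" and
        i = "\<lambda>a. a(k := a k - 1)" and j = "\<lambda>a. a(k := Suc (a k))"])
    show "finite {a \<in> {a. sum a UNIV = Suc n}. a k = 0}"
      by (rule finite_subset[OF _ finite_multi_indices[of "Suc n"]]) auto
    fix a :: "'n \<Rightarrow> nat" assume "a \<in> {a. sum a UNIV = n} - {}"
    then show "a(k := Suc (a k)) \<in> {a. sum a UNIV = Suc n} - {a \<in> {a. sum a UNIV = Suc n}. a k = 0}"
      using s[of a "Suc (a k)"] by auto
  next
    fix a :: "'n \<Rightarrow> nat"
    show "d (a(k := Suc (a k))) * (\<Prod>i\<in>UNIV. x $ i ^ (a(k := Suc (a k))) i)
        = x $ k * (c a * (\<Prod>i\<in>UNIV. x $ i ^ a i))"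
      unfolding p by (simp add: d_def)
  next
    fix a :: "'n \<Rightarrow> nat" assume a: "a \<in> {a. sum a UNIV = Suc n} - {a \<in> {a. sum a UNIV = Suc n}. a k = 0}"
    then show "a(k := a k - 1) \<in> {a. sum a UNIV = n} - {}"
      using s[of a "a k - 1"] by auto
    show "(a(k := a k - 1))(k := Suc ((a(k := a k - 1)) k)) = a" using a by auto
  qed (auto simp: d_def)
  then show ?thesis unfolding homogeneous_poly_def by blast
qed

text \<open>For \<open>c = 1\<close> this is the classical harmonic polynomial Re z^n in two of the
  coordinates, and for \<open>c = - \<i>\<close> it is Im z^n. A general factor \<open>c\<close>
  makes the family closed under partial derivatives.\<close>

definition planar_power :: "'n \<Rightarrow> 'n \<Rightarrow> complex \<Rightarrow> nat \<Rightarrow> real^'n::finite \<Rightarrow> real" where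
  "planar_power i j c n x = Re (c * (of_real (x $ i) + \<i> * of_real (x $ j)) ^ n)"

text \<open>Real and imaginary parts go through one induction because multiplication by z = x_i +
  \<i> x_j mixes them.\<close>

lemma homogeneous_planar_power:
  "homogeneous_poly n (planar_power i j 1 n)" "homogeneous_poly n (planar_power i j (- \<i>) n)"
proof (induction n)
  case 0
  {
    case 1
    show ?case using homogeneous_poly_one by (simp add: planar_power_def[abs_def])
  next
    case 2
    show ?case using homogeneous_poly_diff[OF homogeneous_poly_one homogeneous_poly_one]
      by (simp add: planar_power_def[abs_def])
  }
next
  case (Suc n)
  {
    case 1
    have "planar_power i j 1 (Suc n) = (\<lambda>x. x $ i * planar_power i j 1 n x - x $ j * planar_power i j (- \<i>) n x)"
      by (auto simp: planar_power_def algebra_simps)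
    then show ?case using Suc by (simp add: homogeneous_poly_diff homogeneous_poly_coord_mult)
  next
    case 2
    have "planar_power i j (- \<i>) (Suc n) = (\<lambda>x. x $ i * planar_power i j (- \<i>) n x + x $ j * planar_power i j 1 n x)"
      by (auto simp: planar_power_def algebra_simps)
    then show ?case using Suc by (simp add: homogeneous_poly_add homogeneous_poly_coord_mult)
  }
qed

lemma partial_deriv_planar_power:
  "partial_deriv k (planar_power i j c n) =
    planar_power i j (c * of_nat n * (of_bool (k = i) + \<i> * of_bool (k = j))) (n - 1)"
proof
  fix x :: "real^'a"
  have l: "((\<lambda>x. x $ m) has_derivative (\<lambda>h. h $ m)) (at x)" for m
    by (intro bounded_linear_imp_has_derivative bounded_linear_vec_nth)
  have "((\<lambda>x. of_real (x $ i) + \<i> * of_real (x $ j) :: complex) has_derivative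
      (\<lambda>h. of_real (h $ i) + \<i> * of_real (h $ j))) (at x)"
    by (intro has_derivative_add has_derivative_mult_right has_derivative_of_real l)
  from has_derivative_power[OF this, of n]
  have "((\<lambda>x. planar_power i j c n x) has_derivative
      (\<lambda>h. Re (c * (of_nat n * (of_real (h $ i) + \<i> * of_real (h $ j)) * (of_real (x $ i) + \<i> * of_real (x $ j)) ^ (n - 1))))) (at x)"
    unfolding planar_power_def by (intro has_derivative_Re has_derivative_mult_right)
  from partial_deriv_eqI[OF this, of k]
  show "partial_deriv k (planar_power i j c n) x
    = planar_power i j (c * of_nat n * (of_bool (k = i) + \<i> * of_bool (k = j))) (n - 1) x"
  proof (rule trans)
    show "Re (c * (of_nat n * (of_real (axis k 1 $ i) + \<i> * of_real (axis k 1 $ j)) * (of_real (x $ i) + \<i> * of_real (x $ j)) ^ (n - 1)))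
        = planar_power i j (c * of_nat n * (of_bool (k = i) + \<i> * of_bool (k = j))) (n - 1) x"
      unfolding planar_power_def
      by (intro arg_cong[of _ _ Re]) (auto simp: axis_def mult_ac)
  qed
qed

text \<open>The second derivatives in directions \<open>i\<close> and \<open>j\<close> differ by the
  factor \<open>\<i>\<close> squared and cancel; the other directions contribute nothing.\<close>

lemma harmonic_planar_power:
  fixes i j :: "'n::finite"
  assumes "i \<noteq> j"
  shows "harmonic_homogeneous_poly n (planar_power i j 1 n)"
  unfolding harmonic_homogeneous_poly_def
proof (intro conjI allI homogeneous_planar_power)
  fix x :: "real^'n"
  let ?e = "\<lambda>k. of_bool (k = i) + \<i> * of_bool (k = j) :: complex"
  let ?z = "of_real (x $ i) + \<i> * of_real (x $ j) :: complex"
  have "laplacian (planar_power i j 1 n) x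
    = (\<Sum>k\<in>UNIV. Re ((?e k)\<^sup>2 * (of_nat n * of_nat (n - 1) * ?z ^ (n - 1 - 1))))"
    unfolding laplacian_def partial_deriv_planar_power planar_power_def
    by (intro sum.cong refl arg_cong[of _ _ Re]) (simp add: power2_eq_square mult_ac)
  also have "\<dots> = Re ((\<Sum>k\<in>UNIV. (?e k)\<^sup>2) * (of_nat n * of_nat (n - 1) * ?z ^ (n - 1 - 1)))"
    by (simp only: sum_distrib_right Re_sum)
  also have "(\<Sum>k\<in>UNIV. (?e k)\<^sup>2) = (\<Sum>k\<in>UNIV. of_bool (k = i)) - (\<Sum>k\<in>UNIV. of_bool (k = j))"
    unfolding sum_subtractf[symmetric] using assms
    by (intro sum.cong refl) (auto simp: power2_eq_square)
  also have "\<dots> = 0" by (simp add: of_bool_def)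
  finally show "laplacian (planar_power i j 1 n) x = 0" by simp
qed

text \<open>Dimension at least two provides the two coordinates; in dimension one no nonzero
  harmonic polynomial has degree 2 or more.\<close>

lemma exists_harmonic_homogeneous_poly:
  assumes "CARD('n::finite) \<ge> 2"
  obtains Q :: "real^'n \<Rightarrow> real" and x where "harmonic_homogeneous_poly n Q" "Q x \<noteq> 0" "norm x = 1"
proof -
  obtain i j :: 'n where ij: "i \<noteq> j"
    using assms by (metis card_2_iff' ex_card)
  have "planar_power i j 1 n (axis i 1) \<noteq> 0"
    using ij by (simp add: planar_power_def axis_def)
  with harmonic_planar_power[OF ij] show thesis by (rule that) simp
qed

section \<open>Smooth functions with logarithmic profile\<close>

text \<open>The powers of \<open>t\<close> in the denominator are exactly what differentiating the
  flat function exp (-1/t) produces, so the family spans a space closed under derivatives.\<close>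

definition flat_exp :: "nat \<Rightarrow> real \<Rightarrow> real" where
  "flat_exp k t = (if t \<le> 0 then 0 else exp (- (1 / t)) / t ^ k)"

lemma flat_exp_deriv:
  "(flat_exp k has_real_derivative flat_exp (k + 2) t - real k * flat_exp (k + 1) t) (at t)"
proof (cases "t = 0")
  case False
  show ?thesis
  proof (cases "t < 0")
    case True
    have "((\<lambda>t. 0) has_real_derivative 0) (at t)" by simp
    then have "(flat_exp k has_real_derivative 0) (at t)"
      by (rule has_field_derivative_transform_within_open[of _ _ _ "{..<0}"])
        (use True in \<open>auto simp: flat_exp_def\<close>)
    then show ?thesis using True by (simp add: flat_exp_def)
  next
    case f: False
    then have t: "0 < t" using False by simp
    have "((\<lambda>t. exp (- (1 / t)) / t ^ k) has_real_derivative
        (exp (- (1 / t)) * (1 / t\<^sup>2) * t ^ k - exp (- (1 / t)) * (real k * t ^ (k - 1))) / (t ^ k * t ^ k)) (at t)"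
      using t by (auto intro!: derivative_eq_intros simp: power2_eq_square)
    also have "(exp (- (1 / t)) * (1 / t\<^sup>2) * t ^ k - exp (- (1 / t)) * (real k * t ^ (k - 1))) / (t ^ k * t ^ k)
        = flat_exp (k + 2) t - real k * flat_exp (k + 1) t"
      using t by (cases k) (auto simp: flat_exp_def field_simps power2_eq_square)
    finally have "((\<lambda>t. exp (- (1 / t)) / t ^ k) has_real_derivative
        flat_exp (k + 2) t - real k * flat_exp (k + 1) t) (at t)" .
    then show ?thesis
      by (rule has_field_derivative_transform_within_open[of _ _ _ "{0<..}"])
        (use t in \<open>auto simp: flat_exp_def\<close>)
  qed
next
  case True
  \<comment> \<open>In terms of r = 1 / h the quotient is r^(k + 1) / exp r, and the exponential
    wins.\<close>
  have "((\<lambda>h. flat_exp k h / h) \<longlongrightarrow> 0) (at_right 0)"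
  proof -
    have "((\<lambda>h. (inverse h) ^ (k + 1) / exp (inverse h)) \<longlongrightarrow> 0) (at_right (0::real))"
      by (rule filterlim_compose[OF tendsto_power_div_exp_0 filterlim_inverse_at_top_right])
    then show ?thesis
    proof (rule Lim_transform_eventually)
      show "\<forall>\<^sub>F h in at_right 0. (inverse h) ^ (k + 1) / exp (inverse h) = flat_exp k h / h"
        using eventually_at_right_less[of "0::real"]
        by eventually_elim (simp add: flat_exp_def exp_minus field_simps)
    qed
  qed
  moreover have "((\<lambda>h. flat_exp k h / h) \<longlongrightarrow> 0) (at_left 0)"
  proof (rule Lim_transform_eventually[OF tendsto_const])
    show "\<forall>\<^sub>F h in at_left 0. 0 = flat_exp k h / h"
      using eventually_at_left_real[of "-1" "0::real"]
      by (auto elim!: eventually_mono simp: flat_exp_def)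
  qed
  ultimately have "((\<lambda>h. flat_exp k h / h) \<longlongrightarrow> 0) (at 0)"
    by (simp add: filterlim_at_split)
  then show ?thesis using True by (simp add: DERIV_def flat_exp_def)
qed

lemma continuous_on_flat_exp: "continuous_on S (flat_exp k)"
  by (meson DERIV_isCont continuous_at_imp_continuous_on flat_exp_deriv)

text \<open>The function is meant to be evaluated at y = x \<bullet> x. The parameters
  \<open>a\<close>, \<open>\<phi>\<close>, \<open>j\<close>, \<open>k\<close> are there for closure
  under differentiation: a derivative lowers \<open>a\<close> by 1, turns the cosine by pi / 2 or
  raises \<open>j\<close> or \<open>k\<close>. For \<open>R > 0\<close> the guard
  \<open>y \<le> 1\<close> creates no jump, since the first flat factor is 0 as long as
  \<open>ln y \<le> R\<close>.\<close>

definition log_profile :: "real \<Rightarrow> real \<Rightarrow> real \<Rightarrow> real \<Rightarrow> nat \<Rightarrow> nat \<Rightarrow> real \<Rightarrow> real" where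
  "log_profile \<omega> R a \<phi> j k y = (if y \<le> 1 then 0 else
     y powr a * cos (\<omega> * ln y + \<phi>) * flat_exp j (ln y / R - 1) * flat_exp k (2 - ln y / R))"

inductive log_profile_span :: "real \<Rightarrow> real \<Rightarrow> (real \<Rightarrow> real) \<Rightarrow> bool" for \<omega> R where
  base: "log_profile_span \<omega> R (\<lambda>y. s * log_profile \<omega> R a \<phi> j k y)"
| add: "log_profile_span \<omega> R F \<Longrightarrow> log_profile_span \<omega> R G \<Longrightarrow> log_profile_span \<omega> R (\<lambda>y. F y + G y)"

lemma log_profile_deriv:
  assumes R: "0 < R"
  shows "\<exists>G. log_profile_span \<omega> R G \<and> (\<forall>y. (log_profile \<omega> R a \<phi> j k has_real_derivative G y) (at y))"
proof -
  let ?p = "log_profile \<omega> R"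
  define G where "G y = a * ?p (a - 1) \<phi> j k y + (\<omega> * ?p (a - 1) (\<phi> + pi / 2) j k y
    + (1 / R * ?p (a - 1) \<phi> (j + 2) k y + ((- real j / R) * ?p (a - 1) \<phi> (j + 1) k y
    + ((- 1 / R) * ?p (a - 1) \<phi> j (k + 2) y + (real k / R) * ?p (a - 1) \<phi> j (k + 1) y))))" for y
  have "log_profile_span \<omega> R G" unfolding G_def[abs_def] by (intro log_profile_span.intros)
  moreover have "(?p a \<phi> j k has_real_derivative G y) (at y)" for y
  \<comment> \<open>Below exp R the profile is identically 0, and from exp R on
    \<open>y > 1\<close>, so the formula for the profile holds in a neighbourhood of
    \<open>y\<close>.\<close>
  proof (cases "y < exp R")
    case True
    have z: "?p a \<phi> j k x = 0" if "x < exp R" for a \<phi> j k x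
    proof (cases "x \<le> 1")
      case False
      then have "ln x < R" using that by (subst exp_less_cancel_iff[symmetric]) simp
      then show ?thesis using R by (simp add: log_profile_def flat_exp_def field_simps)
    qed (simp add: log_profile_def)
    have "((\<lambda>t. 0) has_real_derivative 0) (at y)" by simp
    then have "(?p a \<phi> j k has_real_derivative 0) (at y)"
      by (rule has_field_derivative_transform_within_open[of _ _ _ "{..<exp R}"]) (use True z in auto)
    then show ?thesis using True z by (simp add: G_def)
  next
    case False
    moreover have "1 < exp R" using R by simp
    ultimately have y: "1 < y" by linarith
    have 1: "((\<lambda>y. y powr a) has_real_derivative a * y powr (a - 1)) (at y)"
      using y by (auto intro!: derivative_eq_intros)
    have 2: "((\<lambda>y. cos (\<omega> * ln y + \<phi>)) has_real_derivative \<omega> * cos (\<omega> * ln y + (\<phi> + pi / 2)) / y) (at y)"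
    proof -
      have "cos (\<omega> * ln y + (\<phi> + pi / 2)) = - sin (\<omega> * ln y + \<phi>)"
        using cos_add[of "\<omega> * ln y + \<phi>" "pi / 2"] by (simp add: add.assoc)
      then show ?thesis using y by (auto intro!: derivative_eq_intros)
    qed
    have "((\<lambda>y. ln y / R - 1) has_real_derivative 1 / (R * y)) (at y)"
      using y R by (auto intro!: derivative_eq_intros simp: field_simps)
    from DERIV_chain2[OF flat_exp_deriv this]
    have 3: "((\<lambda>y. flat_exp j (ln y / R - 1)) has_real_derivative
        (flat_exp (j + 2) (ln y / R - 1) - real j * flat_exp (j + 1) (ln y / R - 1)) * (1 / (R * y))) (at y)" .
    have "((\<lambda>y. 2 - ln y / R) has_real_derivative - (1 / (R * y))) (at y)"
      using y R by (auto intro!: derivative_eq_intros simp: field_simps)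
    from DERIV_chain2[OF flat_exp_deriv this]
    have 4: "((\<lambda>y. flat_exp k (2 - ln y / R)) has_real_derivative
        (flat_exp (k + 2) (2 - ln y / R) - real k * flat_exp (k + 1) (2 - ln y / R)) * (- (1 / (R * y)))) (at y)" .
    have pw: "y powr (a - 1) = y powr a / y" using y by (simp add: powr_diff)
    have "((\<lambda>y. y powr a * cos (\<omega> * ln y + \<phi>) * flat_exp j (ln y / R - 1) * flat_exp k (2 - ln y / R))
        has_real_derivative G y) (at y)"
      by (rule DERIV_cong[OF DERIV_mult[OF DERIV_mult[OF DERIV_mult[OF 1 2] 3] 4]])
        (use y R in \<open>simp add: G_def log_profile_def pw field_simps\<close>)
    then show ?thesis
      by (rule has_field_derivative_transform_within_open[of _ _ _ "{1<..}"])
        (use y in \<open>auto simp: log_profile_def\<close>)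
  qed
  ultimately show ?thesis by blast
qed

lemma log_profile_span_deriv:
  assumes R: "0 < R" and F: "log_profile_span \<omega> R F"
  shows "\<exists>G. log_profile_span \<omega> R G \<and> (\<forall>y. (F has_real_derivative G y) (at y))"
  using F
proof induction
  case (base s a \<phi> j k)
  have cm: "log_profile_span \<omega> R (\<lambda>y. s * G y)" if "log_profile_span \<omega> R G" for G
    using that
  proof induction
    case (base s' a \<phi> j k)
    show ?case using log_profile_span.base[of \<omega> R "s * s'" a \<phi> j k] by (simp add: mult.assoc)
  next
    case (add F G)
    then show ?case using log_profile_span.add by (simp add: distrib_left)
  qed
  obtain G where "log_profile_span \<omega> R G" "\<forall>y. (log_profile \<omega> R a \<phi> j k has_real_derivative G y) (at y)"
    using log_profile_deriv[OF R] by blast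
  then show ?case using cm by (intro exI[of _ "\<lambda>y. s * G y"]) (auto intro: DERIV_cmult)
next
  case (add F1 F2)
  then obtain G1 G2 where "log_profile_span \<omega> R G1" "\<forall>y. (F1 has_real_derivative G1 y) (at y)"
    "log_profile_span \<omega> R G2" "\<forall>y. (F2 has_real_derivative G2 y) (at y)" by blast
  then show ?case
    by (intro exI[of _ "\<lambda>y. G1 y + G2 y"]) (auto intro: DERIV_add log_profile_span.add)
qed

text \<open>The variable x \<bullet> x is used because it is a polynomial: the chain rule only
  brings in the factors \<open>2 * x $ i\<close>, and the origin is no exception.\<close>

lemma smooth_fun_radial:
  fixes K :: "(real \<Rightarrow> real) \<Rightarrow> bool"
  assumes K: "\<And>F. K F \<Longrightarrow> \<exists>G. K G \<and> (\<forall>y. (F has_real_derivative G y) (at y))" and F: "K F"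
  shows "smooth_fun (\<lambda>x::real^'n. F (x \<bullet> x))"
proof -
  let ?B = "\<lambda>u::real^'n \<Rightarrow> real. smooth_fun u \<or> (\<exists>F. K F \<and> u = (\<lambda>x. F (x \<bullet> x)))"
  show ?thesis
  proof (rule smooth_fun_fun_alg[of ?B])
    fix u :: "real^'n \<Rightarrow> real" assume "?B u"
    then show "(\<forall>x. u differentiable (at x)) \<and> (\<forall>i. fun_alg ?B (partial_deriv i u))"
    proof (elim disjE exE conjE)
      fix F assume F: "K F" "u = (\<lambda>x. F (x \<bullet> x))"
      then obtain G where G: "K G" "\<And>y. (F has_real_derivative G y) (at y)" using K by blast
      have d: "(u has_derivative (\<lambda>h. G (x \<bullet> x) * (x \<bullet> h + h \<bullet> x))) (at x)" for x
      proof -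
        have 1: "((\<lambda>x. x \<bullet> x) has_derivative (\<lambda>h. x \<bullet> h + h \<bullet> x)) (at x)"
          by (rule has_derivative_inner) (auto intro: has_derivative_ident)
        have 2: "(F has_derivative (\<lambda>h. G (x \<bullet> x) * h)) (at (x \<bullet> x))"
          using G(2) by (simp add: has_field_derivative_def)
        show ?thesis using diff_chain_at[OF 1 2] unfolding F(2) by (simp add: o_def)
      qed
      have p: "partial_deriv i u = (\<lambda>x. G (x \<bullet> x) * (2 * x $ i))" for i
        by (rule ext) (simp add: partial_deriv_eqI[OF d] inner_axis inner_axis')
      have "fun_alg ?B (partial_deriv i u)" for i
        unfolding p
      proof (rule fun_alg.mult)
        show "fun_alg ?B (\<lambda>x. G (x \<bullet> x))" using G(1) by (intro fun_alg.base) blast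
        show "fun_alg ?B (\<lambda>x. 2 * x $ i)"
          by (intro fun_alg.base disjI1 smooth_fun_mult smooth_fun_const smooth_fun_coord)
      qed
      then show ?thesis using d unfolding differentiable_def by blast
    next
      assume "smooth_fun u"
      then show ?thesis using smooth_fun_differentiable smooth_fun_partial
        by (metis (no_types, lifting) fun_alg.base)
    qed
  next
    show "fun_alg ?B (\<lambda>x. F (x \<bullet> x))" using F by (intro fun_alg.base) blast
  qed
qed

section \<open>Norms in the logarithmic variable\<close>

lemma Lp_norm_finite:
  assumes p: "1 \<le> p" and A: "A \<in> sets M" "emeasure M A < \<infinity>"
    and f: "\<And>x. x \<in> space M \<Longrightarrow> \<bar>f x\<bar> \<le> B * indicator A x"
  shows "Lp_norm M p f < \<infinity>"
proof (cases "p = \<infinity>")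
  case True
  have "Lp_norm M \<infinity> f \<le> ennreal \<bar>B\<bar>"
    unfolding Lp_norm_infinity_le_iff
  proof (rule AE_I2)
    fix x assume "x \<in> space M"
    from f[OF this] show "ennreal \<bar>f x\<bar> \<le> ennreal \<bar>B\<bar>"
      by (intro ennreal_leI) (cases "x \<in> A"; simp)
  qed
  then show ?thesis using True by (simp add: le_less_trans)
next
  case False
  have q: "1 \<le> enn2real p" using enn2real_ge_1 p False by auto
  have "(\<integral>\<^sup>+ x. ennreal (\<bar>f x\<bar> powr enn2real p) \<partial>M)
      \<le> (\<integral>\<^sup>+ x. ennreal (\<bar>B\<bar> powr enn2real p) * indicator A x \<partial>M)"
  proof (rule nn_integral_mono)
    fix x assume x: "x \<in> space M"
    show "ennreal (\<bar>f x\<bar> powr enn2real p) \<le> ennreal (\<bar>B\<bar> powr enn2real p) * indicator A x"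
    proof (cases "x \<in> A")
      case True
      then have "\<bar>f x\<bar> \<le> \<bar>B\<bar>" using f[OF x] by (cases "x \<in> A") auto
      then show ?thesis using True q by (auto intro!: ennreal_leI powr_mono2)
    next
      case False
      then show ?thesis using f[OF x] by simp
    qed
  qed
  also have "\<dots> = ennreal (\<bar>B\<bar> powr enn2real p) * emeasure M A"
    using A by (simp add: nn_integral_cmult_indicator)
  also have "\<dots> < \<infinity>" using A by (simp add: ennreal_mult_less_top)
  finally show ?thesis using False by (auto simp: Lp_norm_def Let_def)
qed

lemma Lp_norm_eq_0_AE:
  assumes p: "1 \<le> p" and f: "f \<in> borel_measurable M" and z: "Lp_norm M p f = 0"
  shows "AE x in M. f x = 0"
proof (cases "p = \<infinity>")
  case True
  then have "AE x in M. ennreal \<bar>f x\<bar> \<le> 0"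
    using z Lp_norm_infinity_le_iff[of M f 0] by simp
  then show ?thesis by eventually_elim simp
next
  case False
  have "(\<integral>\<^sup>+ x. ennreal (\<bar>f x\<bar> powr enn2real p) \<partial>M) = 0"
    using Lp_norm_le_iff[OF p False, of 0 M f] z by simp
  then have "AE x in M. ennreal (\<bar>f x\<bar> powr enn2real p) = 0"
    using f by (simp add: nn_integral_0_iff_AE)
  then show ?thesis by eventually_elim simp
qed

text \<open>
  The weight makes this norm invariant under translations of \<open>h\<close>, which replaces integration in
  polar coordinates.
\<close>
definition log_norm :: "ennreal \<Rightarrow> ('a::euclidean_space \<Rightarrow> real) \<Rightarrow> (real \<Rightarrow> real) \<Rightarrow> ennreal" where
  "log_norm p Y h = Lp_norm lborel p
    (\<lambda>x. norm x powr (- real DIM('a) * inv_exp p) * h (ln (norm x)) * Y x)"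

text \<open>In the application \<open>Y x = Q x / norm x ^ n\<close> with a harmonic polynomial
  \<open>Q\<close> of degree \<open>n\<close>, which off the origin depends on the direction
  alone.\<close>

context
  fixes p :: ennreal and Y :: "'a::euclidean_space \<Rightarrow> real" and K :: real
  assumes p: "1 \<le> p" and Y: "Y \<in> borel_measurable borel"
    and Y_bound: "\<And>x. \<bar>Y x\<bar> \<le> K" and Y_scale: "\<forall>t>0. \<forall>x. Y (t *\<^sub>R x) = Y x"
begin

lemma log_norm_mono:
  assumes "\<And>s. \<bar>h s\<bar> \<le> \<bar>h' s\<bar>"
  shows "log_norm p Y h \<le> log_norm p Y h'"
  unfolding log_norm_def using assms
  by (intro Lp_norm_mono[OF p] AE_I2) (auto simp: abs_mult intro!: mult_right_mono mult_left_mono)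

lemma log_norm_triangle:
  assumes "h \<in> borel_measurable borel" "h' \<in> borel_measurable borel"
  shows "log_norm p Y (\<lambda>s. h s + h' s) \<le> log_norm p Y h + log_norm p Y h'"
proof -
  have "log_norm p Y (\<lambda>s. h s + h' s) = Lp_norm lborel p
    (\<lambda>x. norm x powr (- real DIM('a) * inv_exp p) * h (ln (norm x)) * Y x
      + norm x powr (- real DIM('a) * inv_exp p) * h' (ln (norm x)) * Y x)"
    by (simp add: log_norm_def algebra_simps)
  also have "\<dots> \<le> log_norm p Y h + log_norm p Y h'"
    unfolding log_norm_def by (intro Lp_norm_triangle p) (use assms Y in measurable)
  finally show ?thesis .
qed

lemma log_norm_cmult:
  assumes "h \<in> borel_measurable borel"
  shows "log_norm p Y (\<lambda>s. c * h s) \<le> ennreal \<bar>c\<bar> * log_norm p Y h"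
proof -
  have "log_norm p Y (\<lambda>s. c * h s) = Lp_norm lborel p
    (\<lambda>x. c * (norm x powr (- real DIM('a) * inv_exp p) * h (ln (norm x)) * Y x))"
    by (simp add: log_norm_def mult_ac)
  also have "\<dots> \<le> ennreal \<bar>c\<bar> * log_norm p Y h"
    unfolding log_norm_def by (intro Lp_norm_cmult_le p) (use assms Y in measurable)
  finally show ?thesis .
qed

text \<open>Translating \<open>h\<close> by \<open>\<tau>\<close> amounts to dilating
  \<open>x\<close> by exp \<tau>; the weight |x|^(-N/p) cancels the factor that the dilation
  contributes.\<close>

lemma log_norm_translate:
  assumes "h \<in> borel_measurable borel"
  shows "log_norm p Y (\<lambda>s. h (\<tau> + s)) \<le> log_norm p Y h"
proof -
  let ?n = "- real DIM('a) * inv_exp p"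
  let ?G = "\<lambda>x. norm x powr ?n * h (ln (norm x)) * Y x"
  have G: "?G \<in> borel_measurable borel" using assms Y by measurable
  have "log_norm p Y (\<lambda>s. h (\<tau> + s)) = Lp_norm lborel p (\<lambda>x. exp (- \<tau> * ?n) * ?G (exp \<tau> *\<^sub>R x))"
    unfolding log_norm_def
  proof (intro arg_cong[of _ _ "Lp_norm lborel p"] ext)
    fix x :: 'a
    show "norm x powr ?n * h (\<tau> + ln (norm x)) * Y x = exp (- \<tau> * ?n) * ?G (exp \<tau> *\<^sub>R x)"
    proof (cases "x = 0")
      case False
      have "exp (- \<tau> * ?n) * exp \<tau> powr ?n = 1"
        by (simp add: exp_powr_real exp_add[symmetric])
      then have "exp (- \<tau> * ?n) * norm (exp \<tau> *\<^sub>R x) powr ?n = norm x powr ?n"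
        by (simp add: powr_mult flip: mult.assoc)
      moreover have "ln (norm (exp \<tau> *\<^sub>R x)) = \<tau> + ln (norm x)"
        using False by (simp add: ln_mult)
      ultimately show ?thesis by (simp add: Y_scale flip: mult.assoc)
    qed simp
  qed
  also have "\<dots> \<le> ennreal \<bar>exp (- \<tau> * ?n)\<bar> * Lp_norm lborel p (\<lambda>x. ?G (exp \<tau> *\<^sub>R x))"
    by (rule Lp_norm_cmult_le[OF p]) (use assms Y in measurable)
  also have "\<dots> \<le> ennreal \<bar>exp (- \<tau> * ?n)\<bar> * (ennreal (exp \<tau> powr ?n) * Lp_norm lborel p ?G)"
    by (intro mult_left_mono Lp_norm_dilation_le[OF p _ G]) auto
  also have "\<dots> = Lp_norm lborel p ?G"
  proof -
    have "\<bar>exp (- \<tau> * ?n)\<bar> * exp \<tau> powr ?n = 1"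
      by (simp add: exp_powr_real exp_add[symmetric])
    then have "ennreal \<bar>exp (- \<tau> * ?n)\<bar> * ennreal (exp \<tau> powr ?n) = 1"
      by (metis abs_ge_zero ennreal_1 ennreal_mult powr_ge_zero)
    then show ?thesis by (simp only: mult.assoc[symmetric] mult_1)
  qed
  finally show ?thesis by (simp add: log_norm_def)
qed

lemma log_norm_finite:
  assumes h: "\<And>s. \<bar>h s\<bar> \<le> M * indicator {a..b} s"
  shows "log_norm p Y h < \<infinity>"
  unfolding log_norm_def
proof (rule Lp_norm_finite[OF p])
  let ?n = "- real DIM('a) * inv_exp p"
  have n: "?n \<le> 0" by (simp add: inv_exp_def)
  have M: "0 \<le> M * indicator {a..b} s" for s using h[of s] by (meson abs_ge_zero order_trans)
  have K: "0 \<le> K" using Y_bound[of 0] by simp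
  fix x :: 'a
  show "\<bar>norm x powr ?n * h (ln (norm x)) * Y x\<bar> \<le> exp a powr ?n * \<bar>M\<bar> * K * indicator (cball 0 (exp b)) x"
  proof (cases "x \<noteq> 0 \<and> a \<le> ln (norm x) \<and> ln (norm x) \<le> b")
    case True
    then have nx: "exp a \<le> norm x" "norm x \<le> exp b"
      by (auto simp: ln_ge_iff) (metis exp_le_cancel_iff exp_ln norm_le_zero_iff not_le)
    have "norm x powr ?n \<le> exp a powr ?n"
      using nx n by (intro powr_mono2') auto
    moreover have "\<bar>h (ln (norm x))\<bar> \<le> \<bar>M\<bar>" using h[of "ln (norm x)"] True by simp
    ultimately have "norm x powr ?n * \<bar>h (ln (norm x))\<bar> * \<bar>Y x\<bar> \<le> exp a powr ?n * \<bar>M\<bar> * K"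
      using Y_bound by (intro mult_mono) auto
    then show ?thesis using nx by (simp add: abs_mult)
  next
    case False
    then have "x = 0 \<or> h (ln (norm x)) = 0" using h[of "ln (norm x)"] by auto
    then show ?thesis using K by auto
  qed
qed (simp_all add: emeasure_lborel_cball_finite flip: infinity_ennreal_def)

lemma log_norm_pos:
  assumes ab: "a < b" and x0: "x0 \<noteq> 0" "Y x0 \<noteq> 0" and c: "continuous_on (- {0}) Y"
  shows "log_norm p Y (indicator {a..b}) \<noteq> 0"
proof
  let ?n = "- real DIM('a) * inv_exp p"
  assume "log_norm p Y (indicator {a..b}) = 0"
  then have ae: "AE x in lborel. norm x powr ?n * indicator {a..b} (ln (norm x)) * Y x = 0"
    unfolding log_norm_def by (rule Lp_norm_eq_0_AE[OF p, rotated]) (use Y in measurable)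
  define S where "S = {x \<in> - {0}. Y x \<noteq> 0} \<inter> {x. exp a < norm x} \<inter> {x. norm x < exp b}"
  have "open ({x \<in> - {0}. Y x \<noteq> 0})"
  proof -
    have "open (- {0} \<inter> Y -` (- {0}))"
      by (rule continuous_open_preimage[OF c]) auto
    then show ?thesis by (simp add: Int_def vimage_def)
  qed
  then have S: "open S"
    unfolding S_def by (intro open_Int open_Collect_less continuous_intros) auto
  \<comment> \<open>\<open>x0\<close> is moved along its ray to a radius strictly between exp a and
    exp b, which leaves the value of \<open>Y\<close> unchanged.\<close>
  define x1 where "x1 = (exp ((a + b) / 2) / norm x0) *\<^sub>R x0"
  have "Y x1 = Y x0" unfolding x1_def using x0 Y_scale by simp
  moreover have "norm x1 = exp ((a + b) / 2)" using x0 by (simp add: x1_def)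
  ultimately have "x1 \<in> S" using x0 ab by (auto simp: S_def)
  then obtain x where x: "x \<in> S" "norm x powr ?n * indicator {a..b} (ln (norm x)) * Y x = 0"
    using AE_lborel_open_imp[OF ae S] by blast
  then have "a \<le> ln (norm x)" "ln (norm x) \<le> b"
    unfolding S_def by (auto simp: ln_ge_iff) (metis exp_le_cancel_iff exp_ln less_imp_le norm_le_zero_iff not_le)
  then show False using x by (simp add: S_def)
qed

text \<open>[R, 2R] is covered by three translates of its middle third. This lets errors supported
  on the whole interval be measured on the third where the cut-off is bounded below.\<close>

lemma log_norm_indicator_triple:
  assumes R: "0 < R"
  shows "log_norm p Y (indicator {R..2 * R}) \<le> 3 * log_norm p Y (indicator {4 * R / 3..5 * R / 3})"
proof -
  let ?i = "indicator {4 * R / 3..5 * R / 3} :: real \<Rightarrow> real"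
  have "log_norm p Y (indicator {R..2 * R}) \<le> log_norm p Y (\<lambda>s. (?i (R / 3 + s) + ?i s) + ?i (- R / 3 + s))"
    by (intro log_norm_mono) (auto simp: indicator_def)
  also have "\<dots> \<le> log_norm p Y (\<lambda>s. ?i (R / 3 + s) + ?i s) + log_norm p Y (\<lambda>s. ?i (- R / 3 + s))"
    by (intro log_norm_triangle) measurable
  also have "\<dots> \<le> (log_norm p Y (\<lambda>s. ?i (R / 3 + s)) + log_norm p Y ?i) + log_norm p Y (\<lambda>s. ?i (- R / 3 + s))"
    by (intro add_right_mono log_norm_triangle) measurable
  also have "\<dots> \<le> (log_norm p Y ?i + log_norm p Y ?i) + log_norm p Y ?i"
    by (intro add_mono log_norm_translate order_refl) measurable
  also have "\<dots> = 3 * log_norm p Y ?i"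
  proof -
    have "(3::ennreal) = 1 + 1 + 1" by simp
    then show ?thesis by (simp only: distrib_right mult_1)
  qed
  finally show ?thesis .
qed

end

section \<open>Approximate eigenfunctions\<close>

definition bump :: "real \<Rightarrow> real" where
  "bump s = flat_exp 0 (s - 1) * flat_exp 0 (2 - s)"

lemma bump_eq_0: "s \<notin> {1..2} \<Longrightarrow> bump s = 0"
  by (auto simp: bump_def flat_exp_def)

text \<open>The lower bound \<open>m\<close> is required on the middle third of [1, 2] to fit
  \<open>log_norm_indicator_triple\<close>; there 1 / (s - 1) and 1 / (2 - s) are at most 3.\<close>

lemma bump_derivatives:
  obtains d1 d2 M m where "0 < m" "0 < M"
    "\<And>s. (bump has_real_derivative d1 s) (at s)" "\<And>s. (d1 has_real_derivative d2 s) (at s)"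
    "\<And>s. \<bar>bump s\<bar> \<le> M * indicator {1..2} s" "\<And>s. \<bar>d1 s\<bar> \<le> M * indicator {1..2} s"
    "\<And>s. \<bar>d2 s\<bar> \<le> M * indicator {1..2} s" "\<And>s. s \<in> {4/3..5/3} \<Longrightarrow> m \<le> bump s"
proof -
  let ?e = "flat_exp"
  define D where "D t = ?e 4 t - 2 * ?e 3 t" for t
  define d1 where "d1 s = ?e 2 (s - 1) * ?e 0 (2 - s) - ?e 0 (s - 1) * ?e 2 (2 - s)" for s
  define d2 where "d2 s = (D (s - 1) * ?e 0 (2 - s) - ?e 2 (s - 1) * ?e 2 (2 - s))
    - (?e 2 (s - 1) * ?e 2 (2 - s) - ?e 0 (s - 1) * D (2 - s))" for s
  have e0: "(?e 0 has_real_derivative ?e 2 t) (at t)" for t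
    using flat_exp_deriv[of 0 t] by (simp add: numeral_2_eq_2)
  have e2: "(?e 2 has_real_derivative D t) (at t)" for t
    using flat_exp_deriv[of 2 t] by (simp add: D_def)
  have s1: "((\<lambda>s. s - 1) has_real_derivative 1) (at s)" "((\<lambda>s. 2 - s) has_real_derivative - 1) (at s)" for s :: real
    by (auto intro!: derivative_eq_intros)
  note ch = DERIV_chain2[OF e0 s1(1)] DERIV_chain2[OF e0 s1(2)] DERIV_chain2[OF e2 s1(1)] DERIV_chain2[OF e2 s1(2)]
  have b1: "(bump has_real_derivative d1 s) (at s)" for s
    unfolding bump_def[abs_def]
    by (rule DERIV_cong[OF DERIV_mult[OF ch(1,2)]]) (simp add: d1_def)
  have b2: "(d1 has_real_derivative d2 s) (at s)" for s
    unfolding d1_def[abs_def]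
    by (rule DERIV_cong[OF DERIV_diff[OF DERIV_mult[OF ch(3,2)] DERIV_mult[OF ch(1,4)]]])
      (simp add: d2_def algebra_simps)
  have bd: "\<exists>B>0. \<forall>s. \<bar>f s\<bar> \<le> B * indicator {1..2} s"
    if c: "continuous_on UNIV f" and z: "\<And>s. s \<notin> {1..2} \<Longrightarrow> f s = 0" for f :: "real \<Rightarrow> real"
  proof -
    have "compact (f ` {1..2})"
      using continuous_on_subset[OF c] by (intro compact_continuous_image) auto
    then obtain B where "0 < B" "\<forall>y\<in>f ` {1..2}. norm y \<le> B"
      using compact_imp_bounded bounded_pos by blast
    then show ?thesis using z by (intro exI[of _ B]) (auto simp: indicator_def)
  qed
  have cb: "continuous_on UNIV bump" using b1 by (meson DERIV_isCont continuous_at_imp_continuous_on)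
  have c1: "continuous_on UNIV d1" using b2 by (meson DERIV_isCont continuous_at_imp_continuous_on)
  have c2: "continuous_on UNIV d2"
    unfolding d2_def D_def
    by (intro continuous_intros continuous_on_compose2[OF continuous_on_flat_exp[of UNIV]]) auto
  obtain B0 where B0: "0 < B0" "\<And>s. \<bar>bump s\<bar> \<le> B0 * indicator {1..2} s"
    using bd[OF cb] bump_eq_0 by blast
  obtain B1 where B1: "0 < B1" "\<And>s. \<bar>d1 s\<bar> \<le> B1 * indicator {1..2} s"
    using bd[OF c1] by (force simp: d1_def flat_exp_def)
  obtain B2 where B2: "0 < B2" "\<And>s. \<bar>d2 s\<bar> \<le> B2 * indicator {1..2} s"
    using bd[OF c2] by (force simp: d2_def D_def flat_exp_def)
  let ?M = "B0 + B1 + B2"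
  show thesis
  proof (rule that[of "exp (- 3) * exp (- 3)" ?M d1 d2, OF _ _ b1 b2])
    show "\<bar>bump s\<bar> \<le> ?M * indicator {1..2} s" "\<bar>d1 s\<bar> \<le> ?M * indicator {1..2} s"
      "\<bar>d2 s\<bar> \<le> ?M * indicator {1..2} s" for s
      using B0(2)[of s] B1(2)[of s] B2(2)[of s] B0(1) B1(1) B2(1)
      by (cases "s \<in> {1..2}"; simp)+
    show "exp (- 3) * exp (- 3) \<le> bump s" if "s \<in> {4/3..5/3}" for s
    proof -
      have "1 / (s - 1) \<le> 3" "1 / (2 - s) \<le> 3" using that by (auto simp: field_simps)
      then show ?thesis using that
        unfolding bump_def by (intro mult_mono) (auto simp: flat_exp_def)
    qed
  qed (use B0 B1 B2 in auto)
qed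

definition test_profile :: "real \<Rightarrow> real \<Rightarrow> real \<Rightarrow> real \<Rightarrow> real" where
  "test_profile \<xi> R \<phi> s = cos (\<xi> * s + \<phi>) * bump (s / R)"

text \<open>Since ln (x \<bullet> x) = 2 ln |x|, frequency and exponent are halved and
  \<open>R\<close> is doubled. The extra \<open>real n\<close> in the exponent compensates for the
  degree of \<open>Q\<close>.\<close>

definition test_family :: "real \<Rightarrow> real \<Rightarrow> real \<Rightarrow> real \<Rightarrow> nat \<Rightarrow> (real^'n \<Rightarrow> real) \<Rightarrow> real^'n::finite \<Rightarrow> real" where
  "test_family \<theta> \<xi> R \<phi> n Q x =
    log_profile (\<xi> / 2) (2 * R) (- (\<theta> + real n) / 2) \<phi> 0 0 (x \<bullet> x) * Q x"

lemma log_profile_eq_0: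
  assumes "0 < R" "exp (2 * R) \<le> y"
  shows "log_profile \<omega> R a \<phi> j k y = 0"
proof -
  have "0 < exp (2 * R)" by simp
  then have "0 < y" using assms by linarith
  then have "2 * R \<le> ln y" using assms by (simp add: ln_ge_iff)
  then have "2 - ln y / R \<le> 0" using assms by (simp add: field_simps)
  then show ?thesis by (simp add: log_profile_def flat_exp_def)
qed

lemma test_family_polar:
  assumes R: "0 < R" and x: "x \<noteq> 0"
  shows "test_family \<theta> \<xi> R \<phi> n Q x =
    norm x powr (- \<theta>) * test_profile \<xi> R \<phi> (ln (norm x)) * (Q x / norm x ^ n)"
proof (cases "norm x \<le> 1")
  case True
  then have "x \<bullet> x \<le> 1" by (simp add: dot_square_norm power_le_one)
  moreover have "ln (norm x) \<le> 0" using True x by simp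
  then have "ln (norm x) / R \<le> 0" using R by (simp add: divide_nonpos_pos)
  then have "bump (ln (norm x) / R) = 0" by (intro bump_eq_0) auto
  ultimately show ?thesis by (simp add: test_family_def log_profile_def test_profile_def)
next
  case False
  then have nx: "1 < norm x" by simp
  have y: "1 < x \<bullet> x" using nx by (simp add: dot_square_norm)
  have l: "ln (x \<bullet> x) = 2 * ln (norm x)" using x by (simp add: dot_square_norm ln_realpow)
  have pw: "(x \<bullet> x) powr (- (\<theta> + real n) / 2) = norm x powr (- \<theta>) / norm x ^ n"
  proof -
    have ex: "2 * (- (\<theta> + real n) / 2) = - \<theta> - real n" by (simp add: field_simps)
    have n2: "x \<bullet> x = norm x powr 2" using x by (simp add: dot_square_norm)
    have "(x \<bullet> x) powr (- (\<theta> + real n) / 2) = norm x powr (- \<theta> - real n)"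
      unfolding n2 powr_powr ex by (rule refl)
    also have "\<dots> = norm x powr (- \<theta>) / norm x ^ n"
      using x by (simp add: powr_diff powr_realpow)
    finally show ?thesis .
  qed
  show ?thesis
    using y R unfolding test_family_def log_profile_def test_profile_def bump_def l pw by simp
qed

lemma smooth_fun_log_profile:
  assumes "0 < R"
  shows "smooth_fun (\<lambda>x::real^'n. log_profile \<omega> R a \<phi> j k (x \<bullet> x))"
  using log_profile_span.base[of \<omega> R 1 a \<phi> j k]
  by (intro smooth_fun_radial[of "log_profile_span \<omega> R"] log_profile_span_deriv assms) simp_all

lemma continuous_on_log_profile: "0 < R \<Longrightarrow> continuous_on S (log_profile \<omega> R a \<phi> j k)"
  by (meson DERIV_isCont continuous_at_imp_continuous_on log_profile_deriv)

lemma test_fun_test_family: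
  fixes Q :: "real^'n \<Rightarrow> real"
  assumes R: "0 < R" and Q: "smooth_fun Q"
  shows "test_fun (test_family \<theta> \<xi> R \<phi> n Q)"
  unfolding test_fun_def
proof (intro conjI)
  let ?u = "test_family \<theta> \<xi> R \<phi> n Q"
  show "smooth_fun ?u"
    unfolding test_family_def using R by (intro smooth_fun_mult smooth_fun_log_profile Q) simp
  let ?A = "cball 0 (exp (2 * R)) - ball 0 1 :: (real^'n) set"
  have "{x. ?u x \<noteq> 0} \<subseteq> ?A"
  proof (safe; rule ccontr)
    fix x :: "real^'n" assume u: "?u x \<noteq> 0" and "x \<notin> cball 0 (exp (2 * R))"
    then have "exp (2 * R) \<le> norm x" by simp
    then have "(exp (2 * R))\<^sup>2 \<le> (norm x)\<^sup>2" by (intro power_mono) auto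
    then have "exp (2 * (2 * R)) \<le> x \<bullet> x" by (simp add: dot_square_norm power2_eq_square flip: exp_add)
    then show False using u R by (simp add: test_family_def log_profile_eq_0)
  next
    fix x :: "real^'n" assume u: "?u x \<noteq> 0" and "x \<in> ball 0 1"
    then have "x \<bullet> x \<le> 1" by (simp add: dot_square_norm power_le_one)
    then show False using u by (simp add: test_family_def log_profile_def)
  qed
  moreover have "compact ?A" by (intro compact_diff) auto
  ultimately have cl: "closure {x. ?u x \<noteq> 0} \<subseteq> ?A"
    by (intro closure_minimal compact_imp_closed)
  then show "compact (closure {x. ?u x \<noteq> 0})"
    using bounded_subset[OF compact_imp_bounded[OF \<open>compact ?A\<close>]] by (simp add: compact_eq_bounded_closed)
  show "0 \<notin> closure {x. ?u x \<noteq> 0}" using cl by auto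
qed

lemma in_Lpn_test_family:
  fixes Q :: "real^'n \<Rightarrow> real"
  assumes p: "1 \<le> p" and R: "0 < R" and Q: "harmonic_homogeneous_poly n Q"
  shows "in_Lpn p n (test_family \<theta> \<xi> R \<phi> n Q)"
proof -
  \<comment> \<open>The factor \<open>\<rho> ^ n\<close> appears because the expansion evaluates
    \<open>Q\<close> on the unit sphere.\<close>
  define f where "f \<rho> = log_profile (\<xi> / 2) (2 * R) (- (\<theta> + real n) / 2) \<phi> 0 0 (\<rho>\<^sup>2) * \<rho> ^ n" for \<rho> :: real
  let ?M = "radial_measure CARD('n)" and ?b = "exp (2 * R)"
  let ?A = "{0<..?b}"
  have cf: "continuous_on UNIV f"
    unfolding f_def using R
    by (intro continuous_intros continuous_on_compose2[OF continuous_on_log_profile[of "2 * R" UNIV]]) auto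
  have "compact (f ` {0..?b})"
    using continuous_on_subset[OF cf] by (intro compact_continuous_image) auto
  then obtain B where B: "\<And>\<rho>. \<rho> \<in> {0..?b} \<Longrightarrow> \<bar>f \<rho>\<bar> \<le> B"
    using compact_imp_bounded bounded_pos by (metis image_eqI real_norm_def)
  have sp: "space ?M = {0<..}" by (simp add: radial_measure_def space_restrict_space)
  have A: "?A \<in> sets ?M"
    by (auto simp: radial_measure_def sets_restrict_space image_iff intro!: bexI[of _ ?A])
  have "f \<in> borel_measurable (restrict_space lborel {0<..})"
    using cf by (intro measurable_restrict_space1) (simp add: borel_measurable_continuous_onI)
  then have fm: "f \<in> borel_measurable ?M" by (simp add: radial_measure_def)
  have "emeasure ?M ?A = (\<integral>\<^sup>+\<rho>. ennreal (\<rho> ^ (CARD('n) - 1)) * indicator ?A \<rho> \<partial>restrict_space lborel {0<..})"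
    using A unfolding radial_measure_def
    by (intro emeasure_density) (auto intro!: measurable_restrict_space1)
  also have "\<dots> \<le> (\<integral>\<^sup>+\<rho>. ennreal (?b ^ (CARD('n) - 1)) * indicator ?A \<rho> \<partial>restrict_space lborel {0<..})"
    by (intro nn_integral_mono) (auto split: split_indicator intro!: ennreal_leI power_mono)
  also have "\<dots> = (\<integral>\<^sup>+\<rho>. ennreal (?b ^ (CARD('n) - 1)) * indicator ?A \<rho> * indicator {0<..} \<rho> \<partial>lborel)"
    by (subst nn_integral_restrict_space) auto
  also have "\<dots> = (\<integral>\<^sup>+\<rho>. ennreal (?b ^ (CARD('n) - 1)) * indicator ?A \<rho> \<partial>lborel)"
    by (intro nn_integral_cong) (auto split: split_indicator)
  also have "\<dots> < \<infinity>"
    by (subst nn_integral_cmult_indicator) (auto simp: ennreal_mult_less_top)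
  finally have "emeasure ?M ?A < \<infinity>" .
  moreover have "\<bar>f \<rho>\<bar> \<le> B * indicator ?A \<rho>" if "\<rho> \<in> space ?M" for \<rho>
  proof (cases "\<rho> \<le> ?b")
    case True
    then show ?thesis using that B[of \<rho>] sp by simp
  next
    case False
    then have "?b\<^sup>2 \<le> \<rho>\<^sup>2" by (intro power_mono) auto
    then have "exp (2 * (2 * R)) \<le> \<rho>\<^sup>2" by (simp add: power2_eq_square flip: exp_add)
    then show ?thesis using R False by (simp add: f_def log_profile_eq_0)
  qed
  ultimately have "memLp ?M p f"
    unfolding memLp_def using fm Lp_norm_finite[OF p A] by blast
  moreover have "spherical_harmonic n Q" unfolding spherical_harmonic_def using Q by blast
  moreover have "AE x in lborel. test_family \<theta> \<xi> R \<phi> n Q x = (\<Sum>i<(1::nat). f (norm x) * Q (x /\<^sub>R norm x))"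
  proof (rule eventually_mono[OF AE_lborel_singleton[of 0]])
    fix x :: "real^'n" assume x: "x \<noteq> 0"
    have "Q (x /\<^sub>R norm x) = Q x / norm x ^ n"
      using Q by (simp add: harmonic_homogeneous_poly_def homogeneous_poly_scaleR[of n Q] divide_inverse power_inverse mult.commute)
    then show "test_family \<theta> \<xi> R \<phi> n Q x = (\<Sum>i<(1::nat). f (norm x) * Q (x /\<^sub>R norm x))"
      using x by (simp add: test_family_def f_def dot_square_norm)
  qed
  ultimately show ?thesis
    unfolding in_Lpn_def
    by (intro exI[of _ "1::nat"] exI[of _ "\<lambda>_. f"] exI[of _ "\<lambda>_. Q"]) simp
qed

text \<open>\<open>Y\<close> is constant along rays, so D acts on the profile alone, as d/ds -
  \<theta>.\<close>

lemma euler_op_polar: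
  fixes u :: "real^'n \<Rightarrow> real"
  assumes u: "smooth_fun u" and v: "\<And>s. (v has_real_derivative v' s) (at s)"
    and Y: "\<And>x t. 0 < t \<Longrightarrow> Y (t *\<^sub>R x) = Y x"
    and eq: "\<And>x. x \<noteq> 0 \<Longrightarrow> u x = norm x powr (- \<theta>) * v (ln (norm x)) * Y x" and x: "x \<noteq> 0"
  shows "euler_op u x = norm x powr (- \<theta>) * (v' (ln (norm x)) - \<theta> * v (ln (norm x))) * Y x"
proof -
  have "((\<lambda>t. u (exp t *\<^sub>R x)) has_real_derivative euler_op u x) (at 0)"
    using has_derivative_along_ray[OF u x, of 0 0] x by simp
  moreover have e: "u (exp t *\<^sub>R x) = exp (- \<theta> * t) * v (t + ln (norm x)) * (norm x powr (- \<theta>) * Y x)" for t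
  proof -
    have "u (exp t *\<^sub>R x) = norm (exp t *\<^sub>R x) powr (- \<theta>) * v (ln (norm (exp t *\<^sub>R x))) * Y (exp t *\<^sub>R x)"
      using x by (intro eq) simp
    moreover have "norm (exp t *\<^sub>R x) powr (- \<theta>) = exp (- \<theta> * t) * norm x powr (- \<theta>)"
      by (simp add: powr_mult exp_powr_real mult.commute)
    moreover have "ln (norm (exp t *\<^sub>R x)) = t + ln (norm x)" using x by (simp add: ln_mult)
    ultimately show ?thesis by (simp add: Y)
  qed
  have 1: "((\<lambda>t. v (t + ln (norm x))) has_real_derivative v' (0 + ln (norm x)) * 1) (at 0)"
    by (rule DERIV_chain2[OF v]) (auto intro!: derivative_eq_intros)
  have 2: "((\<lambda>t. exp (- \<theta> * t)) has_real_derivative - \<theta>) (at 0)"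
    by (auto intro!: derivative_eq_intros)
  have "((\<lambda>t. u (exp t *\<^sub>R x)) has_real_derivative
      norm x powr (- \<theta>) * (v' (ln (norm x)) - \<theta> * v (ln (norm x))) * Y x) (at 0)"
    unfolding e
    by (rule DERIV_cong[OF DERIV_mult[OF DERIV_mult[OF 2 1] DERIV_const]]) (simp add: algebra_simps)
  ultimately show ?thesis by (rule DERIV_unique)
qed

text \<open>Substituting d/ds - \<theta> for D in the constant-coefficient operator and expanding
  gives the three coefficients.\<close>

lemma opL_polar:
  fixes u :: "real^'n \<Rightarrow> real"
  assumes u: "smooth_fun u" "in_Lpn p n u"
    and v: "\<And>s. (v has_real_derivative v' s) (at s)" "\<And>s. (v' has_real_derivative v'' s) (at s)"
    and Y: "\<And>x t. 0 < t \<Longrightarrow> Y (t *\<^sub>R x) = Y x"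
    and eq: "\<And>x. x \<noteq> 0 \<Longrightarrow> u x = norm x powr (- \<theta>) * v (ln (norm x)) * Y x" and x: "x \<noteq> 0"
  shows "(norm x)\<^sup>2 * opL b c u x = norm x powr (- \<theta>) * (v'' (ln (norm x))
    + (real CARD('n) - 2 + c - 2 * \<theta>) * v' (ln (norm x))
    - (b + lambda_n CARD('n) n + \<theta> * (real CARD('n) - 2 + c - \<theta>)) * v (ln (norm x))) * Y x"
proof -
  have 1: "euler_op u x = norm x powr (- \<theta>) * (v' (ln (norm x)) - \<theta> * v (ln (norm x))) * Y x" if "x \<noteq> 0" for x
    by (rule euler_op_polar[OF u(1) v(1) Y eq that])
  have 2: "euler_op (euler_op u) x = norm x powr (- \<theta>) * ((v'' (ln (norm x)) - \<theta> * v' (ln (norm x)))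
      - \<theta> * (v' (ln (norm x)) - \<theta> * v (ln (norm x)))) * Y x"
    by (rule euler_op_polar[OF smooth_fun_euler_op[OF u(1)] _ Y 1 x])
      (intro DERIV_diff v DERIV_cmult)
  show ?thesis
    unfolding norm_sq_opL[OF u x] 2 1[OF x] eq[OF x] by (simp add: algebra_simps)
qed

section \<open>Sharpness\<close>

lemma test_profile_derivatives:
  assumes d: "\<And>s. (bump has_real_derivative d1 s) (at s)" "\<And>s. (d1 has_real_derivative d2 s) (at s)"
  shows "(test_profile \<xi> R \<phi> has_real_derivative
      cos (\<xi> * s + \<phi>) * (d1 (s / R) / R) - \<xi> * sin (\<xi> * s + \<phi>) * bump (s / R)) (at s)" (is ?th1)
    and "((\<lambda>s. cos (\<xi> * s + \<phi>) * (d1 (s / R) / R) - \<xi> * sin (\<xi> * s + \<phi>) * bump (s / R)) has_real_derivative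
      cos (\<xi> * s + \<phi>) * (d2 (s / R) / R\<^sup>2) - 2 * \<xi> * sin (\<xi> * s + \<phi>) * (d1 (s / R) / R)
      - \<xi>\<^sup>2 * cos (\<xi> * s + \<phi>) * bump (s / R)) (at s)" (is ?th2)
proof -
  have s: "((\<lambda>s. s / R) has_real_derivative 1 / R) (at s)"
    using DERIV_cdivide[OF DERIV_ident, of R] by simp
  have c: "((\<lambda>s. cos (\<xi> * s + \<phi>)) has_real_derivative - \<xi> * sin (\<xi> * s + \<phi>)) (at s)"
    "((\<lambda>s. sin (\<xi> * s + \<phi>)) has_real_derivative \<xi> * cos (\<xi> * s + \<phi>)) (at s)"
    by (auto intro!: derivative_eq_intros)
  note b = DERIV_chain2[OF d(1) s] DERIV_chain2[OF d(2) s]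
  show ?th1 unfolding test_profile_def[abs_def]
    by (rule DERIV_cong[OF DERIV_mult[OF c(1) b(1)]]) (simp add: algebra_simps)
  show ?th2
    by (rule DERIV_cong[OF DERIV_diff[OF DERIV_mult[OF c(1) DERIV_cdivide[OF b(2)]]
          DERIV_mult[OF DERIV_cmult[OF c(2)] b(1)]]])
      (simp add: algebra_simps power2_eq_square add_divide_distrib diff_divide_distrib)
qed

text \<open>On the profile v = cos (\<xi> s + \<phi>) bump (s / R) the operator v'' + k v' - \<mu> v
  gives - (\<mu> + \<xi>^2) v, a term with coefficient k \<xi>, and terms with a derivative of
  \<open>bump\<close>, which are of order 1 / R. The hypothesis on \<open>\<xi> * k\<close> removes
  the middle one. The choice of \<open>\<theta>\<close> turns both weighted norms into
  \<open>log_norm\<close>.\<close>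

lemma not_rellich_ineq:
  fixes p :: ennreal and n :: nat and \<alpha> b c \<xi> :: real
  defines "\<theta> \<equiv> \<alpha> - 2 + real CARD('n) * inv_exp p"
  defines "k \<equiv> real CARD('n) - 2 + c - 2 * \<theta>"
  defines "\<mu> \<equiv> b + lambda_n CARD('n) n + \<theta> * (real CARD('n) - 2 + c - \<theta>)"
  assumes N: "CARD('n::finite) \<ge> 2" and p: "1 \<le> p" and \<xi>: "\<xi> * k = 0" and C: "\<bar>\<mu> + \<xi>\<^sup>2\<bar> < C"
  shows "\<not> rellich_ineq TYPE('n) p n \<alpha> b c C"
proof
  assume rel: "rellich_ineq TYPE('n) p n \<alpha> b c C"
  obtain d1 d2 M m where Mm: "0 < m" "0 < M"
    and d: "\<And>s. (bump has_real_derivative d1 s) (at s)" "\<And>s. (d1 has_real_derivative d2 s) (at s)"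
    and bM: "\<And>s. \<bar>bump s\<bar> \<le> M * indicator {1..2} s" "\<And>s. \<bar>d1 s\<bar> \<le> M * indicator {1..2} s"
      "\<And>s. \<bar>d2 s\<bar> \<le> M * indicator {1..2} s"
    and bm: "\<And>s. s \<in> {4/3..5/3} \<Longrightarrow> m \<le> bump s"
    using bump_derivatives by metis
  obtain Q :: "real^'n \<Rightarrow> real" and x0 where Q: "harmonic_homogeneous_poly n Q" "Q x0 \<noteq> 0" "norm x0 = 1"
    using exists_harmonic_homogeneous_poly[OF N] by metis
  have hQ: "homogeneous_poly n Q" using Q by (simp add: harmonic_homogeneous_poly_def)
  have sQ: "smooth_fun Q" by (rule smooth_fun_homogeneous_poly[OF hQ])
  define Y where "Y x = Q x / norm x ^ n" for x
  have Ys: "Y (t *\<^sub>R x) = Y x" if "0 < t" for x t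
    using that by (simp add: Y_def homogeneous_poly_scaleR[OF hQ] power_mult_distrib)
  have Yc: "continuous_on (- {0}) Y"
    unfolding Y_def by (intro continuous_intros smooth_fun_continuous sQ) auto
  have Ym: "Y \<in> borel_measurable borel" by (rule continuous_off_origin_borel[OF Yc])
  have "compact (Y ` sphere 0 1)"
    using continuous_on_subset[OF Yc] by (intro compact_continuous_image) auto
  then obtain K where K: "0 < K" "\<And>x. x \<in> sphere 0 1 \<Longrightarrow> \<bar>Y x\<bar> \<le> K"
    using compact_imp_bounded bounded_pos by (metis image_eqI real_norm_def)
  \<comment> \<open>Scaling to the unit sphere does not reach the origin, so the value there is
    added to the bound.\<close>
  have Yb: "\<bar>Y x\<bar> \<le> K + \<bar>Y 0\<bar>" for x
  proof (cases "x = 0")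
    case False
    then have "Y x = Y (x /\<^sub>R norm x)" using Ys[of "inverse (norm x)" x] by simp
    moreover have "x /\<^sub>R norm x \<in> sphere 0 1" using False by simp
    ultimately show ?thesis using K(2)[of "x /\<^sub>R norm x"] by simp
  qed (use K in simp)
  have Ys': "\<forall>t>0. \<forall>x. Y (t *\<^sub>R x) = Y x" using Ys by blast
  note LN = log_norm_mono[OF p Ym Yb Ys'] log_norm_triangle[OF p Ym Yb Ys'] log_norm_cmult[OF p Ym Yb Ys']
    log_norm_finite[OF p Ym Yb Ys'] log_norm_pos[OF p Ym Yb Ys'] log_norm_indicator_triple[OF p Ym Yb Ys']
  define c0 where "c0 = \<bar>\<mu> + \<xi>\<^sup>2\<bar>"
  \<comment> \<open>\<open>L\<close> collects the coefficients of the derivatives of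
    \<open>bump\<close>: 1 for the second, |k| + 2 |\<xi>| for the first. \<open>R\<close> is such
    that (C - c0) m R exceeds 6 L M; the 6 is two phases times the three translates in
    \<open>log_norm_indicator_triple\<close>.\<close>
  define L where "L = 1 + \<bar>k\<bar> + 2 * \<bar>\<xi>\<bar>"
  define R where "R = 1 + 6 * L * M / ((C - c0) * m)"
  have Cc: "0 < C - c0" "0 \<le> c0" "0 < C" using C by (auto simp: c0_def)
  have L: "1 \<le> L" by (simp add: L_def)
  have R: "1 \<le> R" using Cc Mm L by (simp add: R_def)
  define e where "e = L * M / R"
  have e0: "0 \<le> e" using L Mm R by (simp add: e_def)
  define v where "v \<phi> = test_profile \<xi> R \<phi>" for \<phi>
  let ?I = "indicator {R..2 * R} :: real \<Rightarrow> real" and ?J = "indicator {4 * R / 3..5 * R / 3} :: real \<Rightarrow> real"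
  have ind: "indicator {1..2} (s / R) = ?I s" for s
    using R by (auto simp: indicator_def field_simps)
  have vm: "v \<phi> \<in> borel_measurable borel" for \<phi>
    unfolding v_def using test_profile_derivatives(1)[OF d]
    by (intro borel_measurable_continuous_onI) (meson DERIV_isCont continuous_at_imp_continuous_on)
  have vb: "\<bar>v \<phi> s\<bar> \<le> M * indicator {R..2 * R} s" for \<phi> s
  proof -
    have "\<bar>v \<phi> s\<bar> \<le> 1 * \<bar>bump (s / R)\<bar>"
      unfolding v_def test_profile_def abs_mult by (intro mult_right_mono) auto
    then show ?thesis using bM(1)[of "s / R"] by (simp add: ind)
  qed
  have abs_v: "log_norm p Y (\<lambda>s. \<bar>v \<phi> s\<bar>) = log_norm p Y (v \<phi>)" for \<phi>
    by (intro antisym LN(1)) auto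
  have key: "ennreal C * log_norm p Y (v \<phi>) \<le> ennreal c0 * log_norm p Y (v \<phi>) + ennreal e * log_norm p Y ?I" for \<phi>
  proof -
    let ?u = "test_family \<theta> \<xi> R \<phi> n Q"
    define v1 where "v1 s = cos (\<xi> * s + \<phi>) * (d1 (s / R) / R) - \<xi> * sin (\<xi> * s + \<phi>) * bump (s / R)" for s
    define v2 where "v2 s = cos (\<xi> * s + \<phi>) * (d2 (s / R) / R\<^sup>2) - 2 * \<xi> * sin (\<xi> * s + \<phi>) * (d1 (s / R) / R)
      - \<xi>\<^sup>2 * cos (\<xi> * s + \<phi>) * bump (s / R)" for s
    define T where "T s = v2 s + k * v1 s - \<mu> * v \<phi> s" for s
    have dv: "(v \<phi> has_real_derivative v1 s) (at s)" "(v1 has_real_derivative v2 s) (at s)" for s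
      unfolding v_def v1_def[abs_def] v2_def using test_profile_derivatives[OF d] by blast+
    have u: "test_fun ?u" "in_Lpn p n ?u"
      using R Q(1) sQ p by (auto intro: test_fun_test_family in_Lpn_test_family)
    have eq: "?u x = norm x powr (- \<theta>) * v \<phi> (ln (norm x)) * Y x" if "x \<noteq> 0" for x
      unfolding v_def Y_def using R that by (intro test_family_polar) auto
    have w1: "(\<lambda>x. norm x powr (\<alpha> - 2) * ?u x)
        = (\<lambda>x. norm x powr (- real DIM(real^'n) * inv_exp p) * v \<phi> (ln (norm x)) * Y x)"
    proof
      fix x :: "real^'n"
      have "norm x powr (\<alpha> - 2) * norm x powr (- \<theta>) = norm x powr (- real DIM(real^'n) * inv_exp p)"
        by (simp add: \<theta>_def flip: powr_add)
      then show "norm x powr (\<alpha> - 2) * ?u x = norm x powr (- real DIM(real^'n) * inv_exp p) * v \<phi> (ln (norm x)) * Y x"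
        by (cases "x = 0") (simp_all add: eq flip: mult.assoc)
    qed
    have w2: "(\<lambda>x. norm x powr \<alpha> * opL b c ?u x)
        = (\<lambda>x. norm x powr (- real DIM(real^'n) * inv_exp p) * T (ln (norm x)) * Y x)"
    proof
      fix x :: "real^'n"
      show "norm x powr \<alpha> * opL b c ?u x = norm x powr (- real DIM(real^'n) * inv_exp p) * T (ln (norm x)) * Y x"
      proof (cases "x = 0")
        case False
        have "norm x powr \<alpha> = norm x powr (\<alpha> - 2) * (norm x)\<^sup>2"
          using False powr_add[of "norm x" "\<alpha> - 2" 2] by simp
        then have "norm x powr \<alpha> * opL b c ?u x = norm x powr (\<alpha> - 2) * ((norm x)\<^sup>2 * opL b c ?u x)" by simp
        also have "(norm x)\<^sup>2 * opL b c ?u x = norm x powr (- \<theta>) * T (ln (norm x)) * Y x"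
          unfolding T_def k_def \<mu>_def
          by (rule opL_polar[OF _ u(2) dv Ys eq False]) (use u(1) in \<open>auto simp: test_fun_def\<close>)
        also have "norm x powr (\<alpha> - 2) * (norm x powr (- \<theta>) * T (ln (norm x)) * Y x)
            = (norm x powr (\<alpha> - 2) * norm x powr (- \<theta>)) * T (ln (norm x)) * Y x" by simp
        also have "norm x powr (\<alpha> - 2) * norm x powr (- \<theta>) = norm x powr (- real DIM(real^'n) * inv_exp p)"
          by (simp add: \<theta>_def flip: powr_add)
        finally show ?thesis .
      qed simp
    qed
    have "ennreal C * log_norm p Y (v \<phi>) \<le> log_norm p Y T"
      using rel u unfolding rellich_ineq_def log_norm_def w1[symmetric] w2[symmetric] by blast
    also have "\<dots> \<le> log_norm p Y (\<lambda>s. c0 * \<bar>v \<phi> s\<bar> + e * ?I s)"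
    proof (rule LN(1))
      fix s
      let ?c = "cos (\<xi> * s + \<phi>)" and ?s = "sin (\<xi> * s + \<phi>)"
      have kx: "k * \<xi> = 0" using \<xi> by (simp add: mult.commute)
      have "T s = (?c * d2 (s / R) / R\<^sup>2 + (k * ?c - 2 * \<xi> * ?s) * d1 (s / R) / R)
          - (\<mu> + \<xi>\<^sup>2) * v \<phi> s - (k * \<xi>) * ?s * bump (s / R)"
        by (simp add: T_def v1_def v2_def v_def test_profile_def algebra_simps add_divide_distrib diff_divide_distrib)
      also have "\<dots> = (?c * d2 (s / R) / R\<^sup>2 + (k * ?c - 2 * \<xi> * ?s) * d1 (s / R) / R) - (\<mu> + \<xi>\<^sup>2) * v \<phi> s"
        unfolding kx by simp
      finally have "\<bar>T s\<bar> \<le> \<bar>?c * d2 (s / R) / R\<^sup>2\<bar> + \<bar>(k * ?c - 2 * \<xi> * ?s) * d1 (s / R) / R\<bar> + c0 * \<bar>v \<phi> s\<bar>"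
        unfolding c0_def abs_mult[symmetric] by linarith
      moreover have "\<bar>?c * d2 (s / R) / R\<^sup>2\<bar> \<le> M * ?I s / R"
      proof -
        \<comment> \<open>As \<open>R \<ge> 1\<close>, the order 1 / R^2 is weakened to 1 / R, so
          that all errors fit into \<open>e\<close>.\<close>
        have "\<bar>?c * d2 (s / R) / R\<^sup>2\<bar> = \<bar>?c\<bar> * \<bar>d2 (s / R)\<bar> / R\<^sup>2" using R by (simp add: abs_mult)
        also have "\<dots> \<le> 1 * (M * ?I s) / R"
          using bM(3)[of "s / R"] R Mm
          by (intro frac_le mult_mono) (auto simp: ind self_le_power)
        finally show ?thesis by simp
      qed
      moreover have "\<bar>(k * ?c - 2 * \<xi> * ?s) * d1 (s / R) / R\<bar> \<le> (\<bar>k\<bar> + 2 * \<bar>\<xi>\<bar>) * (M * ?I s) / R"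
      proof -
        have "\<bar>k * ?c - 2 * \<xi> * ?s\<bar> \<le> \<bar>k\<bar> * \<bar>?c\<bar> + 2 * \<bar>\<xi>\<bar> * \<bar>?s\<bar>"
          using abs_triangle_ineq4[of "k * ?c" "2 * \<xi> * ?s"] by (simp add: abs_mult)
        also have "\<dots> \<le> \<bar>k\<bar> * 1 + 2 * \<bar>\<xi>\<bar> * 1"
          by (intro add_mono mult_left_mono) auto
        finally have "\<bar>k * ?c - 2 * \<xi> * ?s\<bar> * \<bar>d1 (s / R)\<bar> / R \<le> (\<bar>k\<bar> + 2 * \<bar>\<xi>\<bar>) * (M * ?I s) / R"
          using bM(2)[of "s / R"] R Mm by (intro divide_right_mono mult_mono) (auto simp: ind)
        then show ?thesis using R by (simp add: abs_mult)
      qed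
      ultimately have "\<bar>T s\<bar> \<le> M * ?I s / R + (\<bar>k\<bar> + 2 * \<bar>\<xi>\<bar>) * (M * ?I s) / R + c0 * \<bar>v \<phi> s\<bar>"
        by linarith
      also have "\<dots> = c0 * \<bar>v \<phi> s\<bar> + e * ?I s"
        by (simp add: e_def L_def algebra_simps add_divide_distrib)
      finally show "\<bar>T s\<bar> \<le> \<bar>c0 * \<bar>v \<phi> s\<bar> + e * ?I s\<bar>" by linarith
    qed
    also have "\<dots> \<le> log_norm p Y (\<lambda>s. c0 * \<bar>v \<phi> s\<bar>) + log_norm p Y (\<lambda>s. e * ?I s)"
      by (intro LN(2)) (use vm in measurable)
    also have "\<dots> \<le> ennreal \<bar>c0\<bar> * log_norm p Y (\<lambda>s. \<bar>v \<phi> s\<bar>) + ennreal \<bar>e\<bar> * log_norm p Y ?I"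
      by (intro add_mono LN(3)) (use vm in measurable)
    finally show ?thesis using e0 Cc by (simp add: abs_v)
  qed
  \<comment> \<open>Finiteness turns the norms into real numbers, so that the \<open>c0\<close> term
    of \<open>key\<close> can be moved to the left and \<open>j\<close> cancelled.\<close>
  have finI: "log_norm p Y ?I < \<infinity>" by (rule LN(4)[of _ 1 R "2 * R"]) auto
  have finJ: "log_norm p Y ?J < \<infinity>" by (rule LN(4)[of _ 1 "4 * R / 3" "5 * R / 3"]) auto
  have finv: "log_norm p Y (v \<phi>) < \<infinity>" for \<phi> by (rule LN(4)[OF vb])
  \<comment> \<open>The two phases are needed because \<open>\<bar>cos\<bar> + \<bar>sin\<bar> \<ge> 1\<close>, while one cosine alone has zeros.\<close>
  have Jle: "log_norm p Y ?J \<le> ennreal (1 / m) * (log_norm p Y (v 0) + log_norm p Y (v (pi / 2)))"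
  proof -
    have "log_norm p Y ?J \<le> log_norm p Y (\<lambda>s. 1 / m * (\<bar>v 0 s\<bar> + \<bar>v (pi / 2) s\<bar>))"
    proof (rule LN(1))
      fix s
      show "\<bar>?J s\<bar> \<le> \<bar>1 / m * (\<bar>v 0 s\<bar> + \<bar>v (pi / 2) s\<bar>)\<bar>"
      proof (cases "s \<in> {4 * R / 3..5 * R / 3}")
        case True
        then have "s / R \<in> {4 / 3..5 / 3}" using R by (auto simp: field_simps)
        from bm[OF this] have b: "m \<le> bump (s / R)" .
        have q: "t\<^sup>2 \<le> \<bar>t\<bar>" if "\<bar>t\<bar> \<le> 1" for t :: real
          using that mult_right_mono[of "\<bar>t\<bar>" 1 "\<bar>t\<bar>"] by (simp add: power2_eq_square abs_mult_self_eq)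
        have "1 = (cos (\<xi> * s))\<^sup>2 + (sin (\<xi> * s))\<^sup>2" by simp
        also have "\<dots> \<le> \<bar>cos (\<xi> * s)\<bar> + \<bar>sin (\<xi> * s)\<bar>" by (intro add_mono q) auto
        finally have "1 * bump (s / R) \<le> (\<bar>cos (\<xi> * s)\<bar> + \<bar>sin (\<xi> * s)\<bar>) * bump (s / R)"
          using b Mm by (intro mult_right_mono) auto
        also have "\<dots> = \<bar>v 0 s\<bar> + \<bar>v (pi / 2) s\<bar>"
          using b Mm by (simp add: v_def test_profile_def abs_mult distrib_right cos_add)
        finally have "m \<le> \<bar>v 0 s\<bar> + \<bar>v (pi / 2) s\<bar>" using b by simp
        then show ?thesis using True Mm by (simp add: field_simps)
      qed simp
    qed
    also have "\<dots> \<le> ennreal \<bar>1 / m\<bar> * log_norm p Y (\<lambda>s. \<bar>v 0 s\<bar> + \<bar>v (pi / 2) s\<bar>)"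
      by (intro LN(3)) (use vm in measurable)
    also have "\<dots> \<le> ennreal \<bar>1 / m\<bar> * (log_norm p Y (\<lambda>s. \<bar>v 0 s\<bar>) + log_norm p Y (\<lambda>s. \<bar>v (pi / 2) s\<bar>))"
      by (intro mult_left_mono LN(2)) (use vm in measurable)
    finally show ?thesis using Mm by (simp add: abs_v)
  qed
  obtain i where i: "0 \<le> i" "log_norm p Y ?I = ennreal i" using finI by (cases "log_norm p Y ?I") auto
  obtain j where j: "0 \<le> j" "log_norm p Y ?J = ennreal j" using finJ by (cases "log_norm p Y ?J") auto
  obtain a0 where a0: "0 \<le> a0" "log_norm p Y (v 0) = ennreal a0"
    using finv[of 0] by (cases "log_norm p Y (v 0)") auto
  obtain a1 where a1: "0 \<le> a1" "log_norm p Y (v (pi / 2)) = ennreal a1"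
    using finv[of "pi / 2"] by (cases "log_norm p Y (v (pi / 2))") auto
  have "log_norm p Y ?J \<noteq> 0"
    using R Q(2,3) by (intro LN(5)[of _ _ x0] Yc) (auto simp: Y_def)
  then have j0: "0 < j" using j by (simp add: ennreal_eq_0_iff)
  have ij: "i \<le> 3 * j"
  proof -
    have "ennreal i \<le> ennreal (3 * j)"
      using LN(6)[of R] R i j by (simp add: ennreal_mult)
    then show ?thesis using j by simp
  qed
  have ja: "m * j \<le> a0 + a1"
  proof -
    have "ennreal j \<le> ennreal (1 / m * (a0 + a1))"
      using Jle j a0 a1 Mm by (simp flip: ennreal_plus ennreal_mult)
    then show ?thesis using a0 a1 Mm by (simp add: field_simps)
  qed
  have k0: "C * a \<le> c0 * a + e * i" if "0 \<le> a" "log_norm p Y (v \<phi>) = ennreal a" for a \<phi>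
  proof -
    have "ennreal (C * a) \<le> ennreal (c0 * a + e * i)"
      using key[of \<phi>] that i Cc e0 by (simp flip: ennreal_plus ennreal_mult)
    moreover have "0 \<le> c0 * a + e * i" using that i Cc e0 by simp
    ultimately show ?thesis using ennreal_le_iff by blast
  qed
  \<comment> \<open>Adding the estimates for the two phases leaves only the errors on the right;
    \<open>ja\<close> and \<open>ij\<close> then express both sides through
    \<open>j > 0\<close>.\<close>
  have "(C - c0) * (m * j) \<le> (C - c0) * (a0 + a1)"
    using ja Cc by (intro mult_left_mono) auto
  also have "\<dots> \<le> 2 * (e * i)"
    using k0[OF a0] k0[OF a1] by (simp add: algebra_simps)
  also have "\<dots> \<le> 2 * (e * (3 * j))"
    using ij e0 by (intro mult_left_mono) auto
  finally have "((C - c0) * m) * j \<le> (6 * e) * j" by (simp add: algebra_simps)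
  then have "(C - c0) * m \<le> 6 * e" using j0 by simp
  then have "(C - c0) * m * R \<le> 6 * L * M" using R by (simp add: e_def field_simps)
  moreover have "(C - c0) * m * R = (C - c0) * m + 6 * L * M"
    using Cc Mm by (simp add: R_def distrib_left)
  moreover have "0 < (C - c0) * m" using Cc Mm by simp
  ultimately show False by linarith
qed

section \<open>The optimal constant and the parabola criterion\<close>

lemma rellich_sharp:
  fixes p :: ennreal and n :: nat and \<alpha> b c :: real
  assumes N: "CARD('n::finite) \<ge> 2" and p: "1 \<le> p"
    and disc: "b + lambda_n CARD('n) n + (real CARD('n) / 2 - 1 + c / 2)^2 \<ge> 0"
  defines "C0 \<equiv> \<bar>b + lambda_n CARD('n) n + gamma_p CARD('n) p \<alpha> c\<bar>"
  shows "rellich_ineq TYPE('n) p n \<alpha> b c C0" "C0 < C \<Longrightarrow> \<not> rellich_ineq TYPE('n) p n \<alpha> b c C"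
proof -
  define \<theta> where "\<theta> = \<alpha> - 2 + real CARD('n) * inv_exp p"
  \<comment> \<open>\<open>2 * h\<close> is the coefficient of D in the characteristic polynomial,
    so its roots are \<open>- h + d\<close> and \<open>- h - d\<close>; the hypothesis
    \<open>disc\<close> makes them real.\<close>
  define h where "h = real CARD('n) / 2 - 1 + c / 2"
  define d where "d = sqrt (b + lambda_n CARD('n) n + h\<^sup>2)"
  have d2: "d * d = b + lambda_n CARD('n) n + h\<^sup>2" using disc by (simp add: d_def h_def)
  have g: "gamma_p CARD('n) p \<alpha> c = \<theta> * (2 * h - \<theta>)"
    by (simp add: gamma_p_def \<theta>_def h_def algebra_simps)
  have "C0 = \<bar>- h + d + \<theta>\<bar> * \<bar>- h - d + \<theta>\<bar>"
  proof -
    have "(- h + d + \<theta>) * (- h - d + \<theta>) = - (b + lambda_n CARD('n) n + gamma_p CARD('n) p \<alpha> c)"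
      using d2 by (simp add: g algebra_simps power2_eq_square)
    then show ?thesis by (simp add: C0_def flip: abs_mult)
  qed
  moreover have "ennreal (\<bar>Re (of_real (- h + d)) + \<theta>\<bar> * \<bar>Re (of_real (- h - d)) + \<theta>\<bar>)
      * Lp_norm lborel p (\<lambda>x. norm x powr (\<alpha> - 2) * u x) \<le> Lp_norm lborel p (\<lambda>x. norm x powr \<alpha> * opL b c u x)"
    if "test_fun u" "in_Lpn p n u" for u :: "real^'n \<Rightarrow> real"
  proof (rule rellich_lower_bound[OF p that _ _ \<theta>_def])
    show "complex_of_real (- h + d) + of_real (- h - d) = - of_real (real CARD('n) - 2 + c)"
      unfolding of_real_add[symmetric] of_real_minus[symmetric] of_real_eq_iff by (simp add: h_def)
    have "(- h + d) * (- h - d) = - (b + lambda_n CARD('n) n)"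
      using d2 by (simp add: algebra_simps power2_eq_square)
    then show "complex_of_real (- h + d) * of_real (- h - d) = - of_real (b + lambda_n CARD('n) n)"
      unfolding of_real_mult[symmetric] of_real_minus[symmetric] of_real_eq_iff by simp
  qed
  ultimately show "rellich_ineq TYPE('n) p n \<alpha> b c C0"
    unfolding rellich_ineq_def by simp
  show "\<not> rellich_ineq TYPE('n) p n \<alpha> b c C" if "C0 < C"
  \<comment> \<open>Frequency 0 satisfies \<open>\<xi> * k = 0\<close> for every \<open>k\<close>,
    and its threshold is exactly \<open>C0\<close>.\<close>
  proof (rule not_rellich_ineq[OF N p, where \<xi> = 0])
    have "2 * h = real CARD('n) - 2 + c" by (simp add: h_def)
    with that show "\<bar>b + lambda_n CARD('n) n + (\<alpha> - 2 + real CARD('n) * inv_exp p)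
        * (real CARD('n) - 2 + c - (\<alpha> - 2 + real CARD('n) * inv_exp p)) + 0\<^sup>2\<bar> < C"
      by (simp add: C0_def g \<theta>_def)
  qed simp
qed

lemma rellich_iff:
  fixes p :: ennreal and n :: nat and \<alpha> b c :: real
  assumes N: "CARD('n::finite) \<ge> 2" and p: "1 \<le> p"
  shows "(\<exists>C>0. rellich_ineq TYPE('n) p n \<alpha> b c C)
    \<longleftrightarrow> complex_of_real (b + lambda_n CARD('n) n) \<notin> parabola_P CARD('n) p \<alpha> c"
proof -
  define \<theta> where "\<theta> = \<alpha> - 2 + real CARD('n) * inv_exp p"
  define h where "h = real CARD('n) / 2 - 1 + c / 2"
  define k where "k = real CARD('n) - 2 + c - 2 * \<theta>"
  define \<mu> where "\<mu> = b + lambda_n CARD('n) n + gamma_p CARD('n) p \<alpha> c"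
  have g: "gamma_p CARD('n) p \<alpha> c = \<theta> * (real CARD('n) - 2 + c - \<theta>)"
    by (simp add: gamma_p_def \<theta>_def algebra_simps)
  have kh: "k = 2 * (h - \<theta>)" by (simp add: k_def h_def)
  have mk: "\<mu> + (h - \<theta>)\<^sup>2 = b + lambda_n CARD('n) n + h\<^sup>2"
    by (simp add: \<mu>_def g h_def power2_eq_square algebra_simps)
  \<comment> \<open>A point of the parabola is real when its imaginary part \<open>t * k\<close> is
    0: for \<open>k \<noteq> 0\<close> this leaves only the vertex \<open>- gamma_p\<close>, while
    for \<open>k = 0\<close> the parabola degenerates to the half-line to the left of it.\<close>
  have par: "complex_of_real (b + lambda_n CARD('n) n) \<in> parabola_P CARD('n) p \<alpha> c
      \<longleftrightarrow> (\<exists>t. t * k = 0 \<and> \<mu> + t\<^sup>2 = 0)"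
  proof -
    have k': "real CARD('n) * (1 - 2 * inv_exp p) + 2 - 2 * \<alpha> + c = k"
      by (simp add: k_def \<theta>_def algebra_simps)
    show ?thesis
      unfolding parabola_P_def k' image_iff
      by (auto simp: complex_eq_iff \<mu>_def eq_neg_iff_add_eq_0 algebra_simps)
  qed
  show ?thesis
  proof
    assume "\<exists>C>0. rellich_ineq TYPE('n) p n \<alpha> b c C"
    then obtain C where C: "0 < C" "rellich_ineq TYPE('n) p n \<alpha> b c C" by blast
    show "complex_of_real (b + lambda_n CARD('n) n) \<notin> parabola_P CARD('n) p \<alpha> c"
    proof
      assume "complex_of_real (b + lambda_n CARD('n) n) \<in> parabola_P CARD('n) p \<alpha> c"
      then obtain t where t: "t * k = 0" "\<mu> + t\<^sup>2 = 0" unfolding par by blast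
      \<comment> \<open>The parabola parameter \<open>t\<close> serves as the frequency of the test
        functions; their threshold is |\<mu> + t^2| = 0, below every positive
        \<open>C\<close>.\<close>
      have "\<not> rellich_ineq TYPE('n) p n \<alpha> b c C"
        using t C(1) by (intro not_rellich_ineq[OF N p, where \<xi> = t])
          (simp_all add: k_def \<mu>_def g \<theta>_def)
      then show False using C by blast
    qed
  next
    assume np: "complex_of_real (b + lambda_n CARD('n) n) \<notin> parabola_P CARD('n) p \<alpha> c"
    show "\<exists>C>0. rellich_ineq TYPE('n) p n \<alpha> b c C"
    proof (cases "b + lambda_n CARD('n) n + h\<^sup>2 \<ge> 0")
      case True
      have "\<mu> \<noteq> 0" using np unfolding par by (metis add_0_right mult_zero_left power_zero_numeral)
      then show ?thesis
        using rellich_sharp(1)[OF N p, of b n c \<alpha>] True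
        by (intro exI[of _ "\<bar>\<mu>\<bar>"]) (simp add: \<mu>_def h_def)
    next
      case False
      \<comment> \<open>The roots are -h plus or minus \<i> d, so the constant obtained below is (h
        - \<theta>)^2. If it were 0, then \<open>k = 0\<close> and \<open>\<mu> < 0\<close>, and
        \<open>t = sqrt (- \<mu>)\<close> would give a point of the parabola.\<close>
      have kn: "h - \<theta> \<noteq> 0"
      proof
        assume ht: "h - \<theta> = 0"
        then have "\<mu> < 0" using mk False by simp
        then have "sqrt (- \<mu>) * k = 0 \<and> \<mu> + (sqrt (- \<mu>))\<^sup>2 = 0" using ht by (simp add: kh)
        then show False using np par by blast
      qed
      define d where "d = sqrt (- (b + lambda_n CARD('n) n + h\<^sup>2))"
      have d2: "d * d = - (b + lambda_n CARD('n) n + h\<^sup>2)" using False by (simp add: d_def)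
      have "ennreal (\<bar>Re (Complex (- h) d) + \<theta>\<bar> * \<bar>Re (Complex (- h) (- d)) + \<theta>\<bar>)
          * Lp_norm lborel p (\<lambda>x. norm x powr (\<alpha> - 2) * u x) \<le> Lp_norm lborel p (\<lambda>x. norm x powr \<alpha> * opL b c u x)"
        if "test_fun u" "in_Lpn p n u" for u :: "real^'n \<Rightarrow> real"
        by (rule rellich_lower_bound[OF p that _ _ \<theta>_def])
          (use d2 in \<open>auto simp: complex_eq_iff h_def power2_eq_square algebra_simps\<close>)
      then have "rellich_ineq TYPE('n) p n \<alpha> b c (\<bar>- h + \<theta>\<bar> * \<bar>- h + \<theta>\<bar>)"
        unfolding rellich_ineq_def by simp
      moreover have "0 < \<bar>- h + \<theta>\<bar> * \<bar>- h + \<theta>\<bar>" using kn by (intro mult_pos_pos) auto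
      ultimately show ?thesis by blast
    qed
  qed
qed

theorem mainTheorem18:
  fixes p :: ennreal and n :: nat and \<alpha> b c :: real
  assumes "CARD('n::finite) \<ge> 2"
    and "1 \<le> p"
  shows "((\<exists>C>0. rellich_ineq TYPE('n) p n \<alpha> b c C)
            \<longleftrightarrow> complex_of_real (b + lambda_n CARD('n) n) \<notin> parabola_P CARD('n) p \<alpha> c)
    \<and> (b + lambda_n CARD('n) n + (real CARD('n) / 2 - 1 + c / 2)^2 \<ge> 0 \<longrightarrow>
         (let C0 = \<bar>b + lambda_n CARD('n) n + gamma_p CARD('n) p \<alpha> c\<bar> in
           rellich_ineq TYPE('n) p n \<alpha> b c C0
           \<and> (\<forall>C>C0. \<not> rellich_ineq TYPE('n) p n \<alpha> b c C)))
    \<and> ((\<exists>C>0. rellich_ineq TYPE('n) p n \<alpha> 0 0 C)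
            \<longleftrightarrow> \<alpha> \<noteq> real CARD('n) * (1 - inv_exp p) + real n
                \<and> \<alpha> \<noteq> - real CARD('n) * inv_exp p + 2 - real n)
    \<and> (let C0 = \<bar>(real CARD('n) * inv_exp p - 2 + \<alpha> + real n)
                  * (real CARD('n) * (1 - inv_exp p) - \<alpha> + real n)\<bar> in
           rellich_ineq TYPE('n) p n \<alpha> 0 0 C0
           \<and> (\<forall>C>C0. \<not> rellich_ineq TYPE('n) p n \<alpha> 0 0 C))"
proof -
  define C0 where "C0 = \<bar>(real CARD('n) * inv_exp p - 2 + \<alpha> + real n)
    * (real CARD('n) * (1 - inv_exp p) - \<alpha> + real n)\<bar>"
  \<comment> \<open>For \<open>c = 0\<close> the two factors of \<open>gamma_p\<close> add up to N -
    2, so increasing each by n adds n (N - 2) + n^2 = lambda_n to their product.\<close>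
  have "0 + lambda_n CARD('n) n + gamma_p CARD('n) p \<alpha> 0
      = (real CARD('n) * inv_exp p - 2 + \<alpha> + real n) * (real CARD('n) * (1 - inv_exp p) - \<alpha> + real n)"
    by (simp add: lambda_n_def gamma_p_def algebra_simps)
  then have C0: "\<bar>0 + lambda_n CARD('n) n + gamma_p CARD('n) p \<alpha> 0\<bar> = C0"
    unfolding C0_def by (rule arg_cong)
  \<comment> \<open>For b = c = 0 the discriminant is a perfect square, so the sharp result always
    applies.\<close>
  have "0 + lambda_n CARD('n) n + (real CARD('n) / 2 - 1 + 0 / 2)\<^sup>2 = (real n + (real CARD('n) / 2 - 1))\<^sup>2"
    by (simp add: lambda_n_def power2_eq_square algebra_simps)
  then have disc: "0 + lambda_n CARD('n) n + (real CARD('n) / 2 - 1 + 0 / 2)\<^sup>2 \<ge> 0"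
    by simp
  note sharp = rellich_sharp[OF assms disc, of \<alpha>, unfolded C0]
  \<comment> \<open>The criterion is read off from the optimal constant: if \<open>C0 = 0\<close>,
    every positive constant already exceeds it.\<close>
  have iff: "(\<exists>C>0. rellich_ineq TYPE('n) p n \<alpha> 0 0 C) \<longleftrightarrow> C0 \<noteq> 0"
  proof
    assume "\<exists>C>0. rellich_ineq TYPE('n) p n \<alpha> 0 0 C"
    then show "C0 \<noteq> 0" using sharp(2) by auto
  next
    assume "C0 \<noteq> 0"
    then have "0 < C0" by (simp add: C0_def)
    then show "\<exists>C>0. rellich_ineq TYPE('n) p n \<alpha> 0 0 C" using sharp(1) by blast
  qed
  have C0_iff: "C0 \<noteq> 0 \<longleftrightarrow> \<alpha> \<noteq> real CARD('n) * (1 - inv_exp p) + real n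
      \<and> \<alpha> \<noteq> - real CARD('n) * inv_exp p + 2 - real n"
    by (auto simp: C0_def)
  show ?thesis
    unfolding Let_def C0_def[symmetric] iff C0_iff
    using rellich_iff[OF assms] rellich_sharp[OF assms] sharp by simp
qed

end
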